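(* Let $(a_1,b_1)$ and $(a_2,b_2)$ be bi-free, bi-partite, self-adjoint two-faced pairs in a $C^*$-noncommutative probability space. Let $\eta_j$ be the distribution of $(a_j,b_j)$, and let $\mu_j$ and $\nu_j$ be its first and second marginal, respectively. Assume that there exists a point $(\xi,\zeta)\in\mathbb R^2$ such that $(\eta_1\boxplus\boxplus\eta_2)(\{(\xi,\zeta)\})>0$. Then there exist $(\xi_j,\zeta_j)\in\mathbb R^2$, $j=1,2$, such that $(\xi_1+\xi_2,\zeta_1+\zeta_2)=(\xi,\zeta)$ and $\eta_j(\{(\xi_j,\zeta_j)\})>0$ for $j=1,2$. Moreover, $$1+\frac{(\mu_1\boxplus\mu_2)(\{\xi\})\,(\nu_1\boxplus\nu_2)(\{\zeta\})}{(\eta_1\boxplus\boxplus\eta_2)(\{(\xi,\zeta)\})}=\frac{\mu_1(\{\xi_1\})\nu_1(\{\zeta_1\})}{\eta_1(\{(\xi_1,\zeta_1)\})}+\frac{\mu_2(\{\xi_2\})\nu_2(\{\zeta_2\})}{\eta_2(\{(\xi_2,\zeta_2)\})}.$$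
   Context: A $C^*$-noncommutative probability space $(\mathcal A,\varphi)$ is a unital $C^*$-algebra with a faithful state. A two-faced pair $(a,b)\in\mathcal A^2$ is self-adjoint if $a=a^*,b=b^*$, and bi-partite if $ab=ba$. Bi-freeness: given vector spaces with state vectors $\mathcal X_j=\mathbb C\xi_j\oplus\mathcal X_j^\circ$, $j=1,2$, their free product is $\mathcal X=\mathbb C\xi\oplus\bigoplus_{n\ge1}\bigoplus_{i_1\ne i_2\ne\cdots\ne i_n}\mathcal X^\circ_{i_1}\otimes\cdots\otimes\mathcal X^\circ_{i_n}$. Let $\mathcal X(\ell,j)$ (resp. $\mathcal X(r,j)$) be the sum of $\mathbb C\xi$ and the summands with $i_1\ne j$ (resp. $i_n\neq j$), with natural isomorphisms $V_j:\mathcal X_j\otimes\mathcal X(\ell,j)\to\mathcal X$ and $W_j:\mathcal X(r,j)\otimes\mathcal X_j\to\mathcal X$, and $\lambda_j(T)=V_j(T\otimes I)V_j^{-1}$, $\rho_j(T)=W_j(I\otimes T)W_j^{-1}$ for linear $T$ on $\mathcal X_j$. Let $\varphi_\xi(T)$ be the $\xi$-coefficient of $T\xi$. Pairs $(a_1,b_1),(a_2,b_2)$ are bi-free with respect to $\varphi$ if there exist such $\mathcal X_1,\mathcal X_2$ and linear operators $T_j,S_j$ on $\mathcal X_j$ such that the joint moments of $a_1,a_2,b_1,b_2$ under $\varphi$ equal those of $\lambda_1(T_1),\lambda_2(T_2),\rho_1(S_1),\rho_2(S_2)$ under $\varphi_\xi$. The distribution $\eta_j$ is the compactly supported probability measure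 on $\mathbb R^2$ with $\varphi(a_j^mb_j^n)=\int t^ms^n\,d\eta_j(t,s)$ for all $m,n\ge0$; thus $\mu_j,\nu_j$ are the distributions of $a_j,b_j$. $\eta_1\boxplus\boxplus\eta_2$ (bi-free additive convolution) is the distribution of the commuting self-adjoint pair $(a_1+a_2,b_1+b_2)$; its marginals are the free additive convolutions $\mu_1\boxplus\mu_2$ and $\nu_1\boxplus\nu_2$. *)

theory Defs
  imports "HOL-Probability.Probability" "HOL-Library.Poly_Mapping" "HOL-Computational_Algebra.Polynomial"
begin

section \<open>Complex vector spaces\<close>

class complex_vector = ab_group_add +
  fixes scaleC :: "complex \<Rightarrow> 'a \<Rightarrow> 'a" (infixr "*\<^sub>C" 75)
  assumes scaleC_add_right: "c *\<^sub>C (x + y) = c *\<^sub>C x + c *\<^sub>C y"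
    and scaleC_add_left: "(c + d) *\<^sub>C x = c *\<^sub>C x + d *\<^sub>C x"
    and scaleC_scaleC: "c *\<^sub>C d *\<^sub>C x = (c * d) *\<^sub>C x"
    and scaleC_one: "1 *\<^sub>C x = x"

global_interpretation cvec: vector_space "scaleC :: complex \<Rightarrow> 'a::complex_vector \<Rightarrow> 'a"
  by unfold_locales (simp_all add: scaleC_add_right scaleC_add_left scaleC_scaleC scaleC_one)

abbreviation cspan :: "'a::complex_vector set \<Rightarrow> 'a set"
  where "cspan \<equiv> module.span scaleC"

abbreviation clinear :: "('a::complex_vector \<Rightarrow> 'b::complex_vector) \<Rightarrow> bool"
  where "clinear \<equiv> Vector_Spaces.linear scaleC scaleC"

instantiation complex :: complex_vector
begin
definition scaleC_complex_def: "c *\<^sub>C (x::complex) = c * x"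
instance by standard (simp_all add: scaleC_complex_def algebra_simps)
end

instantiation prod :: (complex_vector, complex_vector) complex_vector
begin
definition scaleC_prod_def: "c *\<^sub>C p = (c *\<^sub>C fst p, c *\<^sub>C snd p)"
instance
  by standard (auto simp: scaleC_prod_def scaleC_add_right scaleC_add_left scaleC_scaleC scaleC_one)
end

instantiation poly_mapping :: (type, complex_vector) complex_vector
begin
lift_definition scaleC_poly_mapping :: "complex \<Rightarrow> ('a \<Rightarrow>\<^sub>0 'b) \<Rightarrow> ('a \<Rightarrow>\<^sub>0 'b)"
  is "\<lambda>c f k. c *\<^sub>C f k"
  by (erule finite_subset[rotated]) auto
instance
  by standard (transfer; simp add: scaleC_add_right scaleC_add_left scaleC_scaleC scaleC_one)+
end

text \<open>The type \<^typ>\<open>'k \<Rightarrow>\<^sub>0 complex\<close> is the complex vector space with basis \<^typ>\<open>'k\<close>.\<close>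

abbreviation basis_vec :: "'k \<Rightarrow> 'k \<Rightarrow>\<^sub>0 complex"
  where "basis_vec k \<equiv> Poly_Mapping.single k 1"

definition lin_ext :: "('k \<Rightarrow> 'v::complex_vector) \<Rightarrow> ('k \<Rightarrow>\<^sub>0 complex) \<Rightarrow> 'v"
  where "lin_ext g p = (\<Sum>k\<in>Poly_Mapping.keys p. Poly_Mapping.lookup p k *\<^sub>C g k)"

lemma lin_ext_superset:
  assumes "finite K" "Poly_Mapping.keys p \<subseteq> K"
  shows "lin_ext g p = (\<Sum>k\<in>K. Poly_Mapping.lookup p k *\<^sub>C g k)"
  unfolding lin_ext_def using assms
  by (intro sum.mono_neutral_left) (auto simp: in_keys_iff)

lemma clinear_lin_ext: "clinear (lin_ext g)"
proof (unfold_locales)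
  fix p q :: "'a \<Rightarrow>\<^sub>0 complex" and c :: complex
  have fin: "finite (Poly_Mapping.keys p \<union> Poly_Mapping.keys q)" by simp
  have "lin_ext g (p + q) = (\<Sum>k\<in>Poly_Mapping.keys p \<union> Poly_Mapping.keys q. Poly_Mapping.lookup (p + q) k *\<^sub>C g k)"
    by (rule lin_ext_superset[OF fin keys_add])
  also have "\<dots> = lin_ext g p + lin_ext g q"
    by (simp add: lin_ext_superset[OF fin] lookup_add cvec.scale_left_distrib sum.distrib)
  finally show "lin_ext g (p + q) = lin_ext g p + lin_ext g q" .
  have "lin_ext g (c *\<^sub>C p) = (\<Sum>k\<in>Poly_Mapping.keys p. Poly_Mapping.lookup (c *\<^sub>C p) k *\<^sub>C g k)"
    by (rule lin_ext_superset) (auto simp: in_keys_iff scaleC_poly_mapping.rep_eq)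
  then show "lin_ext g (c *\<^sub>C p) = c *\<^sub>C lin_ext g p"
    by (simp add: lin_ext_def scaleC_poly_mapping.rep_eq scaleC_complex_def cvec.scale_sum_right)
qed

lemma lin_ext_basis_vec [simp]: "lin_ext g (basis_vec k) = g k"
  by (simp add: lin_ext_def cvec.scale_one)

lemma clinear_zero_on_span:
  assumes "clinear f" "\<And>r. r \<in> R \<Longrightarrow> f r = 0" "p \<in> cspan R"
  shows "f p = 0"
proof -
  interpret f: Vector_Spaces.linear scaleC scaleC f by fact
  show ?thesis by (rule f.eq_0_on_span[OF assms(2,3)])
qed

lemma equivp_span: "equivp (\<lambda>p q. p - q \<in> cspan R)"
proof (rule equivpI)
  show "reflp (\<lambda>p q. p - q \<in> cspan R)" by (simp add: reflp_def cvec.span_zero)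
  show "symp (\<lambda>p q. p - q \<in> cspan R)"
    unfolding symp_def by (auto dest: cvec.span_neg)
  show "transp (\<lambda>p q. p - q \<in> cspan R)"
    unfolding transp_def by (auto dest: cvec.span_add)
qed

lemma span_congs:
  assumes "p - p' \<in> cspan R"
  shows "- p - - p' \<in> cspan R" "c *\<^sub>C p - c *\<^sub>C p' \<in> cspan R"
    and "q - q' \<in> cspan R \<Longrightarrow> p + q - (p' + q') \<in> cspan R"
    and "q - q' \<in> cspan R \<Longrightarrow> p - q - (p' - q') \<in> cspan R"
proof -
  show "- p - - p' \<in> cspan R"
    using cvec.span_neg[OF assms] by simp
  show "c *\<^sub>C p - c *\<^sub>C p' \<in> cspan R"
    using cvec.span_scale[OF assms, of c] by (simp only: cvec.scale_right_diff_distrib)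
  have eqs: "p + q - (p' + q') = (p - p') + (q - q')" "p - q - (p' - q') = (p - p') - (q - q')"
    by (simp_all only: algebra_simps)
  show "q - q' \<in> cspan R \<Longrightarrow> p + q - (p' + q') \<in> cspan R"
    unfolding eqs by (rule cvec.span_add[OF assms])
  show "q - q' \<in> cspan R \<Longrightarrow> p - q - (p' - q') \<in> cspan R"
    unfolding eqs by (rule cvec.span_diff[OF assms])
qed

section \<open>Algebraic tensor product of two vector spaces\<close>

definition tensor_rels :: "('u::complex_vector \<times> 'v::complex_vector \<Rightarrow>\<^sub>0 complex) set" where
  "tensor_rels =
     {basis_vec (u + u', v) - basis_vec (u, v) - basis_vec (u', v) | u u' v. True} \<union>
     {basis_vec (u, v + v') - basis_vec (u, v) - basis_vec (u, v') | u v v'. True} \<union>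
     {basis_vec (c *\<^sub>C u, v) - c *\<^sub>C basis_vec (u, v) | c u v. True} \<union>
     {basis_vec (u, c *\<^sub>C v) - c *\<^sub>C basis_vec (u, v) | c u v. True}"

quotient_type (overloaded) ('u, 'v) tensor =
  "('u::complex_vector \<times> 'v::complex_vector) \<Rightarrow>\<^sub>0 complex" / "\<lambda>p q. p - q \<in> cspan tensor_rels"
  by (rule equivp_span)

instantiation tensor :: (complex_vector, complex_vector) complex_vector
begin
lift_definition zero_tensor :: "('a, 'b) tensor" is 0 .
lift_definition plus_tensor :: "('a, 'b) tensor \<Rightarrow> ('a, 'b) tensor \<Rightarrow> ('a, 'b) tensor" is "(+)"
  by (rule span_congs)
lift_definition uminus_tensor :: "('a, 'b) tensor \<Rightarrow> ('a, 'b) tensor" is "uminus"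
  by (rule span_congs)
lift_definition minus_tensor :: "('a, 'b) tensor \<Rightarrow> ('a, 'b) tensor \<Rightarrow> ('a, 'b) tensor" is "(-)"
  by (rule span_congs)
lift_definition scaleC_tensor :: "complex \<Rightarrow> ('a, 'b) tensor \<Rightarrow> ('a, 'b) tensor" is scaleC
  by (rule span_congs)
instance
  by standard (transfer; simp add: algebra_simps cvec.span_zero)+
end

lift_definition tens :: "'u::complex_vector \<Rightarrow> 'v::complex_vector \<Rightarrow> ('u, 'v) tensor" (infixl "\<otimes>" 70)
  is "\<lambda>u v. basis_vec (u, v)" .

text \<open>The linear map \<open>u \<otimes> v \<mapsto> g u v\<close>, meaningful for bilinear \<open>g\<close>
  (for which the choice of the representative does not matter).\<close>

definition tensor_lift ::
  "('u::complex_vector \<Rightarrow> 'v::complex_vector \<Rightarrow> 'w::complex_vector) \<Rightarrow> ('u, 'v) tensor \<Rightarrow> 'w"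
  where "tensor_lift g t = lin_ext (\<lambda>(u, v). g u v) (rep_tensor t)"

lemma rep_tensor_cong: "rep_tensor (abs_tensor p) - p \<in> cspan tensor_rels"
  using Quotient3_abs_rep[OF Quotient3_tensor] tensor.abs_eq_iff by blast

lemma tensor_lift_abs:
  assumes "\<And>u. clinear (g u)" "\<And>v. clinear (\<lambda>u. g u v)"
  shows "tensor_lift g (abs_tensor p) = lin_ext (\<lambda>(u, v). g u v) p"
proof -
  let ?L = "lin_ext (\<lambda>(u, v). g u v)"
  interpret L: Vector_Spaces.linear scaleC scaleC ?L by (rule clinear_lin_ext)
  have lin: "g u (v + v') = g u v + g u v'" "g u (c *\<^sub>C v) = c *\<^sub>C g u v"
    "g (u + u') v = g u v + g u' v" "g (c *\<^sub>C u) v = c *\<^sub>C g u v" for u u' v v' c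
    using assms(1)[of u] assms(2)[of v]
    by (simp_all add: Vector_Spaces.linear_iff)
  have "?L r = 0" if "r \<in> tensor_rels" for r
    using that unfolding tensor_rels_def
    by (auto simp: L.diff L.scale lin)
  from clinear_zero_on_span[OF clinear_lin_ext this rep_tensor_cong]
  have "?L (rep_tensor (abs_tensor p) - p) = 0" .
  then show ?thesis by (simp add: L.diff tensor_lift_def)
qed

lemma tensor_lift_tens:
  assumes "\<And>u. clinear (g u)" "\<And>v. clinear (\<lambda>u. g u v)"
  shows "tensor_lift g (u \<otimes> v) = g u v"
  by (simp add: tens.abs_eq tensor_lift_abs[OF assms])

definition tensor_map ::
  "('u::complex_vector \<Rightarrow> 'u) \<Rightarrow> ('v::complex_vector \<Rightarrow> 'v) \<Rightarrow> ('u, 'v) tensor \<Rightarrow> ('u, 'v) tensor"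
  where "tensor_map S T = tensor_lift (\<lambda>u v. S u \<otimes> T v)"

section \<open>Free product of vector spaces with state vectors\<close>

text \<open>A vector space with state vector \<open>\<X>\<^sub>j = \<complex>\<xi>\<^sub>j \<oplus> \<X>\<^sub>j\<degree>\<close> is \<^typ>\<open>complex \<times> 'z\<close> with
  \<open>\<xi>\<^sub>j = (1, 0)\<close>, where the type \<^typ>\<open>'z\<close> is \<open>\<X>\<^sub>j\<degree>\<close>; it is \<^typ>\<open>'x\<close> for \<open>j = 1\<close> and \<^typ>\<open>'y\<close>
  for \<open>j = 2\<close>. The word \<open>[z\<^sub>1, \<dots>, z\<^sub>n]\<close> over \<^typ>\<open>'x + 'y\<close> stands for \<open>z\<^sub>1 \<otimes> \<dots> \<otimes> z\<^sub>n\<close> and the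
  empty word for \<open>\<xi>\<close>. The quotient by the multilinearity relations is the sum of \<open>\<complex>\<xi>\<close> and all
  tensor products \<open>\<X>\<degree>\<^bsub>i\<^sub>1\<^esub> \<otimes> \<dots> \<otimes> \<X>\<degree>\<^bsub>i\<^sub>n\<^esub>\<close>; the last set of relations kills
  precisely the summands in which two neighbouring indices agree.\<close>

definition alternating :: "('x + 'y) list \<Rightarrow> bool"
  where "alternating w \<longleftrightarrow> successively (\<lambda>a b. isl a \<noteq> isl b) w"

definition free_prod_rels :: "(('x::complex_vector + 'y::complex_vector) list \<Rightarrow>\<^sub>0 complex) set" where
  "free_prod_rels =
     {basis_vec (s @ Inl (x + x') # t) - basis_vec (s @ Inl x # t) - basis_vec (s @ Inl x' # t)
       | s t x x'. True} \<union>
     {basis_vec (s @ Inr (y + y') # t) - basis_vec (s @ Inr y # t) - basis_vec (s @ Inr y' # t)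
       | s t y y'. True} \<union>
     {basis_vec (s @ Inl (c *\<^sub>C x) # t) - c *\<^sub>C basis_vec (s @ Inl x # t) | s t c x. True} \<union>
     {basis_vec (s @ Inr (c *\<^sub>C y) # t) - c *\<^sub>C basis_vec (s @ Inr y # t) | s t c y. True} \<union>
     {basis_vec w | w. \<not> alternating w}"

quotient_type (overloaded) ('x, 'y) free_prod =
  "('x::complex_vector + 'y::complex_vector) list \<Rightarrow>\<^sub>0 complex" / "\<lambda>p q. p - q \<in> cspan free_prod_rels"
  by (rule equivp_span)

instantiation free_prod :: (complex_vector, complex_vector) complex_vector
begin
lift_definition zero_free_prod :: "('a, 'b) free_prod" is 0 .
lift_definition plus_free_prod :: "('a, 'b) free_prod \<Rightarrow> ('a, 'b) free_prod \<Rightarrow> ('a, 'b) free_prod"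
  is "(+)"
  by (rule span_congs)
lift_definition uminus_free_prod :: "('a, 'b) free_prod \<Rightarrow> ('a, 'b) free_prod" is "uminus"
  by (rule span_congs)
lift_definition minus_free_prod :: "('a, 'b) free_prod \<Rightarrow> ('a, 'b) free_prod \<Rightarrow> ('a, 'b) free_prod"
  is "(-)"
  by (rule span_congs)
lift_definition scaleC_free_prod :: "complex \<Rightarrow> ('a, 'b) free_prod \<Rightarrow> ('a, 'b) free_prod" is scaleC
  by (rule span_congs)
instance
  by standard (transfer; simp add: algebra_simps cvec.span_zero)+
end

lift_definition word :: "('x::complex_vector + 'y::complex_vector) list \<Rightarrow> ('x, 'y) free_prod"
  is "\<lambda>w. basis_vec w" .

abbreviation vacuum :: "('x::complex_vector, 'y::complex_vector) free_prod"
  where "vacuum \<equiv> word []"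

lift_definition vacuum_coeff :: "('x::complex_vector, 'y::complex_vector) free_prod \<Rightarrow> complex"
  is "\<lambda>p. Poly_Mapping.lookup p []"
proof -
  fix p q :: "('x + 'y) list \<Rightarrow>\<^sub>0 complex"
  assume "p - q \<in> cspan free_prod_rels"
  moreover have "clinear (\<lambda>p :: ('x + 'y) list \<Rightarrow>\<^sub>0 complex. Poly_Mapping.lookup p [])"
    by unfold_locales (simp_all add: lookup_add scaleC_poly_mapping.rep_eq)
  moreover have "Poly_Mapping.lookup r [] = 0" if "r \<in> free_prod_rels" for r :: "('x + 'y) list \<Rightarrow>\<^sub>0 complex"
    using that unfolding free_prod_rels_def alternating_def
    by (auto simp: lookup_minus lookup_single scaleC_poly_mapping.rep_eq scaleC_complex_def when_def)
  ultimately have "Poly_Mapping.lookup (p - q) [] = 0"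
    using clinear_zero_on_span by blast
  then show "Poly_Mapping.lookup p [] = Poly_Mapping.lookup q []"
    by (simp add: lookup_minus)
qed

definition vacuum_state ::
  "(('x::complex_vector, 'y::complex_vector) free_prod \<Rightarrow> ('x, 'y) free_prod) \<Rightarrow> complex"
  where "vacuum_state T = vacuum_coeff (T vacuum)"

text \<open>The linear maps \<open>w \<mapsto> z \<otimes> w\<close> and \<open>w \<mapsto> w \<otimes> z\<close>; concatenation is compatible with the
  relations, so the choice of the representative does not matter.\<close>

definition attach_left ::
  "'x + 'y \<Rightarrow> ('x::complex_vector, 'y::complex_vector) free_prod \<Rightarrow> ('x, 'y) free_prod"
  where "attach_left z h = lin_ext (\<lambda>w. word (z # w)) (rep_free_prod h)"

definition attach_right ::
  "'x + 'y \<Rightarrow> ('x::complex_vector, 'y::complex_vector) free_prod \<Rightarrow> ('x, 'y) free_prod"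
  where "attach_right z h = lin_ext (\<lambda>w. word (w @ [z])) (rep_free_prod h)"

lemma alternating_appendD: "alternating (s @ t) \<Longrightarrow> alternating s \<and> alternating t"
  by (simp add: alternating_def successively_append_iff)

lemma rep_free_prod_cong: "rep_free_prod (abs_free_prod p) - p \<in> cspan free_prod_rels"
  using Quotient3_abs_rep[OF Quotient3_free_prod] free_prod.abs_eq_iff by blast

lemma word_rel_zero:
  assumes "r \<in> free_prod_rels"
  shows "lin_ext (\<lambda>w. word (s @ w @ t)) r = 0"
proof -
  interpret L: Vector_Spaces.linear scaleC scaleC "lin_ext (\<lambda>w. word (s @ w @ t))"
    by (rule clinear_lin_ext)
  have abs0: "abs_free_prod q = 0" if "q \<in> free_prod_rels" for q :: "('a + 'b) list \<Rightarrow>\<^sub>0 complex"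
    using cvec.span_base[OF that] by (simp add: zero_free_prod.abs_eq free_prod.abs_eq_iff)
  have m1: "word (s @ Inl (x + x') # t) - word (s @ Inl x # t) - word (s @ Inl x' # t) = 0"
    for s t :: "('a + 'b) list" and x x'
    unfolding word.abs_eq minus_free_prod.abs_eq by (rule abs0) (unfold free_prod_rels_def, blast)
  have m2: "word (s @ Inr (x + x') # t) - word (s @ Inr x # t) - word (s @ Inr x' # t) = 0"
    for s t :: "('a + 'b) list" and x x'
    unfolding word.abs_eq minus_free_prod.abs_eq by (rule abs0) (unfold free_prod_rels_def, blast)
  have m3: "word (s @ Inl (c *\<^sub>C x) # t) - c *\<^sub>C word (s @ Inl x # t) = 0"
    for s t :: "('a + 'b) list" and c x
    unfolding word.abs_eq minus_free_prod.abs_eq scaleC_free_prod.abs_eq by (rule abs0) (unfold free_prod_rels_def, blast)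
  have m4: "word (s @ Inr (c *\<^sub>C x) # t) - c *\<^sub>C word (s @ Inr x # t) = 0"
    for s t :: "('a + 'b) list" and c x
    unfolding word.abs_eq minus_free_prod.abs_eq scaleC_free_prod.abs_eq by (rule abs0) (unfold free_prod_rels_def, blast)
  have m5: "word w = 0" if "\<not> alternating w" for w :: "('a + 'b) list"
    unfolding word.abs_eq by (rule abs0) (use that in \<open>unfold free_prod_rels_def, blast\<close>)
  consider (1) u v x x' where "r = basis_vec (u @ Inl (x + x') # v) - basis_vec (u @ Inl x # v) - basis_vec (u @ Inl x' # v)"
    | (2) u v x x' where "r = basis_vec (u @ Inr (x + x') # v) - basis_vec (u @ Inr x # v) - basis_vec (u @ Inr x' # v)"
    | (3) u v c x where "r = basis_vec (u @ Inl (c *\<^sub>C x) # v) - c *\<^sub>C basis_vec (u @ Inl x # v)"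
    | (4) u v c x where "r = basis_vec (u @ Inr (c *\<^sub>C x) # v) - c *\<^sub>C basis_vec (u @ Inr x # v)"
    | (5) w where "r = basis_vec w" "\<not> alternating w"
    using assms unfolding free_prod_rels_def by blast
  then show ?thesis
  proof cases
    case 1
    then show ?thesis using m1[of "s @ u" _ _ "v @ t"] by (simp add: L.diff)
  next
    case 2
    then show ?thesis using m2[of "s @ u" _ _ "v @ t"] by (simp add: L.diff)
  next
    case 3
    then show ?thesis using m3[of "s @ u" _ _ "v @ t"] by (simp add: L.diff L.scale)
  next
    case 4
    then show ?thesis using m4[of "s @ u" _ _ "v @ t"] by (simp add: L.diff L.scale)
  next
    case 5
    then have "\<not> alternating (s @ w @ t)" using alternating_appendD by blast
    then show ?thesis using 5 m5 by simp
  qed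
qed

lemma attach_word:
  shows attach_left_word: "attach_left z (word w) = word (z # w)"
    and attach_right_word: "attach_right z (word w) = word (w @ [z])"
proof -
  have *: "lin_ext (\<lambda>w. word (s @ w @ t)) (rep_free_prod (word w)) = word (s @ w @ t)" for s t
  proof -
    interpret L: Vector_Spaces.linear scaleC scaleC "lin_ext (\<lambda>w. word (s @ w @ t))"
      by (rule clinear_lin_ext)
    have "lin_ext (\<lambda>w. word (s @ w @ t)) (rep_free_prod (abs_free_prod (basis_vec w)) - basis_vec w) = 0"
      by (rule clinear_zero_on_span[OF clinear_lin_ext word_rel_zero rep_free_prod_cong])
    then show ?thesis by (simp add: L.diff flip: word.abs_eq)
  qed
  show "attach_left z (word w) = word (z # w)" "attach_right z (word w) = word (w @ [z])"
    unfolding attach_left_def attach_right_def using *[of "[z]" "[]"] *[of "[]" "[z]"] by simp_all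
qed

text \<open>In the following the index \<open>j\<close> is given by the embedding \<open>\<iota>\<close> of \<open>\<X>\<^sub>j\<degree>\<close> into the letters:
  \<^term>\<open>Inl\<close> for \<open>j = 1\<close> and \<^term>\<open>Inr\<close> for \<open>j = 2\<close>. The spaces \<open>\<X>(\<ell>,j)\<close> and \<open>\<X>(r,j)\<close> are
  \<open>left_space \<iota>\<close> and \<open>right_space \<iota>\<close>, and \<open>\<X>\<^sub>j \<otimes> \<X>(\<ell>,j)\<close> and \<open>\<X>(r,j) \<otimes> \<X>\<^sub>j\<close> are regarded as
  subspaces of \<open>\<X>\<^sub>j \<otimes> \<X>\<close> and \<open>\<X> \<otimes> \<X>\<^sub>j\<close>. The maps \<open>V \<iota>\<close> and \<open>W \<iota>\<close> are bijections onto \<open>\<X>\<close> only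
  when restricted to these subspaces.\<close>

definition left_space ::
  "('z \<Rightarrow> 'x + 'y) \<Rightarrow> ('x::complex_vector, 'y::complex_vector) free_prod set"
  where "left_space \<iota> = cspan {word w | w. alternating w \<and> (w = [] \<or> hd w \<notin> range \<iota>)}"

definition right_space ::
  "('z \<Rightarrow> 'x + 'y) \<Rightarrow> ('x::complex_vector, 'y::complex_vector) free_prod set"
  where "right_space \<iota> = cspan {word w | w. alternating w \<and> (w = [] \<or> last w \<notin> range \<iota>)}"

definition left_tensors ::
  "('z \<Rightarrow> 'x + 'y) \<Rightarrow> (complex \<times> 'z::complex_vector, ('x::complex_vector, 'y::complex_vector) free_prod) tensor set"
  where "left_tensors \<iota> = cspan {u \<otimes> h | u h. h \<in> left_space \<iota>}"

definition right_tensors ::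
  "('z \<Rightarrow> 'x + 'y) \<Rightarrow> (('x::complex_vector, 'y::complex_vector) free_prod, complex \<times> 'z::complex_vector) tensor set"
  where "right_tensors \<iota> = cspan {h \<otimes> u | h u. h \<in> right_space \<iota>}"

definition V ::
  "('z \<Rightarrow> 'x + 'y) \<Rightarrow> (complex \<times> 'z::complex_vector, ('x::complex_vector, 'y::complex_vector) free_prod) tensor
    \<Rightarrow> ('x, 'y) free_prod"
  where "V \<iota> = tensor_lift (\<lambda>(c, z) h. c *\<^sub>C h + attach_left (\<iota> z) h)"

definition W ::
  "('z \<Rightarrow> 'x + 'y) \<Rightarrow> (('x::complex_vector, 'y::complex_vector) free_prod, complex \<times> 'z::complex_vector) tensor
    \<Rightarrow> ('x, 'y) free_prod"
  where "W \<iota> = tensor_lift (\<lambda>h (c, z). c *\<^sub>C h + attach_right (\<iota> z) h)"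

definition lambda_op ::
  "('z \<Rightarrow> 'x + 'y) \<Rightarrow> (complex \<times> 'z \<Rightarrow> complex \<times> 'z::complex_vector)
    \<Rightarrow> ('x::complex_vector, 'y::complex_vector) free_prod \<Rightarrow> ('x, 'y) free_prod"
  where "lambda_op \<iota> T = V \<iota> \<circ> tensor_map T id \<circ> inv_into (left_tensors \<iota>) (V \<iota>)"

definition rho_op ::
  "('z \<Rightarrow> 'x + 'y) \<Rightarrow> (complex \<times> 'z \<Rightarrow> complex \<times> 'z::complex_vector)
    \<Rightarrow> ('x::complex_vector, 'y::complex_vector) free_prod \<Rightarrow> ('x, 'y) free_prod"
  where "rho_op \<iota> T = W \<iota> \<circ> tensor_map id T \<circ> inv_into (right_tensors \<iota>) (W \<iota>)"

section \<open>Noncommutative probability\<close>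

class cstar_algebra = real_normed_algebra_1 + banach + complex_vector +
  fixes adj :: "'a \<Rightarrow> 'a"
  assumes scaleC_of_real: "complex_of_real r *\<^sub>C x = r *\<^sub>R x"
    and norm_scaleC: "norm (c *\<^sub>C x) = cmod c * norm x"
    and mult_scaleC_left: "(c *\<^sub>C x) * y = c *\<^sub>C (x * y)"
    and mult_scaleC_right: "x * (c *\<^sub>C y) = c *\<^sub>C (x * y)"
    and adj_add: "adj (x + y) = adj x + adj y"
    and adj_scaleC: "adj (c *\<^sub>C x) = cnj c *\<^sub>C adj x"
    and adj_mult: "adj (x * y) = adj y * adj x"
    and adj_adj: "adj (adj x) = x"
    and cstar_identity: "norm (adj x * x) = (norm x)\<^sup>2"

instantiation complex :: cstar_algebra
begin
definition adj_complex_def: "adj (x::complex) = cnj x"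
instance
  by standard (simp_all add: adj_complex_def scaleC_complex_def norm_mult power2_eq_square scaleR_conv_of_real)
end

definition faithful_state :: "('a::cstar_algebra \<Rightarrow> complex) \<Rightarrow> bool" where
  "faithful_state \<phi> \<longleftrightarrow> clinear \<phi> \<and> \<phi> 1 = 1 \<and> (\<forall>x. \<phi> (adj x * x) \<in> \<real>\<^sub>\<ge>\<^sub>0)
     \<and> (\<forall>x. \<phi> (adj x * x) = 0 \<longrightarrow> x = 0)"

definition self_adjoint_pair :: "'a::cstar_algebra \<times> 'a \<Rightarrow> bool"
  where "self_adjoint_pair = (\<lambda>(a, b). adj a = a \<and> adj b = b)"

definition bi_partite :: "'a::cstar_algebra \<times> 'a \<Rightarrow> bool"
  where "bi_partite = (\<lambda>(a, b). a * b = b * a)"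

datatype face = Left1 | Left2 | Right1 | Right2

text \<open>HOL cannot quantify over types inside a formula, so the types of \<open>\<X>\<^sub>1\<degree>\<close> and \<open>\<X>\<^sub>2\<degree>\<close> are
  parameters. Quantifying over the spaces means having them as type variables: a hypothesis
  \<open>bi_free TYPE('x) TYPE('y) \<dots>\<close> with free \<open>'x\<close> and \<open>'y\<close> expresses that some spaces exist.\<close>

definition bi_free :: "'x::complex_vector itself \<Rightarrow> 'y::complex_vector itself \<Rightarrow>
    ('a::cstar_algebra \<Rightarrow> complex) \<Rightarrow> 'a \<times> 'a \<Rightarrow> 'a \<times> 'a \<Rightarrow> bool" where
  "bi_free _ _ \<phi> = (\<lambda>(a\<^sub>1, b\<^sub>1) (a\<^sub>2, b\<^sub>2).
     (\<exists>(T\<^sub>1 :: complex \<times> 'x \<Rightarrow> complex \<times> 'x) S\<^sub>1 (T\<^sub>2 :: complex \<times> 'y \<Rightarrow> complex \<times> 'y) S\<^sub>2.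
        clinear T\<^sub>1 \<and> clinear S\<^sub>1 \<and> clinear T\<^sub>2 \<and> clinear S\<^sub>2 \<and>
        (\<forall>m :: face list.
           \<phi> (prod_list (map (case_face a\<^sub>1 a\<^sub>2 b\<^sub>1 b\<^sub>2) m)) =
           vacuum_state (foldr (\<circ>) (map (case_face
             (lambda_op (Inl :: 'x \<Rightarrow> 'x + 'y) T\<^sub>1) (lambda_op Inr T\<^sub>2) (rho_op Inl S\<^sub>1) (rho_op Inr S\<^sub>2)) m) id))))"

definition compactly_supported_prob :: "'s::euclidean_space measure \<Rightarrow> bool" where
  "compactly_supported_prob \<mu> \<longleftrightarrow> prob_space \<mu> \<and> sets \<mu> = sets borel \<and>
     (\<exists>K. compact K \<and> emeasure \<mu> (- K) = 0)"

definition pair_distribution ::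
  "('a::cstar_algebra \<Rightarrow> complex) \<Rightarrow> 'a \<times> 'a \<Rightarrow> (real \<times> real) measure \<Rightarrow> bool" where
  "pair_distribution \<phi> = (\<lambda>(a, b) \<eta>. compactly_supported_prob \<eta> \<and>
     (\<forall>m n. \<phi> (a ^ m * b ^ n) = of_real (\<integral>(t, s). t ^ m * s ^ n \<partial>\<eta>)))"

definition distribution :: "('a::cstar_algebra \<Rightarrow> complex) \<Rightarrow> 'a \<Rightarrow> real measure \<Rightarrow> bool" where
  "distribution \<phi> a \<mu> \<longleftrightarrow> compactly_supported_prob \<mu> \<and>
     (\<forall>n. \<phi> (a ^ n) = of_real (\<integral>t. t ^ n \<partial>\<mu>))"

definition fst_marginal :: "(real \<times> real) measure \<Rightarrow> real measure"
  where "fst_marginal \<eta> = distr \<eta> borel fst"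

definition snd_marginal :: "(real \<times> real) measure \<Rightarrow> real measure"
  where "snd_marginal \<eta> = distr \<eta> borel snd"

definition poly_at :: "complex poly \<Rightarrow> 'a::cstar_algebra \<Rightarrow> 'a"
  where "poly_at p a = (\<Sum>i\<le>degree p. coeff p i *\<^sub>C a ^ i)"

text \<open>Freeness of self-adjoint elements: for these the unital *-algebra generated by one of them
  consists of the polynomials in it.\<close>

definition free_elements :: "('a::cstar_algebra \<Rightarrow> complex) \<Rightarrow> 'a \<Rightarrow> 'a \<Rightarrow> bool" where
  "free_elements \<phi> a\<^sub>1 a\<^sub>2 \<longleftrightarrow>
     (\<forall>ps :: (bool \<times> complex poly) list.
        ps \<noteq> [] \<and> successively (\<lambda>p q. fst p \<noteq> fst q) ps \<and>
        (\<forall>(i, p) \<in> set ps. \<phi> (poly_at p (if i then a\<^sub>1 else a\<^sub>2)) = 0) \<longrightarrow>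
        \<phi> (prod_list (map (\<lambda>(i, p). poly_at p (if i then a\<^sub>1 else a\<^sub>2)) ps)) = 0)"

text \<open>\<open>free_convolution TYPE('c) \<mu>\<^sub>1 \<mu>\<^sub>2 \<mu>\<close> says \<open>\<mu> = \<mu>\<^sub>1 \<boxplus> \<mu>\<^sub>2\<close>, realized on the type \<open>'c\<close>; the result
  does not depend on the realization.\<close>

definition free_convolution ::
  "'c::cstar_algebra itself \<Rightarrow> real measure \<Rightarrow> real measure \<Rightarrow> real measure \<Rightarrow> bool" where
  "free_convolution _ \<mu>\<^sub>1 \<mu>\<^sub>2 \<mu> \<longleftrightarrow>
     (\<exists>(\<phi> :: 'c \<Rightarrow> complex) a\<^sub>1 a\<^sub>2. faithful_state \<phi> \<and> adj a\<^sub>1 = a\<^sub>1 \<and> adj a\<^sub>2 = a\<^sub>2 \<and>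
        free_elements \<phi> a\<^sub>1 a\<^sub>2 \<and> distribution \<phi> a\<^sub>1 \<mu>\<^sub>1 \<and> distribution \<phi> a\<^sub>2 \<mu>\<^sub>2 \<and>
        distribution \<phi> (a\<^sub>1 + a\<^sub>2) \<mu>)"

end

theory Submission
  imports Defs
begin

text \<open>Represent \<open>a\<^sub>1, a\<^sub>2\<close> by operators on words. The projection onto the words that end in a letter of
  \<open>\<X>\<^sub>2\<degree>\<close> commutes with \<open>a\<^sub>1\<close> and has a rank-two commutator with \<open>a\<^sub>2\<close>; this yields an
  identity for the resolvent \<open>R\<close> of \<open>a\<^sub>1 + a\<^sub>2\<close> that involves only products of two values of \<open>\<phi>\<close>,
  such as \<open>\<phi>(f R a\<^sub>2) \<phi>(R) = \<phi>(f R) \<phi>(a\<^sub>2 R)\<close> for \<open>f\<close> in the algebra of \<open>a\<^sub>1\<close>. If \<open>a\<^sub>1 + a\<^sub>2\<close> has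
  an atom of mass \<open>m\<close> at \<open>\<xi>\<close>, with spectral projection \<open>P\<close>, then near \<open>\<xi>\<close> this identity and the trace
  property of \<open>\<phi>\<close> give \<open>\<xi> = \<xi>\<^sub>1 + \<xi>\<^sub>2\<close> with \<open>a\<^sub>j P = \<xi>\<^sub>j P\<close>, and the masses \<open>m\<^sub>j\<close> of the atoms \<open>\<xi>\<^sub>j\<close>
  satisfy \<open>m\<^sub>1 + m\<^sub>2 = 1 + m\<close>. It follows that \<open>P\<close>, applied to the vacuum, is \<open>m\<close> times
  the sum of all alternating words in \<open>y\<^sub>j = P\<^sub>j / m\<^sub>j - 1\<close>, where \<open>P\<^sub>j\<close> is the spectral projection of \<open>a\<^sub>j\<close>
  at \<open>\<xi>\<^sub>j\<close>. Let \<open>u\<^sub>j\<close> be the analogous elements for \<open>b\<^sub>1 + b\<^sub>2\<close>, where the atom has mass \<open>n\<close>, and let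
  \<open>\<alpha>\<^sub>j = \<phi>(y\<^sub>j u\<^sub>j)\<close>. In a bi-free family only words of
  the same shape pair nontrivially, so that the mass of the atom \<open>(\<xi>, \<zeta>)\<close> is the geometric series
  \<open>m n (1 + \<alpha>\<^sub>1) (1 + \<alpha>\<^sub>2) / (1 - \<alpha>\<^sub>1 \<alpha>\<^sub>2)\<close>, while \<open>1 + \<alpha>\<^sub>j = \<eta>\<^sub>j({(\<xi>\<^sub>j, \<zeta>\<^sub>j)}) / (m\<^sub>j n\<^sub>j)\<close>. Spectral
  projections need not lie in the algebra; they are replaced by polynomials that converge to the
  indicator function of a point.\<close>

section \<open>Operators on the free vector space over words\<close>

text \<open>The operators of a bi-free family live on a purely algebraic space without adjoint or
  norm, where resolvents and spectral projections have no meaning. Words therefore only prove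
  identities between finitely many moments, and all limits are taken in the algebra, in the seminorm
  given by \<phi>. The trace property is available on each face separately, so the faces are
  analysed one by one and meet only in a final Cauchy-Schwarz estimate. The relation
  \<open>m\<^sub>1 + m\<^sub>2 = 1 + m\<close> is the expansion at the atom of
  \<open>\<omega>\<^sub>1 + \<omega>\<^sub>2 = z + 1 / \<phi>(R)\<close>, where
  \<open>\<omega>\<^sub>j = (\<phi>(a\<^sub>j R) + 1) / \<phi>(R)\<close> are the subordination
  functions. It does two things. It gives the sum \<open>L\<close> of all alternating words squared
  norm \<open>1 / m\<close> while \<open>\<phi>(L P) = 1\<close>, so that \<open>P - m L\<close> has
  squared norm \<open>m - 2 m + m = 0\<close>. And it gives
  \<open>m\<^sub>1 + m\<^sub>2 > 1\<close>, likewise on the other face, from which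
  \<open>\<bar>\<alpha>\<^sub>1 \<alpha>\<^sub>2\<bar> < 1\<close> and the convergence of the series
  follow.\<close>

lemma clinear_eq_lin_ext:
  assumes "clinear f"
  shows "f p = lin_ext (\<lambda>k. f (basis_vec k)) p"
proof -
  interpret f: Vector_Spaces.linear scaleC scaleC f by fact
  have "p = (\<Sum>k\<in>Poly_Mapping.keys p. Poly_Mapping.lookup p k *\<^sub>C basis_vec k)"
    by (rule poly_mapping_eqI)
      (simp add: lookup_sum scaleC_poly_mapping.rep_eq scaleC_complex_def lookup_single when_def
        sum.delta if_distrib in_keys_iff cong: if_cong)
  then have "f p = f (\<Sum>k\<in>Poly_Mapping.keys p. Poly_Mapping.lookup p k *\<^sub>C basis_vec k)"
    by simp
  then show ?thesis by (simp add: f.sum f.scale lin_ext_def)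
qed

lemma clinear_eq_on_basis:
  assumes "clinear f" "clinear g" "\<And>k. f (basis_vec k) = g (basis_vec k)"
  shows "f p = g p"
  using clinear_eq_lin_ext[OF assms(1), of p] clinear_eq_lin_ext[OF assms(2), of p]
  by (simp only: assms(3))

lemma clinearI:
  assumes "\<And>x y. f (x + y) = f x + f y" "\<And>c x. f (c *\<^sub>C x) = c *\<^sub>C f x"
  shows "clinear f"
  by unfold_locales (simp_all add: assms)

lemma clinearD:
  assumes "clinear f"
  shows "f (x + y) = f x + f y" "f (c *\<^sub>C x) = c *\<^sub>C f x" "f 0 = 0" "f (x - y) = f x - f y"
    "f (- x) = - f x" "f (sum h A) = (\<Sum>a\<in>A. f (h a))"
proof -
  interpret f: Vector_Spaces.linear scaleC scaleC f by fact
  show "f (x + y) = f x + f y" "f (c *\<^sub>C x) = c *\<^sub>C f x" "f 0 = 0" "f (x - y) = f x - f y"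
    "f (- x) = - f x" "f (sum h A) = (\<Sum>a\<in>A. f (h a))"
    by (simp_all add: f.add f.scale f.diff f.neg f.sum)
qed

lemma clinear_comp:
  assumes "clinear f" "clinear g"
  shows "clinear (\<lambda>x. f (g x))"
  by (rule clinearI) (simp_all add: clinearD[OF assms(1)] clinearD[OF assms(2)])

lemma clinear_abs: "clinear abs_free_prod"
  by (rule clinearI) (simp_all add: plus_free_prod.abs_eq scaleC_free_prod.abs_eq)

lemma abs_basis: "abs_free_prod (basis_vec w) = word w"
  by (simp add: word.abs_eq)

lemma abs_eq_lin_ext: "abs_free_prod p = lin_ext word p"
  using clinear_eq_lin_ext[OF clinear_abs, of p] by (simp add: abs_basis)

lemma abs_rel_zero: "r \<in> free_prod_rels \<Longrightarrow> abs_free_prod r = 0"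
  using word_rel_zero[of r "[]" "[]"] by (simp add: abs_eq_lin_ext)

lemma abs_eq_iff_span: "abs_free_prod p = abs_free_prod q \<longleftrightarrow> p - q \<in> cspan free_prod_rels"
  by (rule free_prod.abs_eq_iff)

lemma free_prod_rels_cases:
  assumes "r \<in> free_prod_rels"
  obtains (1) u v x x' where "r = basis_vec (u @ Inl (x + x') # v) - basis_vec (u @ Inl x # v) - basis_vec (u @ Inl x' # v)"
    | (2) u v x x' where "r = basis_vec (u @ Inr (x + x') # v) - basis_vec (u @ Inr x # v) - basis_vec (u @ Inr x' # v)"
    | (3) u v c x where "r = basis_vec (u @ Inl (c *\<^sub>C x) # v) - c *\<^sub>C basis_vec (u @ Inl x # v)"
    | (4) u v c x where "r = basis_vec (u @ Inr (c *\<^sub>C x) # v) - c *\<^sub>C basis_vec (u @ Inr x # v)"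
    | (5) w where "r = basis_vec w" "\<not> alternating w"
  using assms unfolding free_prod_rels_def
  by (elim UnE CollectE exE conjE) (erule that)+

lemma word_Inl_add: "word (s @ Inl (x + x') # t) = word (s @ Inl x # t) + word (s @ Inl x' # t)"
  and word_Inr_add: "word (s @ Inr (y + y') # t) = word (s @ Inr y # t) + word (s @ Inr y' # t)"
  and word_Inl_scale: "word (s @ Inl (c *\<^sub>C x) # t) = c *\<^sub>C word (s @ Inl x # t)"
  and word_Inr_scale: "word (s @ Inr (c *\<^sub>C y) # t) = c *\<^sub>C word (s @ Inr y # t)"
  and word_not_alternating: "\<not> alternating w \<Longrightarrow> word w = 0"
proof -
  have "abs_free_prod (basis_vec (s @ Inl (x + x') # t) - basis_vec (s @ Inl x # t) - basis_vec (s @ Inl x' # t)) = 0"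
    by (rule abs_rel_zero) (unfold free_prod_rels_def, blast)
  then show "word (s @ Inl (x + x') # t) = word (s @ Inl x # t) + word (s @ Inl x' # t)"
    by (simp add: clinearD[OF clinear_abs] abs_basis algebra_simps)
  have "abs_free_prod (basis_vec (s @ Inr (y + y') # t) - basis_vec (s @ Inr y # t) - basis_vec (s @ Inr y' # t)) = 0"
    by (rule abs_rel_zero) (unfold free_prod_rels_def, blast)
  then show "word (s @ Inr (y + y') # t) = word (s @ Inr y # t) + word (s @ Inr y' # t)"
    by (simp add: clinearD[OF clinear_abs] abs_basis algebra_simps)
  have "abs_free_prod (basis_vec (s @ Inl (c *\<^sub>C x) # t) - c *\<^sub>C basis_vec (s @ Inl x # t)) = 0"
    by (rule abs_rel_zero) (unfold free_prod_rels_def, blast)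
  then show "word (s @ Inl (c *\<^sub>C x) # t) = c *\<^sub>C word (s @ Inl x # t)"
    by (simp add: clinearD[OF clinear_abs] abs_basis)
  have "abs_free_prod (basis_vec (s @ Inr (c *\<^sub>C y) # t) - c *\<^sub>C basis_vec (s @ Inr y # t)) = 0"
    by (rule abs_rel_zero) (unfold free_prod_rels_def, blast)
  then show "word (s @ Inr (c *\<^sub>C y) # t) = c *\<^sub>C word (s @ Inr y # t)"
    by (simp add: clinearD[OF clinear_abs] abs_basis)
  show "word w = 0" if "\<not> alternating w"
  proof -
    have "basis_vec w \<in> free_prod_rels" using that unfolding free_prod_rels_def by blast
    from abs_rel_zero[OF this] show ?thesis by (simp add: abs_basis)
  qed
qed

section \<open>Left and right operators on representatives\<close>

text \<open>The action of \<open>lambda_op\<close> before the multilinearity relations are imposed.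
  Words form a basis here, so linear maps may be prescribed word by word; the price is that a word
  containing a zero letter is not the zero vector. Non-alternating words go to 0 because they
  represent 0 in the quotient.\<close>

definition lop :: "('z \<Rightarrow> 'x + 'y) \<Rightarrow> (complex \<times> 'z::complex_vector \<Rightarrow> complex \<times> 'z) \<Rightarrow>
    (('x::complex_vector + 'y::complex_vector) list \<Rightarrow>\<^sub>0 complex) \<Rightarrow> (('x + 'y) list \<Rightarrow>\<^sub>0 complex)"
  where "lop \<iota> T = lin_ext (\<lambda>w. if \<not> alternating w then 0
    else if w \<noteq> [] \<and> hd w \<in> range \<iota>
      then fst (T (0, inv \<iota> (hd w))) *\<^sub>C basis_vec (tl w) + basis_vec (\<iota> (snd (T (0, inv \<iota> (hd w)))) # tl w)
    else fst (T (1, 0)) *\<^sub>C basis_vec w + basis_vec (\<iota> (snd (T (1, 0))) # w))"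

definition rev_word :: "('l list \<Rightarrow>\<^sub>0 complex) \<Rightarrow> ('l list \<Rightarrow>\<^sub>0 complex)"
  where "rev_word = lin_ext (\<lambda>w. basis_vec (rev w))"

text \<open>Defined through reversal, so that linearity and compatibility with the relations are
  inherited from \<open>lop\<close>.\<close>

definition rop :: "('z \<Rightarrow> 'x + 'y) \<Rightarrow> (complex \<times> 'z::complex_vector \<Rightarrow> complex \<times> 'z) \<Rightarrow>
    (('x::complex_vector + 'y::complex_vector) list \<Rightarrow>\<^sub>0 complex) \<Rightarrow> (('x + 'y) list \<Rightarrow>\<^sub>0 complex)"
  where "rop \<iota> T p = rev_word (lop \<iota> T (rev_word p))"

lemma clinear_lop: "clinear (lop \<iota> T)"
  unfolding lop_def by (rule clinear_lin_ext)

lemma clinear_rev_word: "clinear rev_word"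
  unfolding rev_word_def by (rule clinear_lin_ext)

lemma rev_word_basis [simp]: "rev_word (basis_vec w) = basis_vec (rev w)"
  by (simp add: rev_word_def)

lemma rev_word_rev_word [simp]: "rev_word (rev_word p) = p"
  by (rule clinear_eq_on_basis[of "\<lambda>p. rev_word (rev_word p)" "\<lambda>p. p"])
    (rule clinear_comp[OF clinear_rev_word clinear_rev_word], rule clinearI, simp_all)

lemma clinear_rop: "clinear (rop \<iota> T)"
  unfolding rop_def
  by (rule clinear_comp[OF clinear_rev_word clinear_comp[OF clinear_lop clinear_rev_word]])

lemma alternating_rev [simp]: "alternating (rev w) \<longleftrightarrow> alternating w"
proof -
  have "(\<lambda>x y :: 'a + 'b. isl y \<noteq> isl x) = (\<lambda>x y. isl x \<noteq> isl y)" by auto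
  from arg_cong[OF this, of "\<lambda>P. successively P w"] show ?thesis
    by (simp only: alternating_def successively_rev)
qed

lemma lookup_Nil_rev_word: "Poly_Mapping.lookup (rev_word p) [] = Poly_Mapping.lookup p []"
proof -
  have lin: "clinear (\<lambda>p :: 'a list \<Rightarrow>\<^sub>0 complex. Poly_Mapping.lookup p [])"
    by (rule clinearI) (simp_all add: lookup_add scaleC_poly_mapping.rep_eq)
  show ?thesis
    by (rule clinear_eq_on_basis[OF clinear_comp[OF lin clinear_rev_word] lin])
      (auto simp: lookup_single when_def)
qed

lemma abs_rev_word_rel: "r \<in> free_prod_rels \<Longrightarrow> abs_free_prod (rev_word r) = 0"
  by (erule free_prod_rels_cases)
    (simp_all add: clinearD[OF clinear_rev_word] clinearD[OF clinear_abs] abs_basis word_Inl_add word_Inr_add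
      word_Inl_scale word_Inr_scale word_not_alternating)

text \<open>Treats \<open>Inl\<close> and \<open>Inr\<close> at once; \<open>b\<close> records the
  side of the letters. Linearity of the inverse is stated for letters written with
  \<open>Inl\<close> or \<open>Inr\<close>, the form in which the relations of the free product
  present them, hence the split by side.\<close>

locale letter =
  fixes \<iota> :: "'z::complex_vector \<Rightarrow> 'x::complex_vector + 'y::complex_vector" and b :: bool
  assumes range_iff: "l \<in> range \<iota> \<longleftrightarrow> isl l = b"
    and inj: "inj \<iota>"
    and word_add: "word (s @ \<iota> (z + z') # t) = word (s @ \<iota> z # t) + word (s @ \<iota> z' # t)"
    and word_scale: "word (s @ \<iota> (c *\<^sub>C z) # t) = c *\<^sub>C word (s @ \<iota> z # t)"
    and inv_Inl: "b \<Longrightarrow> inv \<iota> (Inl (x + x')) = inv \<iota> (Inl x) + inv \<iota> (Inl x')"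
      "b \<Longrightarrow> inv \<iota> (Inl (c *\<^sub>C x)) = c *\<^sub>C inv \<iota> (Inl x)"
    and inv_Inr: "\<not> b \<Longrightarrow> inv \<iota> (Inr (y + y')) = inv \<iota> (Inr y) + inv \<iota> (Inr y')"
      "\<not> b \<Longrightarrow> inv \<iota> (Inr (c *\<^sub>C y)) = c *\<^sub>C inv \<iota> (Inr y)"
begin

lemma isl_letter [simp]: "isl (\<iota> z) = b"
  using range_iff[of "\<iota> z"] by simp

lemma inv_letter [simp]: "inv \<iota> (\<iota> z) = z"
  by (rule inv_f_f[OF inj])

lemma letter_inv: "isl l = b \<Longrightarrow> \<iota> (inv \<iota> l) = l"
  by (rule f_inv_into_f) (simp add: range_iff)

lemma word_add_hd: "word (\<iota> (z + z') # t) = word (\<iota> z # t) + word (\<iota> z' # t)"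
  using word_add[of "[]"] by simp

lemma word_scale_hd: "word (\<iota> (c *\<^sub>C z) # t) = c *\<^sub>C word (\<iota> z # t)"
  using word_scale[of "[]"] by simp

lemma lop_basis_pre: "lop \<iota> T (basis_vec w) = (if \<not> alternating w then 0
    else if w \<noteq> [] \<and> isl (hd w) = b
      then fst (T (0, inv \<iota> (hd w))) *\<^sub>C basis_vec (tl w) + basis_vec (\<iota> (snd (T (0, inv \<iota> (hd w)))) # tl w)
    else fst (T (1, 0)) *\<^sub>C basis_vec w + basis_vec (\<iota> (snd (T (1, 0))) # w))"
  by (simp add: lop_def range_iff)

text \<open>A relation that changes a head letter of side \<open>b\<close> is absorbed by linearity
  of \<open>T\<close>; a relation at any other letter is carried along and yields relations again.
  The case split on the prefix \<open>u\<close> separates head from later letters.\<close>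

lemma abs_lop_rel:
  assumes T: "clinear T" and r: "r \<in> free_prod_rels"
  shows "abs_free_prod (lop \<iota> T r) = 0"
proof -
  note lin = clinearD[OF clinear_abs] clinearD[OF clinear_lop]
  have T0: "T (0, z + z') = T (0, z) + T (0, z')" for z z'
    using clinearD(1)[OF T, of "(0, z)" "(0, z')"] by simp
  have T1: "T (0, c *\<^sub>C z) = c *\<^sub>C T (0, z)" for z c
    using clinearD(2)[OF T, of c "(0, z)"] by (simp add: scaleC_prod_def scaleC_complex_def)
  note base = lop_basis_pre lin abs_basis T0 T1 word_add_hd word_scale_hd scaleC_add_left scaleC_scaleC
    scaleC_prod_def scaleC_complex_def algebra_simps scaleC_add_right
  have a: "alternating (u @ l # v) = alternating (u @ l' # v)" if "isl l = isl l'" for u v and l l' :: "'x + 'y"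
    using that by (auto simp: alternating_def successively_append_iff successively_Cons)
  have m: "word (q # u @ Inl (x + x') # v) = word (q # u @ Inl x # v) + word (q # u @ Inl x' # v)"
    "word (q # u @ Inr (y + y') # v) = word (q # u @ Inr y # v) + word (q # u @ Inr y' # v)"
    "word (q # u @ Inl (c *\<^sub>C x) # v) = c *\<^sub>C word (q # u @ Inl x # v)"
    "word (q # u @ Inr (c *\<^sub>C y) # v) = c *\<^sub>C word (q # u @ Inr y # v)"
    for q :: "'x + 'y" and u v c x x' y y'
    using word_Inl_add[of "q # u"] word_Inr_add[of "q # u"] word_Inl_scale[of "q # u"] word_Inr_scale[of "q # u"]
    by simp_all
  have m2: "word (Inl (x + x') # v) = word (Inl x # v) + word (Inl x' # v)"
    "word (Inr (y + y') # v) = word (Inr y # v) + word (Inr y' # v)"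
    "word (Inl (c *\<^sub>C x) # v) = c *\<^sub>C word (Inl x # v)"
    "word (Inr (c *\<^sub>C y) # v) = c *\<^sub>C word (Inr y # v)"
    for v :: "('x + 'y) list" and c x x' y y'
    using word_Inl_add[of "[]"] word_Inr_add[of "[]"] word_Inl_scale[of "[]"] word_Inr_scale[of "[]"]
    by simp_all
  have m3: "word (q # Inl (x + x') # v) = word (q # Inl x # v) + word (q # Inl x' # v)"
    "word (q # Inr (y + y') # v) = word (q # Inr y # v) + word (q # Inr y' # v)"
    "word (q # Inl (c *\<^sub>C x) # v) = c *\<^sub>C word (q # Inl x # v)"
    "word (q # Inr (c *\<^sub>C y) # v) = c *\<^sub>C word (q # Inr y # v)"
    for q :: "'x + 'y" and v c x x' y y'
    using m[of q "[]"] by simp_all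
  have m4: "word (q # q' # u @ Inl (x + x') # v) = word (q # q' # u @ Inl x # v) + word (q # q' # u @ Inl x' # v)"
    "word (q # q' # u @ Inr (y + y') # v) = word (q # q' # u @ Inr y # v) + word (q # q' # u @ Inr y' # v)"
    "word (q # q' # u @ Inl (c *\<^sub>C x) # v) = c *\<^sub>C word (q # q' # u @ Inl x # v)"
    "word (q # q' # u @ Inr (c *\<^sub>C y) # v) = c *\<^sub>C word (q # q' # u @ Inr y # v)"
    for q q' :: "'x + 'y" and u v c x x' y y'
    using m[of q "q' # u"] by simp_all
  note mm = m m2 m3 m4 word_Inl_add word_Inr_add word_Inl_scale word_Inr_scale
  from r show ?thesis
  proof (cases rule: free_prod_rels_cases)
    case (1 u v x x')
    show ?thesis unfolding 1 using a[of "Inl (x + x')" "Inl x" u v] a[of "Inl (x + x')" "Inl x'" u v]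
      by (cases u) (simp_all add: base mm inv_Inl)
  next
    case (2 u v x x')
    show ?thesis unfolding 2 using a[of "Inr (x + x')" "Inr x" u v] a[of "Inr (x + x')" "Inr x'" u v]
      by (cases u) (simp_all add: base mm inv_Inr)
  next
    case (3 u v c x)
    show ?thesis unfolding 3 using a[of "Inl (c *\<^sub>C x)" "Inl x" u v]
      by (cases u) (simp_all add: base mm inv_Inl)
  next
    case (4 u v c x)
    show ?thesis unfolding 4 using a[of "Inr (c *\<^sub>C x)" "Inr x" u v]
      by (cases u) (simp_all add: base mm inv_Inr)
  next
    case (5 w)
    then show ?thesis by (simp add: lop_basis_pre lin)
  qed
qed

end

lemma letter_Inl: "letter Inl True"
proof
  have i: "inv Inl (Inl x) = x" for x :: 'a by (simp add: inv_f_f)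
  show "l \<in> range Inl \<longleftrightarrow> isl l = True" for l :: "'a + 'b" by (cases l) auto
  show "inv Inl (Inl (x + x')) = inv Inl (Inl x) + inv Inl (Inl x')" for x x' :: 'a
    unfolding i ..
  show "inv Inl (Inl (c *\<^sub>C x)) = c *\<^sub>C inv Inl (Inl x)" for c and x :: 'a
    unfolding i ..
qed (simp_all add: word_Inl_add word_Inl_scale)

lemma letter_Inr: "letter (Inr :: 'b::complex_vector \<Rightarrow> 'a::complex_vector + 'b) False"
proof
  have i: "inv Inr (Inr x) = x" for x :: 'b by (simp add: inv_f_f)
  show "l \<in> range Inr \<longleftrightarrow> isl l = False" for l :: "'a + 'b" by (cases l) auto
  show "inv Inr (Inr (x + x')) = inv Inr (Inr x) + inv Inr (Inr x')" for x x' :: 'b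
    unfolding i ..
  show "inv Inr (Inr (c *\<^sub>C x)) = c *\<^sub>C inv Inr (Inr x)" for c and x :: 'b
    unfolding i ..
qed (simp_all add: word_Inr_add word_Inr_scale)

section \<open>Agreement of the operators on the free product with those on representatives\<close>

lemma clinear_eq_on_span:
  assumes "clinear f" "clinear g" "\<And>x. x \<in> B \<Longrightarrow> f x = g x" "x \<in> cspan B"
  shows "f x = g x"
proof -
  have "clinear (\<lambda>x. f x - g x)"
    by (rule clinearI)
      (simp_all add: clinearD(1,2)[OF assms(1)] clinearD(1,2)[OF assms(2)] cvec.scale_right_diff_distrib)
  from clinear_zero_on_span[OF this _ assms(4)] assms(3) show ?thesis by simp
qed

lemma abs_rep: "abs_free_prod (rep_free_prod h) = h"
  by (rule Quotient3_abs_rep[OF Quotient3_free_prod])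

text \<open>Maps on the quotient are defined through whichever representative
  \<open>rep_free_prod\<close> returns; a linear map that kills the relations does not see this
  choice.\<close>

lemma clinear_well_def:
  assumes "clinear f" "\<And>r. r \<in> free_prod_rels \<Longrightarrow> f r = 0"
  shows "f (rep_free_prod (abs_free_prod p)) = f p"
proof -
  have "f (rep_free_prod (abs_free_prod p) - p) = 0"
    by (rule clinear_zero_on_span[OF assms rep_free_prod_cong])
  then show ?thesis by (simp add: clinearD[OF assms(1)])
qed

lemma attach_left_abs: "attach_left z (abs_free_prod p) = lin_ext (\<lambda>w. word (z # w)) p"
  unfolding attach_left_def
  by (rule clinear_well_def[OF clinear_lin_ext]) (use word_rel_zero[of _ "[z]" "[]"] in simp)

lemma attach_right_abs: "attach_right z (abs_free_prod p) = lin_ext (\<lambda>w. word (w @ [z])) p"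
  unfolding attach_right_def
  by (rule clinear_well_def[OF clinear_lin_ext]) (use word_rel_zero[of _ "[]" "[z]"] in simp)

lemma clinear_descend:
  assumes "clinear g" "\<And>p. f (abs_free_prod p) = g p"
  shows "clinear f"
proof (rule clinearI)
  fix x y :: "('a, 'b) free_prod" and c
  have "f (abs_free_prod (rep_free_prod x + rep_free_prod y)) = f x + f y"
    by (simp only: assms(2) clinearD[OF assms(1)]) (simp only: assms(2)[symmetric] abs_rep)
  then show "f (x + y) = f x + f y" by (simp add: clinearD[OF clinear_abs] abs_rep)
  have "f (abs_free_prod (c *\<^sub>C rep_free_prod x)) = c *\<^sub>C f x"
    by (simp only: assms(2) clinearD[OF assms(1)]) (simp only: assms(2)[symmetric] abs_rep)
  then show "f (c *\<^sub>C x) = c *\<^sub>C f x" by (simp add: clinearD[OF clinear_abs] abs_rep)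
qed

lemma clinear_attach_left: "clinear (attach_left z)"
  by (rule clinear_descend[OF clinear_lin_ext attach_left_abs])

lemma clinear_attach_right: "clinear (attach_right z)"
  by (rule clinear_descend[OF clinear_lin_ext attach_right_abs])

lemma abs_tensor_rep: "abs_tensor (rep_tensor h) = h"
  by (rule Quotient3_abs_rep[OF Quotient3_tensor])

lemma clinear_tensor_lift:
  assumes "\<And>u. clinear (g u)" "\<And>v. clinear (\<lambda>u. g u v)"
  shows "clinear (tensor_lift g)"
proof (rule clinearI)
  note lift = tensor_lift_abs[of g, OF assms]
  note lin = clinearD[OF clinear_lin_ext]
  fix x y :: "('a, 'b) tensor" and c
  have "tensor_lift g (abs_tensor (rep_tensor x + rep_tensor y)) = tensor_lift g x + tensor_lift g y"
    by (simp only: lift lin) (simp only: lift[symmetric] abs_tensor_rep)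
  then show "tensor_lift g (x + y) = tensor_lift g x + tensor_lift g y"
    by (simp add: plus_tensor.abs_eq[symmetric] abs_tensor_rep)
  have "tensor_lift g (abs_tensor (c *\<^sub>C rep_tensor x)) = c *\<^sub>C tensor_lift g x"
    by (simp only: lift lin) (simp only: lift[symmetric] abs_tensor_rep)
  then show "tensor_lift g (c *\<^sub>C x) = c *\<^sub>C tensor_lift g x"
    by (simp add: scaleC_tensor.abs_eq[symmetric] abs_tensor_rep)
qed

lemma abs_tensor_rel_zero: "r \<in> tensor_rels \<Longrightarrow> abs_tensor r = 0"
  using tensor.abs_eq_iff[of r 0] by (simp add: zero_tensor.abs_eq cvec.span_base)

lemma tens_add_left: "(u + u') \<otimes> v = u \<otimes> v + u' \<otimes> v"
  and tens_add_right: "u \<otimes> (v + v') = u \<otimes> v + u \<otimes> v'"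
  and tens_scale_left: "(c *\<^sub>C u) \<otimes> v = c *\<^sub>C (u \<otimes> v)"
  and tens_scale_right: "u \<otimes> (c *\<^sub>C v) = c *\<^sub>C (u \<otimes> v)"
proof -
  note eqs = minus_tensor.abs_eq[symmetric] scaleC_tensor.abs_eq[symmetric] tens.abs_eq[symmetric]
  have "abs_tensor (basis_vec (u + u', v) - basis_vec (u, v) - basis_vec (u', v)) = 0"
    by (rule abs_tensor_rel_zero) (unfold tensor_rels_def, blast)
  then show "(u + u') \<otimes> v = u \<otimes> v + u' \<otimes> v" unfolding eqs by (simp add: diff_diff_eq)
  have "abs_tensor (basis_vec (u, v + v') - basis_vec (u, v) - basis_vec (u, v')) = 0"
    by (rule abs_tensor_rel_zero) (unfold tensor_rels_def, blast)
  then show "u \<otimes> (v + v') = u \<otimes> v + u \<otimes> v'" unfolding eqs by (simp add: diff_diff_eq)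
  have "abs_tensor (basis_vec (c *\<^sub>C u, v) - c *\<^sub>C basis_vec (u, v)) = 0"
    by (rule abs_tensor_rel_zero) (unfold tensor_rels_def, blast)
  then show "(c *\<^sub>C u) \<otimes> v = c *\<^sub>C (u \<otimes> v)" by (simp add: eqs)
  have "abs_tensor (basis_vec (u, c *\<^sub>C v) - c *\<^sub>C basis_vec (u, v)) = 0"
    by (rule abs_tensor_rel_zero) (unfold tensor_rels_def, blast)
  then show "u \<otimes> (c *\<^sub>C v) = c *\<^sub>C (u \<otimes> v)" by (simp add: eqs)
qed

lemma tensor_map_bilinear:
  assumes "clinear S" "clinear T"
  shows "clinear (\<lambda>v. S u \<otimes> T v)" "clinear (\<lambda>u. S u \<otimes> T v)"
  by (rule clinearI; simp add: clinearD[OF assms(1)] clinearD[OF assms(2)] tens_add_left tens_add_right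
      tens_scale_left tens_scale_right)+

lemma clinear_tensor_map: "clinear S \<Longrightarrow> clinear T \<Longrightarrow> clinear (tensor_map S T)"
  unfolding tensor_map_def by (rule clinear_tensor_lift) (rule tensor_map_bilinear; assumption)+

lemma tensor_map_tens: "clinear S \<Longrightarrow> clinear T \<Longrightarrow> tensor_map S T (u \<otimes> v) = S u \<otimes> T v"
  unfolding tensor_map_def by (rule tensor_lift_tens) (rule tensor_map_bilinear; assumption)+

lemma clinear_id: "clinear id"
  by (rule clinearI) simp_all

lemma alternating_Cons: "alternating (l # w) \<longleftrightarrow> alternating w \<and> (w = [] \<or> isl (hd w) \<noteq> isl l)"
  by (cases w) (auto simp: alternating_def)

lemma alternating_snoc: "alternating (w @ [l]) \<longleftrightarrow> alternating w \<and> (w = [] \<or> isl (last w) \<noteq> isl l)"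
  by (cases w rule: rev_cases) (auto simp: alternating_def successively_append_iff)

lemma abs_spanned: "abs_free_prod p \<in> cspan {word w |w. alternating w}"
proof -
  have "word w \<in> cspan {word w |w. alternating w}" for w :: "('a + 'b) list"
    by (cases "alternating w") (auto intro: cvec.span_base simp: word_not_alternating cvec.span_zero)
  then show ?thesis
    unfolding abs_eq_lin_ext lin_ext_def by (intro cvec.span_sum cvec.span_scale)
qed

context letter
begin

lemma linear_attach_letter: "clinear (\<lambda>z. attach_left (\<iota> z) h)" "clinear (\<lambda>z. attach_right (\<iota> z) h)"
proof -
  obtain p where h: "h = abs_free_prod p" by (metis abs_rep)
  have add: "word (w @ [\<iota> (z + z')]) = word (w @ [\<iota> z]) + word (w @ [\<iota> z'])"
    and sc: "word (w @ [\<iota> (c *\<^sub>C z)]) = c *\<^sub>C word (w @ [\<iota> z])" for w z z' c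
    using word_add[of w z z' "[]"] word_scale[of w c z "[]"] by simp_all
  show "clinear (\<lambda>z. attach_left (\<iota> z) h)" "clinear (\<lambda>z. attach_right (\<iota> z) h)"
    unfolding h attach_left_abs attach_right_abs lin_ext_def
    by (rule clinearI; simp add: word_add_hd word_scale_hd add sc scaleC_add_right sum.distrib
        scaleC_scaleC cvec.scale_sum_right mult.commute)+
qed

lemma attach_letter_zero: "attach_left (\<iota> 0) h = 0" "attach_right (\<iota> 0) h = 0"
  using clinearD(3)[OF linear_attach_letter(1)] clinearD(3)[OF linear_attach_letter(2)] by simp_all

lemma V_bilinear: "clinear ((\<lambda>(c, z) h. c *\<^sub>C h + attach_left (\<iota> z) h) u)"
  "clinear (\<lambda>u. (\<lambda>(c, z) h. c *\<^sub>C h + attach_left (\<iota> z) h) u v)"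
  by (cases u; rule clinearI; auto simp: clinearD[OF clinear_attach_left] scaleC_add_right
      scaleC_add_left scaleC_scaleC clinearD[OF linear_attach_letter(1)] scaleC_prod_def scaleC_complex_def
      mult.commute algebra_simps)+

lemma W_bilinear: "clinear ((\<lambda>h (c, z). c *\<^sub>C h + attach_right (\<iota> z) h) v)"
  "clinear (\<lambda>v. (\<lambda>h (c, z). c *\<^sub>C h + attach_right (\<iota> z) h) v u)"
  by (cases u; rule clinearI; auto simp: clinearD[OF clinear_attach_right] scaleC_add_right
      scaleC_add_left scaleC_scaleC clinearD[OF linear_attach_letter(2)] scaleC_prod_def scaleC_complex_def
      mult.commute algebra_simps)+

lemma V_tens: "V \<iota> ((c, z) \<otimes> h) = c *\<^sub>C h + attach_left (\<iota> z) h"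
  unfolding V_def using tensor_lift_tens[OF V_bilinear, of "(c, z)" h] by simp

lemma W_tens: "W \<iota> (h \<otimes> (c, z)) = c *\<^sub>C h + attach_right (\<iota> z) h"
  unfolding W_def using tensor_lift_tens[OF W_bilinear, of h "(c, z)"] by simp

lemma clinear_V: "clinear (V \<iota>)"
  unfolding V_def by (rule clinear_tensor_lift[OF V_bilinear])

lemma clinear_W: "clinear (W \<iota>)"
  unfolding W_def by (rule clinear_tensor_lift[OF W_bilinear])

text \<open>A head on side \<open>b\<close> is split off as the tensor factor; any other word is
  paired with the state vector \<open>(1, 0)\<close>. Surjectivity guarantees that
  \<open>inv_into\<close> returns a genuine preimage.\<close>

lemma range_V: "abs_free_prod p \<in> V \<iota> ` left_tensors \<iota>"
proof -
  interpret L: Vector_Spaces.linear scaleC scaleC "V \<iota>" by (rule clinear_V)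
  have "word w \<in> V \<iota> ` left_tensors \<iota>" if w: "alternating w" for w
  proof (cases "w \<noteq> [] \<and> isl (hd w) = b")
    case True
    then obtain l w' where l: "w = l # w'" "isl l = b" by (cases w) auto
    have "word w' \<in> left_space \<iota>"
      unfolding left_space_def using w l by (intro cvec.span_base) (auto simp: alternating_Cons range_iff)
    then have "(0, inv \<iota> l) \<otimes> word w' \<in> left_tensors \<iota>"
      unfolding left_tensors_def by (intro cvec.span_base) blast
    moreover have "V \<iota> ((0, inv \<iota> l) \<otimes> word w') = word w"
      using l by (simp add: V_tens attach_left_word letter_inv)
    ultimately show ?thesis by (metis image_eqI)
  next
    case False
    then have "word w \<in> left_space \<iota>"
      unfolding left_space_def using w by (intro cvec.span_base) (auto simp: range_iff)
    then have "(1, 0) \<otimes> word w \<in> left_tensors \<iota>"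
      unfolding left_tensors_def by (intro cvec.span_base) blast
    moreover have "V \<iota> ((1, 0) \<otimes> word w) = word w"
      by (simp add: V_tens attach_letter_zero scaleC_one)
    ultimately show ?thesis by (metis image_eqI)
  qed
  then have "{word w |w. alternating w} \<subseteq> V \<iota> ` left_tensors \<iota>" by blast
  then have "cspan {word w |w. alternating w} \<subseteq> V \<iota> ` left_tensors \<iota>"
    unfolding left_tensors_def by (rule cvec.span_minimal[OF _ L.subspace_image[OF cvec.subspace_span]])
  then show ?thesis using abs_spanned by blast
qed

lemma range_W: "abs_free_prod p \<in> W \<iota> ` right_tensors \<iota>"
proof -
  interpret L: Vector_Spaces.linear scaleC scaleC "W \<iota>" by (rule clinear_W)
  have "word w \<in> W \<iota> ` right_tensors \<iota>" if w: "alternating w" for w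
  proof (cases "w \<noteq> [] \<and> isl (last w) = b")
    case True
    then obtain l w' where l: "w = w' @ [l]" "isl l = b" by (cases w rule: rev_cases) auto
    have "word w' \<in> right_space \<iota>"
      unfolding right_space_def using w l by (intro cvec.span_base) (auto simp: alternating_snoc range_iff)
    then have "word w' \<otimes> (0, inv \<iota> l) \<in> right_tensors \<iota>"
      unfolding right_tensors_def by (intro cvec.span_base) blast
    moreover have "W \<iota> (word w' \<otimes> (0, inv \<iota> l)) = word w"
      using l by (simp add: W_tens attach_right_word letter_inv)
    ultimately show ?thesis by (metis image_eqI)
  next
    case False
    then have "word w \<in> right_space \<iota>"
      unfolding right_space_def using w by (intro cvec.span_base) (auto simp: range_iff)
    then have "word w \<otimes> (1, 0) \<in> right_tensors \<iota>"
      unfolding right_tensors_def by (intro cvec.span_base) blast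
    moreover have "W \<iota> (word w \<otimes> (1, 0)) = word w"
      by (simp add: W_tens attach_letter_zero scaleC_one)
    ultimately show ?thesis by (metis image_eqI)
  qed
  then have "{word w |w. alternating w} \<subseteq> W \<iota> ` right_tensors \<iota>" by blast
  then have "cspan {word w |w. alternating w} \<subseteq> W \<iota> ` right_tensors \<iota>"
    unfolding right_tensors_def by (rule cvec.span_minimal[OF _ L.subspace_image[OF cvec.subspace_span]])
  then show ?thesis using abs_spanned by blast
qed

lemma rop_basis_pre: "rop \<iota> T (basis_vec w) = (if \<not> alternating w then 0
    else if w \<noteq> [] \<and> isl (last w) = b
      then fst (T (0, inv \<iota> (last w))) *\<^sub>C basis_vec (butlast w) + basis_vec (butlast w @ [\<iota> (snd (T (0, inv \<iota> (last w))))])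
    else fst (T (1, 0)) *\<^sub>C basis_vec w + basis_vec (w @ [\<iota> (snd (T (1, 0)))]))"
  using alternating_rev[of w]
  by (cases w rule: rev_cases) (simp_all add: rop_def lop_basis_pre clinearD[OF clinear_rev_word])

lemma split_pair:
  assumes "clinear T"
  shows "T (c, z) = (c * fst (T (1, 0)) + fst (T (0, z)), c *\<^sub>C snd (T (1, 0)) + snd (T (0, z)))"
proof -
  have "T (c, z) = T (c *\<^sub>C (1, 0) + (0, z))" by (simp add: scaleC_prod_def scaleC_complex_def)
  also have "\<dots> = c *\<^sub>C T (1, 0) + T (0, z)" by (simp only: clinearD[OF assms])
  finally show ?thesis by (simp add: scaleC_prod_def scaleC_complex_def prod_eq_iff)
qed

text \<open>The map \<open>lam\<close> induced by \<open>lop\<close> satisfies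
  \<open>V (T \<otimes> id) = lam V\<close> on the tensors in question, so whichever preimage
  \<open>inv_into\<close> picks, the outcome is \<open>lam\<close>.\<close>

lemma lambda_op_abs:
  assumes T: "clinear T"
  shows "lambda_op \<iota> T (abs_free_prod p) = abs_free_prod (lop \<iota> T p)"
proof -
  define lam where "lam = (\<lambda>h. abs_free_prod (lop \<iota> T (rep_free_prod h)))"
  have cl: "clinear (\<lambda>p. abs_free_prod (lop \<iota> T p))"
    by (rule clinear_comp[OF clinear_abs clinear_lop])
  have lam_abs: "lam (abs_free_prod p) = abs_free_prod (lop \<iota> T p)" for p
    unfolding lam_def by (rule clinear_well_def[OF cl]) (rule abs_lop_rel[OF T])
  have lin: "clinear lam" by (rule clinear_descend[OF cl lam_abs])
  have lam_word: "lam (word w) = abs_free_prod (lop \<iota> T (basis_vec w))" for w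
    by (simp add: lam_abs flip: abs_basis)
  have gen: "V \<iota> (tensor_map T id ((c, z) \<otimes> h)) = lam (V \<iota> ((c, z) \<otimes> h))" if "h \<in> left_space \<iota>" for c z h
  proof (rule clinear_eq_on_span[of _ "\<lambda>h. lam (V \<iota> ((c, z) \<otimes> h))", OF _ _ _ that[unfolded left_space_def]])
    have "clinear (\<lambda>h. (c, z) \<otimes> h)" for c z
      by (rule clinearI) (simp_all add: tens_add_right tens_scale_right)
    note cc = this[of c z]
    show "clinear (\<lambda>h. V \<iota> (tensor_map T id ((c, z) \<otimes> h)))"
      by (rule clinear_comp[OF clinear_comp[OF clinear_V clinear_tensor_map[OF T clinear_id]] cc])
    show "clinear (\<lambda>h. lam (V \<iota> ((c, z) \<otimes> h)))"
      by (rule clinear_comp[OF lin clinear_comp[OF clinear_V cc]])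
    fix h assume "h \<in> {word w |w. alternating w \<and> (w = [] \<or> hd w \<notin> range \<iota>)}"
    then obtain w where w: "h = word w" "alternating w" "w = [] \<or> isl (hd w) \<noteq> b"
      by (auto simp: range_iff)
    then have alt: "alternating (\<iota> z # w)" and nb: "\<not> (w \<noteq> [] \<and> isl (hd w) = b)"
      by (auto simp: alternating_Cons)
    have *: "lop \<iota> T (basis_vec w) = fst (T (1, 0)) *\<^sub>C basis_vec w + basis_vec (\<iota> (snd (T (1, 0))) # w)"
      by (subst lop_basis_pre) (simp only: nb w(2) if_False not_True_eq_False)
    have **: "lop \<iota> T (basis_vec (\<iota> z # w)) = fst (T (0, z)) *\<^sub>C basis_vec w + basis_vec (\<iota> (snd (T (0, z))) # w)"
      by (simp add: lop_basis_pre alt)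
    show "V \<iota> (tensor_map T id ((c, z) \<otimes> h)) = lam (V \<iota> ((c, z) \<otimes> h))"
      by (simp add: * ** tensor_map_tens[OF T clinear_id] split_pair[OF T, of c z] V_tens w(1) attach_left_word
          clinearD[OF lin] lam_word clinearD[OF clinear_abs] abs_basis word_add_hd word_scale_hd
          scaleC_add_left scaleC_add_right scaleC_scaleC algebra_simps)
  qed
  have main: "V \<iota> (tensor_map T id t) = lam (V \<iota> t)" if "t \<in> left_tensors \<iota>" for t
  proof (rule clinear_eq_on_span[of _ "\<lambda>t. lam (V \<iota> t)", OF _ _ _ that[unfolded left_tensors_def]])
    show "clinear (\<lambda>t. V \<iota> (tensor_map T id t))" "clinear (\<lambda>t. lam (V \<iota> t))"
      by (rule clinear_comp[OF clinear_V clinear_tensor_map[OF T clinear_id]], rule clinear_comp[OF lin clinear_V])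
    fix t assume "t \<in> {u \<otimes> h |(u :: complex \<times> 'z) h. h \<in> left_space \<iota>}"
    then obtain c z h where "t = (c, z) \<otimes> h" "h \<in> left_space \<iota>" by fastforce
    then show "V \<iota> (tensor_map T id t) = lam (V \<iota> t)" by (simp only: gen)
  qed
  show ?thesis
    unfolding lambda_op_def comp_apply
    by (simp add: main[OF inv_into_into[OF range_V]] f_inv_into_f[OF range_V] lam_abs)
qed

lemma rho_op_abs:
  assumes T: "clinear T"
  shows "rho_op \<iota> T (abs_free_prod p) = abs_free_prod (rop \<iota> T p)"
proof -
  define lam where "lam = (\<lambda>h. abs_free_prod (rop \<iota> T (rep_free_prod h)))"
  have cl: "clinear (\<lambda>p. abs_free_prod (rop \<iota> T p))"
    by (rule clinear_comp[OF clinear_abs clinear_rop])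
  \<comment> \<open>Reversal and \<open>lop\<close> each respect the relations, hence so does
    \<open>rop\<close>, which is composed of them.\<close>
  have rv: "abs_free_prod (rev_word q) = 0" if "abs_free_prod q = 0" for q :: "('x + 'y) list \<Rightarrow>\<^sub>0 complex"
  proof -
    have "q - 0 \<in> cspan free_prod_rels" using that abs_eq_iff_span[of q 0] by (simp only: clinearD(3)[OF clinear_abs] simp_thms)
    then show ?thesis
      using clinear_zero_on_span[OF clinear_comp[OF clinear_abs clinear_rev_word] abs_rev_word_rel] by simp
  qed
  have lo: "abs_free_prod (lop \<iota> T q) = 0" if "abs_free_prod q = 0" for q
  proof -
    have "q - 0 \<in> cspan free_prod_rels" using that abs_eq_iff_span[of q 0] by (simp only: clinearD(3)[OF clinear_abs] simp_thms)
    then show ?thesis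
      using clinear_zero_on_span[OF clinear_comp[OF clinear_abs clinear_lop] abs_lop_rel[OF T]] by simp
  qed
  have lam_abs: "lam (abs_free_prod p) = abs_free_prod (rop \<iota> T p)" for p
    unfolding lam_def by (rule clinear_well_def[OF cl]) (simp add: rop_def rv lo abs_rel_zero)
  have lin: "clinear lam" by (rule clinear_descend[OF cl lam_abs])
  have lam_word: "lam (word w) = abs_free_prod (rop \<iota> T (basis_vec w))" for w
    by (simp add: lam_abs flip: abs_basis)
  have add: "word (w @ [\<iota> (z + z')]) = word (w @ [\<iota> z]) + word (w @ [\<iota> z'])"
    and sc: "word (w @ [\<iota> (c *\<^sub>C z)]) = c *\<^sub>C word (w @ [\<iota> z])" for w z z' c
    using word_add[of w z z' "[]"] word_scale[of w c z "[]"] by simp_all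
  have gen: "W \<iota> (tensor_map id T (h \<otimes> (c, z))) = lam (W \<iota> (h \<otimes> (c, z)))" if "h \<in> right_space \<iota>" for c z h
  proof (rule clinear_eq_on_span[of _ "\<lambda>h. lam (W \<iota> (h \<otimes> (c, z)))", OF _ _ _ that[unfolded right_space_def]])
    have "clinear (\<lambda>h. h \<otimes> (c, z))" for c z
      by (rule clinearI) (simp_all add: tens_add_left tens_scale_left)
    note cc = this[of c z]
    show "clinear (\<lambda>h. W \<iota> (tensor_map id T (h \<otimes> (c, z))))"
      by (rule clinear_comp[OF clinear_comp[OF clinear_W clinear_tensor_map[OF clinear_id T]] cc])
    show "clinear (\<lambda>h. lam (W \<iota> (h \<otimes> (c, z))))"
      by (rule clinear_comp[OF lin clinear_comp[OF clinear_W cc]])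
    fix h assume "h \<in> {word w |w. alternating w \<and> (w = [] \<or> last w \<notin> range \<iota>)}"
    then obtain w where w: "h = word w" "alternating w" "w = [] \<or> isl (last w) \<noteq> b"
      by (auto simp: range_iff)
    then have alt: "alternating (w @ [\<iota> z])" and nb: "\<not> (w \<noteq> [] \<and> isl (last w) = b)"
      by (auto simp: alternating_snoc)
    have *: "rop \<iota> T (basis_vec w) = fst (T (1, 0)) *\<^sub>C basis_vec w + basis_vec (w @ [\<iota> (snd (T (1, 0)))])"
      by (subst rop_basis_pre) (simp only: nb w(2) if_False not_True_eq_False)
    have **: "rop \<iota> T (basis_vec (w @ [\<iota> z])) = fst (T (0, z)) *\<^sub>C basis_vec w + basis_vec (w @ [\<iota> (snd (T (0, z)))])"
      by (simp add: rop_basis_pre alt)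
    show "W \<iota> (tensor_map id T (h \<otimes> (c, z))) = lam (W \<iota> (h \<otimes> (c, z)))"
      by (simp add: * ** tensor_map_tens[OF clinear_id T] split_pair[OF T, of c z] W_tens w(1) attach_right_word
          clinearD[OF lin] lam_word clinearD[OF clinear_abs] abs_basis add sc
          scaleC_add_left scaleC_add_right scaleC_scaleC algebra_simps)
  qed
  have main: "W \<iota> (tensor_map id T t) = lam (W \<iota> t)" if "t \<in> right_tensors \<iota>" for t
  proof (rule clinear_eq_on_span[of _ "\<lambda>t. lam (W \<iota> t)", OF _ _ _ that[unfolded right_tensors_def]])
    show "clinear (\<lambda>t. W \<iota> (tensor_map id T t))" "clinear (\<lambda>t. lam (W \<iota> t))"
      by (rule clinear_comp[OF clinear_W clinear_tensor_map[OF clinear_id T]], rule clinear_comp[OF lin clinear_W])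
    fix t assume "t \<in> {h \<otimes> u |h (u :: complex \<times> 'z). h \<in> right_space \<iota>}"
    then obtain c z h where "t = h \<otimes> (c, z)" "h \<in> right_space \<iota>" by fastforce
    then show "W \<iota> (tensor_map id T t) = lam (W \<iota> t)" by (simp only: gen)
  qed
  show ?thesis
    unfolding rho_op_def comp_apply
    by (simp add: main[OF inv_into_into[OF range_W]] f_inv_into_f[OF range_W] lam_abs)
qed

end

section \<open>Concatenation and spans of words\<close>

abbreviation vac :: "('l list \<Rightarrow>\<^sub>0 complex) \<Rightarrow> complex"
  where "vac p \<equiv> Poly_Mapping.lookup p []"

lemma vacuum_coeff_abs: "vacuum_coeff (abs_free_prod p) = vac p"
  by (rule vacuum_coeff.abs_eq)

definition conc :: "('l list \<Rightarrow>\<^sub>0 complex) \<Rightarrow> ('l list \<Rightarrow>\<^sub>0 complex) \<Rightarrow> ('l list \<Rightarrow>\<^sub>0 complex)"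
  where "conc p q = lin_ext (\<lambda>u. lin_ext (\<lambda>v. basis_vec (u @ v)) q) p"

lemma clinear_conc_left: "clinear (\<lambda>p. conc p q)"
  unfolding conc_def by (rule clinear_lin_ext)

lemma clinear_conc_right: "clinear (conc p)"
proof (rule clinearI)
  show "conc p (x + y) = conc p x + conc p y" for x y
    by (simp add: conc_def clinearD[OF clinear_lin_ext] lin_ext_def[of _ p] scaleC_add_right sum.distrib)
  show "conc p (c *\<^sub>C x) = c *\<^sub>C conc p x" for c x
    by (simp add: conc_def clinearD[OF clinear_lin_ext] lin_ext_def[of _ p] cvec.scale_sum_right scaleC_scaleC mult.commute)
qed

lemma conc_basis [simp]: "conc (basis_vec u) (basis_vec v) = basis_vec (u @ v)"
  by (simp add: conc_def)

lemma conc_Nil_left [simp]: "conc (basis_vec []) p = p"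
  by (rule clinear_eq_on_basis[OF clinear_conc_right]) (rule clinearI, simp_all)

lemma conc_Nil_right [simp]: "conc p (basis_vec []) = p"
  by (rule clinear_eq_on_basis[OF clinear_conc_left]) (rule clinearI, simp_all)

lemma conc_assoc_basis: "conc (basis_vec u) (conc p q) = conc (conc (basis_vec u) p) q"
proof (rule clinear_eq_on_basis[OF clinear_comp[OF clinear_conc_right clinear_conc_right] clinear_conc_right])
  fix v
  show "conc (basis_vec u) (conc p (basis_vec v)) = conc (conc (basis_vec u) p) (basis_vec v)"
    by (rule clinear_eq_on_basis[OF clinear_comp[OF clinear_conc_right clinear_conc_left]
          clinear_comp[OF clinear_conc_left clinear_conc_right]]) simp
qed

lemma clinear_vac: "clinear (\<lambda>p. vac p)"
  by (rule clinearI) (simp_all add: lookup_add scaleC_poly_mapping.rep_eq)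

lemma vac_basis: "vac (basis_vec w) = (if w = [] then 1 else 0)"
  by (auto simp: lookup_single when_def)

text \<open>Restricting to alternating words spares later arguments the words on which
  \<open>lop\<close> and \<open>rop\<close> are 0 by definition.\<close>

definition wspan :: "(('x + 'y) list \<Rightarrow> bool) \<Rightarrow> (('x + 'y) list \<Rightarrow>\<^sub>0 complex) set"
  where "wspan P = cspan {basis_vec w |w. alternating w \<and> P w}"

lemma wspan_basis: "alternating w \<Longrightarrow> P w \<Longrightarrow> basis_vec w \<in> wspan P"
  unfolding wspan_def by (rule cvec.span_base) blast

lemma wspan_add: "p \<in> wspan P \<Longrightarrow> q \<in> wspan P \<Longrightarrow> p + q \<in> wspan P"
  unfolding wspan_def by (rule cvec.span_add)

lemma wspan_scale: "p \<in> wspan P \<Longrightarrow> c *\<^sub>C p \<in> wspan P"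
  unfolding wspan_def by (rule cvec.span_scale)

lemma wspan_0: "0 \<in> wspan P"
  unfolding wspan_def by (rule cvec.span_zero)

lemma wspan_mono: "(\<And>w. P w \<Longrightarrow> Q w) \<Longrightarrow> p \<in> wspan P \<Longrightarrow> p \<in> wspan Q"
  unfolding wspan_def by (erule rev_subsetD[OF _ cvec.span_mono]) blast

lemma wspan_eq:
  assumes "clinear f" "clinear g" "\<And>w. alternating w \<Longrightarrow> P w \<Longrightarrow> f (basis_vec w) = g (basis_vec w)" "p \<in> wspan P"
  shows "f p = g p"
  by (rule clinear_eq_on_span[OF assms(1,2) _ assms(4)[unfolded wspan_def]]) (use assms(3) in blast)

lemma wspan_zero:
  assumes "clinear f" "\<And>w. alternating w \<Longrightarrow> P w \<Longrightarrow> f (basis_vec w) = 0" "p \<in> wspan P"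
  shows "f p = 0"
  by (rule clinear_zero_on_span[OF assms(1) _ assms(3)[unfolded wspan_def]]) (use assms(2) in blast)

lemma wspan_map:
  assumes "clinear f" "\<And>w. alternating w \<Longrightarrow> P w \<Longrightarrow> f (basis_vec w) \<in> wspan Q" "p \<in> wspan P"
  shows "f p \<in> wspan Q"
  using assms(3) unfolding wspan_def
proof (induction rule: cvec.span_induct_alt)
  case base
  then show ?case by (simp add: clinearD[OF assms(1)] cvec.span_zero)
next
  case (step c x y)
  then have "f x \<in> cspan {basis_vec w |w. alternating w \<and> Q w}"
    using assms(2) unfolding wspan_def by blast
  with step show ?case
    by (simp add: clinearD[OF assms(1)] cvec.span_add cvec.span_scale)
qed

text \<open>At the level of representatives, \<open>short b\<close> stands for the space
  \<open>\<X>\<^sub>b\<close> of side \<open>b\<close>, \<open>one_letter b\<close> for its centred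
  part, and \<open>no_head b\<close> for the space \<open>\<X>(\<ell>,b)\<close>.\<close>

abbreviation "heads b \<equiv> wspan (\<lambda>w. w \<noteq> [] \<and> isl (hd w) = b)"
abbreviation "no_head b \<equiv> wspan (\<lambda>w. w = [] \<or> isl (hd w) = (\<not> b))"
abbreviation "short b \<equiv> wspan (\<lambda>w. w = [] \<or> (\<exists>l. w = [l] \<and> isl l = b))"
abbreviation "one_letter b \<equiv> wspan (\<lambda>w. \<exists>l. w = [l] \<and> isl l = b)"

lemma alternating_Nil [simp]: "alternating []" and alternating_single [simp]: "alternating [l]"
  by (simp_all add: alternating_def)

text \<open>The source of freeness: the vacuum part of \<open>g\<close> leaves \<open>h\<close>
  alone, and the one-letter part puts a new head in front of it.\<close>

lemma conc_decomp:
  assumes "g \<in> short b" "h \<in> no_head b"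
  shows "conc g h - vac g *\<^sub>C h \<in> heads b"
proof (rule wspan_map[OF _ _ assms(1), of "\<lambda>g. conc g h - vac g *\<^sub>C h"])
  show "clinear (\<lambda>g. conc g h - vac g *\<^sub>C h)"
    by (rule clinearI) (simp_all add: clinearD[OF clinear_conc_left] clinearD[OF clinear_vac] scaleC_add_left
        scaleC_complex_def scaleC_scaleC cvec.scale_right_diff_distrib)
  fix u :: "('a + 'b) list"
  assume u: "alternating u" "u = [] \<or> (\<exists>l. u = [l] \<and> isl l = b)"
  show "conc (basis_vec u) h - vac (basis_vec u) *\<^sub>C h \<in> heads b"
  proof (cases "u = []")
    case True
    then show ?thesis by (simp add: vac_basis scaleC_one wspan_0)
  next
    case False
    then obtain l where l: "u = [l]" "isl l = b" using u by auto
    have "conc (basis_vec [l]) h \<in> heads b"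
      by (rule wspan_map[OF clinear_conc_right _ assms(2)])
        (use l in \<open>auto intro!: wspan_basis simp: alternating_Cons\<close>)
    then show ?thesis by (simp add: l vac_basis)
  qed
qed

text \<open>The operator has the form \<open>T \<otimes> I\<close> for the splitting of a word into
  a head of side \<open>b\<close> and the rest. Unlike the exact shape of \<open>lop\<close>, whose
  products are no longer of that shape on representatives, this property survives sums and products
  and so covers polynomials in one generator.\<close>

definition acts :: "bool \<Rightarrow> ((('x + 'y) list \<Rightarrow>\<^sub>0 complex) \<Rightarrow> (('x + 'y) list \<Rightarrow>\<^sub>0 complex)) \<Rightarrow> bool"
  where "acts b Y \<longleftrightarrow> clinear Y \<and> (\<forall>g \<in> short b. Y g \<in> short b) \<and>
    (\<forall>g \<in> short b. \<forall>h \<in> no_head b. Y (conc g h) = conc (Y g) h)"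

definition racts :: "bool \<Rightarrow> ((('x + 'y) list \<Rightarrow>\<^sub>0 complex) \<Rightarrow> (('x + 'y) list \<Rightarrow>\<^sub>0 complex)) \<Rightarrow> bool"
  where "racts b Y \<longleftrightarrow> clinear Y \<and> (\<forall>g \<in> short b. Y g \<in> short b) \<and>
    (\<forall>g \<in> short b. \<forall>v. alternating v \<longrightarrow> v = [] \<or> isl (last v) = (\<not> b) \<longrightarrow>
       Y (conc (basis_vec v) g) = conc (basis_vec v) (Y g))"

lemma Nil_in_short: "basis_vec [] \<in> short b"
  by (rule wspan_basis) simp_all

text \<open>A centred operator has no vacuum part to fall back on, so it must put a letter of its
  own side in front. Repeated along an alternating product, this is freeness.\<close>

lemma acts_no_head:
  assumes "acts b Y" "vac (Y (basis_vec [])) = 0" "h \<in> no_head b"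
  shows "Y h \<in> heads b"
proof -
  have "Y (basis_vec []) \<in> short b" and "Y (conc (basis_vec []) h) = conc (Y (basis_vec [])) h"
    using assms(1,3) Nil_in_short[of b] by (auto simp: acts_def)
  with conc_decomp[OF this(1) assms(3)] show ?thesis by (simp add: assms(2))
qed

context letter
begin

lemma lop_hd: "alternating (\<iota> z # w) \<Longrightarrow>
    lop \<iota> T (basis_vec (\<iota> z # w)) = fst (T (0, z)) *\<^sub>C basis_vec w + basis_vec (\<iota> (snd (T (0, z))) # w)"
  by (simp add: lop_basis_pre)

lemma lop_no_hd: "alternating w \<Longrightarrow> w = [] \<or> isl (hd w) = (\<not> b) \<Longrightarrow>
    lop \<iota> T (basis_vec w) = fst (T (1, 0)) *\<^sub>C basis_vec w + basis_vec (\<iota> (snd (T (1, 0))) # w)"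
  by (auto simp: lop_basis_pre)

lemma rop_last: "alternating (w @ [\<iota> z]) \<Longrightarrow>
    rop \<iota> T (basis_vec (w @ [\<iota> z])) = fst (T (0, z)) *\<^sub>C basis_vec w + basis_vec (w @ [\<iota> (snd (T (0, z)))])"
  by (simp add: rop_basis_pre)

lemma rop_no_last: "alternating w \<Longrightarrow> w = [] \<or> isl (last w) = (\<not> b) \<Longrightarrow>
    rop \<iota> T (basis_vec w) = fst (T (1, 0)) *\<^sub>C basis_vec w + basis_vec (w @ [\<iota> (snd (T (1, 0)))])"
  by (auto simp: rop_basis_pre)

lemma letterE:
  assumes "isl l = b" obtains z where "l = \<iota> z"
  using letter_inv[OF assms] by metis

lemma short_cases:
  assumes "w = [] \<or> (\<exists>l. w = [l] \<and> isl l = b)"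
  obtains "w = []" | z where "w = [\<iota> z]"
  using assms letterE by metis

lemma lop_short: "g \<in> short b \<Longrightarrow> lop \<iota> T g \<in> short b"
proof (erule wspan_map[OF clinear_lop, rotated])
  fix w :: "('x + 'y) list" assume "w = [] \<or> (\<exists>l. w = [l] \<and> isl l = b)"
  then show "lop \<iota> T (basis_vec w) \<in> short b"
    by (cases rule: short_cases) (auto simp: lop_hd lop_no_hd intro!: wspan_add wspan_scale wspan_basis)
qed

text \<open>On the copy of \<open>\<X>\<^sub>b\<close> there is only one letter to act on. This is
  what allows left and right actions to be exchanged at the vacuum.\<close>

lemma rop_eq_lop_short: "g \<in> short b \<Longrightarrow> rop \<iota> T g = lop \<iota> T g"
proof (erule wspan_eq[OF clinear_rop clinear_lop, rotated])
  fix w :: "('x + 'y) list" assume "w = [] \<or> (\<exists>l. w = [l] \<and> isl l = b)"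
  then show "rop \<iota> T (basis_vec w) = lop \<iota> T (basis_vec w)"
    by (cases rule: short_cases) (use rop_last[of "[]"] in \<open>simp_all add: lop_hd lop_no_hd rop_no_last\<close>)
qed

lemma acts_lop: "acts b (lop \<iota> T)"
  unfolding acts_def
proof (intro conjI ballI clinear_lop lop_short)
  fix g h :: "('x + 'y) list \<Rightarrow>\<^sub>0 complex" assume g: "g \<in> short b" and h: "h \<in> no_head b"
  show "lop \<iota> T (conc g h) = conc (lop \<iota> T g) h"
  proof (rule wspan_eq[OF clinear_comp[OF clinear_lop clinear_conc_left] clinear_comp[OF clinear_conc_left clinear_lop] _ g])
    fix u :: "('x + 'y) list" assume u: "u = [] \<or> (\<exists>l. u = [l] \<and> isl l = b)"
    show "lop \<iota> T (conc (basis_vec u) h) = conc (lop \<iota> T (basis_vec u)) h"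
    proof (rule wspan_eq[OF clinear_comp[OF clinear_lop clinear_conc_right] clinear_conc_right _ h])
      fix w :: "('x + 'y) list" assume w: "alternating w" "w = [] \<or> isl (hd w) = (\<not> b)"
      show "lop \<iota> T (conc (basis_vec u) (basis_vec w)) = conc (lop \<iota> T (basis_vec u)) (basis_vec w)"
        by (rule short_cases[OF u]) (use w in \<open>auto simp: lop_hd lop_no_hd alternating_Cons clinearD[OF clinear_conc_left]\<close>)
    qed
  qed
qed

lemma racts_rop: "racts b (rop \<iota> T)"
  unfolding racts_def
proof (intro conjI ballI clinear_rop allI impI)
  fix g :: "('x + 'y) list \<Rightarrow>\<^sub>0 complex" assume g: "g \<in> short b"
  then show "rop \<iota> T g \<in> short b" by (simp add: rop_eq_lop_short lop_short)
  fix v :: "('x + 'y) list" assume v: "alternating v" "v = [] \<or> isl (last v) = (\<not> b)"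
  show "rop \<iota> T (conc (basis_vec v) g) = conc (basis_vec v) (rop \<iota> T g)"
  proof (rule wspan_eq[OF clinear_comp[OF clinear_rop clinear_conc_right] clinear_comp[OF clinear_conc_right clinear_rop] _ g])
    fix u :: "('x + 'y) list" assume u: "u = [] \<or> (\<exists>l. u = [l] \<and> isl l = b)"
    then show "rop \<iota> T (conc (basis_vec v) (basis_vec u)) = conc (basis_vec v) (rop \<iota> T (basis_vec u))"
      using v rop_last[of "[]"] by (cases rule: short_cases)
        (auto simp: rop_last rop_no_last alternating_snoc clinearD[OF clinear_conc_right])
  qed
qed

text \<open>Only the empty word and single letters of side \<open>b\<close> reach the empty word in
  one step, and there both actions agree.\<close>

lemma vac_rop: "vac (rop \<iota> T p) = vac (lop \<iota> T p)"
proof (rule clinear_eq_on_basis[OF clinear_comp[OF clinear_vac clinear_rop] clinear_comp[OF clinear_vac clinear_lop]])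
  fix w
  show "vac (rop \<iota> T (basis_vec w)) = vac (lop \<iota> T (basis_vec w))"
    by (cases w; cases "tl w" rule: rev_cases)
      (auto simp: lop_basis_pre rop_basis_pre clinearD[OF clinear_vac] vac_basis alternating_Cons scaleC_complex_def)
qed

end

section \<open>Commutation of left and right actions\<close>

lemma alternating_snoc_snoc: "alternating (w @ [l, l']) \<longleftrightarrow> alternating (w @ [l]) \<and> isl l \<noteq> isl l'"
  using alternating_snoc[of "w @ [l]" l'] by simp

text \<open>On longer words the two operators work at different ends. On the empty word and on a
  single letter of side \<open>b\<close> they are the same operator, which is where it matters that
  both come from the same \<open>T\<close>.\<close>

lemma rop_lop_commute_same:
  fixes \<iota> :: "'z::complex_vector \<Rightarrow> 'x::complex_vector + 'y::complex_vector"
  assumes "letter \<iota> b"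
  shows "rop \<iota> T (lop \<iota> T p) = lop \<iota> T (rop \<iota> T p)"
proof -
  interpret letter \<iota> b by fact
  note pre = lop_basis_pre rop_basis_pre clinearD[OF clinear_rop] clinearD[OF clinear_lop] alternating_Cons
    alternating_snoc alternating_snoc_snoc
  show ?thesis
  proof (rule clinear_eq_on_basis[OF clinear_comp[OF clinear_rop clinear_lop] clinear_comp[OF clinear_lop clinear_rop]])
    fix w :: "('x + 'y) list"
    consider "\<not> alternating w" | "w = [] \<or> (\<exists>l. w = [l] \<and> isl l = b)" | l where "w = [l]" "isl l = (\<not> b)"
      | l m l' where "w = l # m @ [l']" "alternating w"
      by (cases w; cases "tl w" rule: rev_cases) auto
    then show "rop \<iota> T (lop \<iota> T (basis_vec w)) = lop \<iota> T (rop \<iota> T (basis_vec w))"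
    proof cases
      case 1
      then show ?thesis by (simp add: lop_basis_pre rop_basis_pre clinearD[OF clinear_rop] clinearD[OF clinear_lop])
    next
      case 2
      then have "basis_vec w \<in> short b" by (intro wspan_basis) auto
      then show ?thesis by (simp add: rop_eq_lop_short lop_short)
    next
      case 3
      then show ?thesis
        by (simp add: pre scaleC_add_right scaleC_scaleC mult.commute add_ac)
    next
      case 4
      then show ?thesis
        by (cases "m = []"; cases "isl l = b"; cases "isl l' = b")
          (simp_all add: pre scaleC_add_right scaleC_scaleC mult.commute add_ac butlast_append)
    qed
  qed
qed

text \<open>With different sides no word lets both operators act on the same letter, so
  \<open>T\<close> and \<open>S\<close> are independent of each other.\<close>

lemma rop_lop_commute_other:
  fixes \<iota> :: "'z::complex_vector \<Rightarrow> 'x::complex_vector + 'y::complex_vector"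
  assumes "letter \<iota> b" "letter \<kappa> (\<not> b)"
  shows "rop \<iota> T (lop \<kappa> S p) = lop \<kappa> S (rop \<iota> T p)"
proof -
  interpret l: letter \<iota> b by fact
  interpret k: letter \<kappa> "\<not> b" by fact
  note pre = l.rop_basis_pre k.lop_basis_pre clinearD[OF clinear_rop] clinearD[OF clinear_lop] alternating_Cons
            alternating_snoc alternating_snoc_snoc
  show ?thesis
  proof (rule clinear_eq_on_basis[OF clinear_comp[OF clinear_rop clinear_lop] clinear_comp[OF clinear_lop clinear_rop]])
    fix w :: "('x + 'y) list"
    consider "\<not> alternating w" | "w = []" | l where "w = [l]"
      | l m l' where "w = l # m @ [l']" "alternating w"
      by (cases w; cases "tl w" rule: rev_cases) auto
    then show "rop \<iota> T (lop \<kappa> S (basis_vec w)) = lop \<kappa> S (rop \<iota> T (basis_vec w))"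
    proof cases
      case 1
      then show ?thesis by (simp add: pre)
    next
      case 2
      then show ?thesis by (simp add: pre scaleC_add_right scaleC_scaleC mult.commute add_ac)
    next
      case 3
      then show ?thesis by (cases "isl l = b") (simp_all add: pre scaleC_add_right scaleC_scaleC mult.commute add_ac)
    next
      case 4
      then show ?thesis
        by (cases "m = []"; cases "isl l = b"; cases "isl l' = b")
          (simp_all add: pre scaleC_add_right scaleC_scaleC mult.commute add_ac butlast_append)
    qed
  qed
qed

definition lasts :: "bool \<Rightarrow> (('x + 'y) list \<Rightarrow>\<^sub>0 complex) \<Rightarrow> (('x + 'y) list \<Rightarrow>\<^sub>0 complex)"
  where "lasts c = lin_ext (\<lambda>w. if w \<noteq> [] \<and> isl (last w) = c then basis_vec w else 0)"

lemma clinear_lasts: "clinear (lasts c)"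
  unfolding lasts_def by (rule clinear_lin_ext)

lemma lasts_basis: "lasts c (basis_vec w) = (if w \<noteq> [] \<and> isl (last w) = c then basis_vec w else 0)"
  by (simp add: lasts_def)

lemma vac_lasts: "vac (lasts c p) = 0"
  by (rule clinear_eq_on_basis[OF clinear_comp[OF clinear_vac clinear_lasts]])
    (rule clinearI, simp_all add: lasts_basis vac_basis)

lemma lasts_decomp: "p = vac p *\<^sub>C basis_vec [] + lasts b p + lasts (\<not> b) p"
proof (rule clinear_eq_on_basis[of "\<lambda>p. p" "\<lambda>p. vac p *\<^sub>C basis_vec [] + lasts b p + lasts (\<not> b) p"])
  show "clinear (\<lambda>p :: ('a + 'b) list \<Rightarrow>\<^sub>0 complex. p)" by (rule clinearI) simp_all
  show "clinear (\<lambda>p :: ('a + 'b) list \<Rightarrow>\<^sub>0 complex. vac p *\<^sub>C basis_vec [] + lasts b p + lasts (\<not> b) p)"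
    by (rule clinearI) (simp_all add: clinearD[OF clinear_vac] clinearD[OF clinear_lasts] scaleC_add_left
      scaleC_add_right scaleC_scaleC scaleC_complex_def algebra_simps)
qed (auto simp: lasts_basis vac_basis scaleC_one)

text \<open>A left operator of side \<open>b\<close> affects the end of a word only if the word is
  empty or a single letter of side \<open>b\<close>; the words that arise are then empty or end on
  side \<open>b\<close>, and the projection onto ends of the other side sees none of them.\<close>

lemma (in letter) lop_lasts: "lop \<iota> T (lasts (\<not> b) p) = lasts (\<not> b) (lop \<iota> T p)"
proof (rule clinear_eq_on_basis[OF clinear_comp[OF clinear_lop clinear_lasts] clinear_comp[OF clinear_lasts clinear_lop]])
  fix w
  show "lop \<iota> T (lasts (\<not> b) (basis_vec w)) = lasts (\<not> b) (lop \<iota> T (basis_vec w))"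
    by (cases w; cases "tl w") (auto simp: lop_basis_pre lasts_basis clinearD[OF clinear_lop] clinearD[OF clinear_lasts] alternating_Cons)
qed

section \<open>Elements and the operators that model them\<close>

text \<open>A relation instead of a map: equations that hold in the algebra need not hold for the
  operators on words, so one element may have several operators. What the element determines is the
  vacuum coefficient.\<close>

inductive corr :: "('a::cstar_algebra \<times> ('v::complex_vector \<Rightarrow> 'v)) set \<Rightarrow> 'a \<Rightarrow> ('v \<Rightarrow> 'v) \<Rightarrow> bool"
  for G where
  one: "corr G 1 (\<lambda>v. v)"
| gmult: "(g, L) \<in> G \<Longrightarrow> corr G x X \<Longrightarrow> corr G (g * x) (\<lambda>v. L (X v))"
| add: "corr G x X \<Longrightarrow> corr G y Y \<Longrightarrow> corr G (x + y) (\<lambda>v. X v + Y v)"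
| scale: "corr G x X \<Longrightarrow> corr G (c *\<^sub>C x) (\<lambda>v. c *\<^sub>C X v)"

lemma corr_mono: "corr G x X \<Longrightarrow> G \<subseteq> H \<Longrightarrow> corr H x X"
proof (induction rule: corr.induct)
  case (gmult g L x X)
  then show ?case by (intro corr.gmult) auto
next
  case (add x X y Y)
  then show ?case by (intro corr.add) auto
next
  case (scale x X c)
  then show ?case by (intro corr.scale) auto
qed (rule corr.one)

lemma corr_mult: "corr G x X \<Longrightarrow> corr G y Y \<Longrightarrow> corr G (x * y) (\<lambda>v. X (Y v))"
proof (induction rule: corr.induct)
  case (gmult g L x X)
  from corr.gmult[OF gmult(1) gmult(3)[OF gmult(4)]] show ?case by (simp add: mult.assoc)
next
  case (add x X x' X')
  from corr.add[OF add(3)[OF add(5)] add(4)[OF add(5)]] show ?case by (simp add: distrib_right)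
next
  case (scale x X c)
  from corr.scale[OF scale(2)[OF scale(3)], of c] show ?case by (simp add: mult_scaleC_left)
qed simp

lemma corr_gen: "(g, L) \<in> G \<Longrightarrow> corr G g L"
  using corr.gmult[OF _ corr.one, of g L G] by simp

lemma corr_zero: "corr G 0 (\<lambda>v. 0)"
  using corr.scale[OF corr.one, of G 0] by simp

lemma corr_pow: "corr G x X \<Longrightarrow> corr G (x ^ n) (X ^^ n)"
proof (induction n)
  case 0
  have "(\<lambda>v. v) = X ^^ 0" by (simp add: fun_eq_iff)
  then show ?case using corr.one[of G] by simp
next
  case (Suc n)
  have "(\<lambda>v. X ((X ^^ n) v)) = X ^^ Suc n" by (simp add: fun_eq_iff)
  then show ?case using corr_mult[OF Suc.prems Suc.IH[OF Suc.prems]] by simp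
qed

lemma corr_sum: "(\<And>i. i \<in> I \<Longrightarrow> \<exists>X. corr G (x i) X) \<Longrightarrow> \<exists>X. corr G (\<Sum>i\<in>I. x i) X"
proof (induction I rule: infinite_finite_induct)
  case (insert i I)
  then obtain X Y where "corr G (x i) X" "corr G (\<Sum>i\<in>I. x i) Y" by blast
  then show ?case using insert by (auto intro: corr.add)
qed (auto intro: corr_zero)

lemma corr_poly_at: "(a, L) \<in> G \<Longrightarrow> \<exists>X. corr G (poly_at p a) X"
  unfolding poly_at_def by (intro corr_sum) (blast intro: corr.scale corr_pow corr_gen)

lemma clinear_ident: "clinear (\<lambda>v. v)"
  by (rule clinearI) simp_all

lemma corr_clinear:
  assumes "corr G x X" "\<And>g L. (g, L) \<in> G \<Longrightarrow> clinear L"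
  shows "clinear X"
  using assms(1)
proof (induction rule: corr.induct)
  case one
  show ?case by (rule clinearI) simp_all
next
  case (gmult g L x X)
  show ?case by (rule clinear_comp[OF assms(2)[OF gmult(1)] gmult(3)])
next
  case (add x X y Y)
  show ?case by (rule clinearI) (simp_all add: clinearD[OF add(3)] clinearD[OF add(4)] scaleC_add_right)
next
  case (scale x X c)
  show ?case by (rule clinearI) (simp_all add: clinearD[OF scale(2)] scaleC_add_right scaleC_scaleC mult.commute)
qed

lemma corr_commute:
  assumes "corr G x X" "clinear K" "\<And>g L v. (g, L) \<in> G \<Longrightarrow> K (L v) = L (K v)"
  shows "K (X v) = X (K v)"
  using assms(1)
proof (induction arbitrary: v rule: corr.induct)
  case (gmult g L x X)
  show ?case by (simp only: assms(3)[OF gmult(1)] gmult(3))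
qed (simp_all add: clinearD[OF assms(2)])

lemma corr_acts:
  assumes "corr {(a, L)} x X" "acts b L"
  shows "acts b X"
  using assms(1)
proof (induction rule: corr.induct)
  case one
  show ?case unfolding acts_def by (auto simp: clinear_ident)
next
  case (gmult g L' x X)
  have cl: "clinear L" "clinear X" using assms(2) gmult(3) unfolding acts_def by auto
  show ?case using gmult(1,3) assms(2) clinear_comp[OF cl] unfolding acts_def by auto
next
  case (add x X y Y)
  have cl: "clinear X" "clinear Y" using add(3,4) unfolding acts_def by auto
  have "clinear (\<lambda>v. X v + Y v)"
    by (rule clinearI) (simp_all add: clinearD[OF cl(1)] clinearD[OF cl(2)] scaleC_add_right)
  with add(3,4) show ?case unfolding acts_def by (auto intro: wspan_add simp: clinearD[OF clinear_conc_left])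
next
  case (scale x X c)
  have cl: "clinear X" using scale(2) unfolding acts_def by auto
  have "clinear (\<lambda>v. c *\<^sub>C X v)"
    by (rule clinearI) (simp_all add: clinearD[OF cl] scaleC_add_right scaleC_scaleC mult.commute)
  with scale(2) show ?case unfolding acts_def by (auto intro: wspan_scale simp: clinearD[OF clinear_conc_left])
qed

lemma corr_racts:
  assumes "corr {(a, L)} x X" "racts b L"
  shows "racts b X"
  using assms(1)
proof (induction rule: corr.induct)
  case one
  show ?case unfolding racts_def by (auto simp: clinear_ident)
next
  case (gmult g L' x X)
  have cl: "clinear L" "clinear X" using assms(2) gmult(3) unfolding racts_def by auto
  show ?case using gmult(1,3) assms(2) clinear_comp[OF cl] unfolding racts_def by auto
next
  case (add x X y Y)
  have cl: "clinear X" "clinear Y" using add(3,4) unfolding racts_def by auto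
  have "clinear (\<lambda>v. X v + Y v)"
    by (rule clinearI) (simp_all add: clinearD[OF cl(1)] clinearD[OF cl(2)] scaleC_add_right)
  with add(3,4) show ?case unfolding racts_def by (auto intro: wspan_add simp: clinearD[OF clinear_conc_right])
next
  case (scale x X c)
  have cl: "clinear X" using scale(2) unfolding racts_def by auto
  have "clinear (\<lambda>v. c *\<^sub>C X v)"
    by (rule clinearI) (simp_all add: clinearD[OF cl] scaleC_add_right scaleC_scaleC mult.commute)
  with scale(2) show ?case unfolding racts_def by (auto intro: wspan_scale simp: clinearD[OF clinear_conc_right])
qed

definition models :: "('a::cstar_algebra \<Rightarrow> complex) \<Rightarrow> ('a \<times> (('l list \<Rightarrow>\<^sub>0 complex) \<Rightarrow> ('l list \<Rightarrow>\<^sub>0 complex))) set \<Rightarrow> bool"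
  where "models \<phi> G \<longleftrightarrow> clinear \<phi> \<and> (\<forall>(g, L) \<in> G. clinear L) \<and>
    (\<forall>w. set w \<subseteq> G \<longrightarrow> \<phi> (prod_list (map fst w)) = vac (foldr (\<lambda>(g, L) v. L v) w (basis_vec [])))"

lemma models_corr:
  assumes "models \<phi> G" "corr G x X"
  shows "\<phi> x = vac (X (basis_vec []))"
proof -
  have fl: "clinear (foldr (\<lambda>(g, L) v. L v) w)" if "set w \<subseteq> G" for w
    using that
  proof (induction w)
    case Nil
    then show ?case by (simp add: id_def clinear_ident)
  next
    case (Cons a w)
    obtain g L where a: "a = (g, L)" by (cases a)
    then have "clinear L" using assms(1) Cons.prems unfolding models_def by auto
    from clinear_comp[OF this Cons.IH] Cons.prems show ?case by (simp add: a comp_def)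
  qed
  have ph: "clinear \<phi>" using assms(1) by (simp add: models_def)
  \<comment> \<open>The prefix \<open>w\<close> makes the induction go through: the product rule of
    \<open>corr\<close> moves its generator from the element to the end of the prefix.\<close>
  have "\<phi> (prod_list (map fst w) * x) = vac (foldr (\<lambda>(g, L) v. L v) w (X (basis_vec [])))" if "set w \<subseteq> G" for w
    using assms(2) that
  proof (induction arbitrary: w rule: corr.induct)
    case one
    then show ?case using assms(1) by (simp add: models_def)
  next
    case (gmult g L x X)
    then show ?case using gmult(3)[of "w @ [(g, L)]"] by (simp add: mult.assoc)
  next
    case (add x X y Y)
    then show ?case by (simp add: clinearD[OF ph] clinearD[OF fl[OF add(5)]] distrib_left lookup_add)
  next
    case (scale x X c)
    then show ?case
      by (simp add: clinearD[OF ph] clinearD[OF fl[OF scale(3)]] mult_scaleC_right scaleC_poly_mapping.rep_eq)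
  qed
  from this[of "[]"] show ?thesis by simp
qed

section \<open>Truncated alternating sums\<close>

text \<open>\<open>suf\<close> and \<open>pre\<close> both sum alternating products of length 1 to
  n; those of \<open>suf\<close> end in \<open>y\<close>, those of \<open>pre\<close> start with it.
  For numbers they agree and form a geometric series that gains the factor \<open>y * y'\<close>
  every two steps.\<close>

fun suf :: "'a::ring_1 \<Rightarrow> 'a \<Rightarrow> nat \<Rightarrow> 'a" where
  "suf y y' 0 = 0"
| "suf y y' (Suc n) = (1 + suf y' y n) * y"

fun pre :: "'a::ring_1 \<Rightarrow> 'a \<Rightarrow> nat \<Rightarrow> 'a" where
  "pre y y' 0 = 0"
| "pre y y' (Suc n) = y * (1 + pre y' y n)"

fun suf_op :: "('v::complex_vector \<Rightarrow> 'v) \<Rightarrow> ('v \<Rightarrow> 'v) \<Rightarrow> nat \<Rightarrow> 'v \<Rightarrow> 'v" where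
  "suf_op Y Y' 0 v = 0"
| "suf_op Y Y' (Suc n) v = Y v + suf_op Y' Y n (Y v)"

fun pre_op :: "('v::complex_vector \<Rightarrow> 'v) \<Rightarrow> ('v \<Rightarrow> 'v) \<Rightarrow> nat \<Rightarrow> 'v \<Rightarrow> 'v" where
  "pre_op Y Y' 0 v = 0"
| "pre_op Y Y' (Suc n) v = Y (v + pre_op Y' Y n v)"

text \<open>The counterpart of \<open>pre\<close> for vectors, with concatenation as the
  product.\<close>

fun vecs :: "('l list \<Rightarrow>\<^sub>0 complex) \<Rightarrow> ('l list \<Rightarrow>\<^sub>0 complex) \<Rightarrow> nat \<Rightarrow> ('l list \<Rightarrow>\<^sub>0 complex)" where
  "vecs g g' 0 = 0"
| "vecs g g' (Suc n) = conc g (basis_vec [] + vecs g' g n)"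

lemma corr_suf:
  assumes "corr G y Y" "corr G y' Y'"
  shows "corr G (suf y y' n) (suf_op Y Y' n)"
proof -
  have "corr G (suf y y' n) (suf_op Y Y' n) \<and> corr G (suf y' y n) (suf_op Y' Y n)"
  proof (induction n)
    case 0
    have "suf_op Y Y' 0 = (\<lambda>v. 0)" for Y Y' :: "'b \<Rightarrow> 'b" by (simp add: fun_eq_iff)
    then show ?case by (simp add: corr_zero)
  next
    case (Suc n)
    have "suf_op Y Y' (Suc n) = (\<lambda>v. Y v + suf_op Y' Y n (Y v))" for Y Y' :: "'b \<Rightarrow> 'b" by (simp add: fun_eq_iff)
    with corr_mult[OF corr.add[OF corr.one conjunct2[OF Suc]] assms(1)]
      corr_mult[OF corr.add[OF corr.one conjunct1[OF Suc]] assms(2)]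
    show ?case by simp
  qed
  then show ?thesis ..
qed

lemma corr_pre:
  assumes "corr G y Y" "corr G y' Y'"
  shows "corr G (pre y y' n) (pre_op Y Y' n)"
proof -
  have "corr G (pre y y' n) (pre_op Y Y' n) \<and> corr G (pre y' y n) (pre_op Y' Y n)"
  proof (induction n)
    case 0
    have "pre_op Y Y' 0 = (\<lambda>v. 0)" for Y Y' :: "'b \<Rightarrow> 'b" by (simp add: fun_eq_iff)
    then show ?case by (simp add: corr_zero)
  next
    case (Suc n)
    have "pre_op Y Y' (Suc n) = (\<lambda>v. Y (v + pre_op Y' Y n v))" for Y Y' :: "'b \<Rightarrow> 'b" by (simp add: fun_eq_iff)
    with corr_mult[OF assms(1) corr.add[OF corr.one conjunct2[OF Suc]]]
      corr_mult[OF assms(2) corr.add[OF corr.one conjunct1[OF Suc]]]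
    show ?case by simp
  qed
  then show ?thesis ..
qed

lemma heads_le_no_head: "h \<in> heads b \<Longrightarrow> h \<in> no_head (\<not> b)"
  by (erule wspan_mono[rotated]) auto

lemma heads_le_no_head': "h \<in> heads (\<not> b) \<Longrightarrow> h \<in> no_head b"
  by (erule wspan_mono[rotated]) auto

lemma vac_heads: "h \<in> heads b \<Longrightarrow> vac h = 0"
  by (erule wspan_zero[OF clinear_vac, rotated]) (simp add: vac_basis)

lemma Nil_in_no_head: "basis_vec [] \<in> no_head b"
  by (rule wspan_basis) simp_all

lemma conc_heads:
  assumes "g \<in> short b" "vac g = 0" "h \<in> no_head b"
  shows "conc g h \<in> heads b"
  using conc_decomp[OF assms(1,3)] by (simp add: assms(2))

lemma vecs_heads:
  assumes "g \<in> short b" "vac g = 0" "g' \<in> short (\<not> b)" "vac g' = 0"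
  shows "vecs g g' n \<in> heads b" "vecs g' g n \<in> heads (\<not> b)"
proof -
  have "vecs g g' n \<in> heads b \<and> vecs g' g n \<in> heads (\<not> b)"
  proof (induction n)
    case (Suc n)
    then show ?case
      using conc_heads[OF assms(1,2) wspan_add[OF Nil_in_no_head heads_le_no_head']]
        conc_heads[OF assms(3,4) wspan_add[OF Nil_in_no_head heads_le_no_head]]
      by simp
  qed (simp add: wspan_0)
  then show "vecs g g' n \<in> heads b" "vecs g' g n \<in> heads (\<not> b)" by auto
qed

lemma clinear_suf_op:
  assumes "clinear Y" "clinear Y'"
  shows "clinear (suf_op Y Y' n)"
proof -
  have "clinear (suf_op Y Y' n) \<and> clinear (suf_op Y' Y n)"
  proof (induction n)
    case 0
    have "clinear (\<lambda>v :: 'a. 0 :: 'a)" by (rule clinearI) simp_all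
    then show ?case by simp
  next
    case (Suc n)
    then have 1: "clinear (suf_op Y Y' n)" "clinear (suf_op Y' Y n)" by auto
    show ?case
      by (auto intro!: clinearI simp: clinearD[OF 1(1)] clinearD[OF 1(2)] clinearD[OF assms(1)] clinearD[OF assms(2)]
        scaleC_add_right)
  qed
  then show ?thesis ..
qed

text \<open>Each centred factor meets words whose head is not on its own side and therefore only
  puts a letter in front; the vacuum is never reached again.\<close>

lemma suf_op_vac:
  assumes "acts b Y" "vac (Y (basis_vec [])) = 0" "acts (\<not> b) Y'" "vac (Y' (basis_vec [])) = 0"
  shows "h \<in> no_head b \<Longrightarrow> vac (suf_op Y Y' n h) = 0"
    and "h \<in> no_head (\<not> b) \<Longrightarrow> vac (suf_op Y' Y n h) = 0"
proof -
  have "(\<forall>h \<in> no_head b. vac (suf_op Y Y' n h) = 0) \<and> (\<forall>h \<in> no_head (\<not> b). vac (suf_op Y' Y n h) = 0)"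
  proof (induction n)
    case (Suc n)
    have "vac (suf_op Y Y' (Suc n) h) = 0" if "h \<in> no_head b" for h
    proof -
      have k: "Y h \<in> heads b" by (rule acts_no_head[OF assms(1,2) that])
      have "vac (suf_op Y' Y n (Y h)) = 0" using Suc heads_le_no_head[OF k] by blast
      with vac_heads[OF k] show ?thesis by (simp only: suf_op.simps lookup_add add_0)
    qed
    moreover have "vac (suf_op Y' Y (Suc n) h) = 0" if "h \<in> no_head (\<not> b)" for h
    proof -
      have k: "Y' h \<in> heads (\<not> b)" by (rule acts_no_head[OF assms(3,4) that])
      have "vac (suf_op Y Y' n (Y' h)) = 0" using Suc heads_le_no_head'[OF k] by blast
      with vac_heads[OF k] show ?thesis by (simp only: suf_op.simps lookup_add add_0)
    qed
    ultimately show ?case by blast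
  qed simp
  then show "h \<in> no_head b \<Longrightarrow> vac (suf_op Y Y' n h) = 0"
    and "h \<in> no_head (\<not> b) \<Longrightarrow> vac (suf_op Y' Y n h) = 0" by auto
qed

text \<open>The rightmost factor meets the leftmost letter. It either removes this letter with
  coefficient \<open>vac (Y g)\<close>, or leaves a head that the following factors can only bury.
  So words pair letter by letter, and only those of equal length and shape contribute.\<close>

lemma suf_op_pairing:
  assumes "acts b Y" "vac (Y (basis_vec [])) = 0" "acts (\<not> b) Y'" "vac (Y' (basis_vec [])) = 0"
    and g: "g \<in> short b" "vac g = 0" "g' \<in> short (\<not> b)" "vac g' = 0"
  shows "vac (suf_op Y Y' n (vecs g g' n)) = pre (vac (Y g)) (vac (Y' g')) n"
    and "vac (suf_op Y' Y n (vecs g' g n)) = pre (vac (Y' g')) (vac (Y g)) n"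
proof -
  have cl: "clinear Y" "clinear Y'" using assms(1,3) by (auto simp: acts_def)
  note lin = clinearD[OF clinear_vac] clinearD[OF clinear_suf_op[OF cl]]
    clinearD[OF clinear_suf_op[OF cl(2,1)]]
  \<comment> \<open>One factor against one letter: the vacuum part of \<open>Y g\<close> passes
    \<open>h\<close> on, and the remainder \<open>k\<close> starts on side \<open>b\<close>, where
    the remaining alternating operators have no vacuum coefficient.\<close>
  have key: "vac (suf_op Y Y' (Suc n) (conc g h)) = vac (Y g) * (vac h + vac (suf_op Y' Y n h))"
    if h: "h \<in> no_head b" for h n
  proof -
    have Yg: "Y g \<in> short b" "Y (conc g h) = conc (Y g) h" using assms(1) g h by (auto simp: acts_def)
    define k where "k = conc (Y g) h - vac (Y g) *\<^sub>C h"
    have k: "k \<in> heads b" unfolding k_def by (rule conc_decomp[OF Yg(1) h])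
    have "conc (Y g) h = vac (Y g) *\<^sub>C h + k" by (simp add: k_def)
    then show ?thesis
      using vac_heads[OF k] suf_op_vac(2)[OF assms(1-4) heads_le_no_head[OF k]] Yg
      by (simp add: lin scaleC_complex_def algebra_simps)
  qed
  have key': "vac (suf_op Y' Y (Suc n) (conc g' h)) = vac (Y' g') * (vac h + vac (suf_op Y Y' n h))"
    if h: "h \<in> no_head (\<not> b)" for h n
  proof -
    have Yg: "Y' g' \<in> short (\<not> b)" "Y' (conc g' h) = conc (Y' g') h" using assms(3) g h by (auto simp: acts_def)
    define k where "k = conc (Y' g') h - vac (Y' g') *\<^sub>C h"
    have k: "k \<in> heads (\<not> b)" unfolding k_def by (rule conc_decomp[OF Yg(1) h])
    have "conc (Y' g') h = vac (Y' g') *\<^sub>C h + k" by (simp add: k_def)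
    then show ?thesis
      using vac_heads[OF k] suf_op_vac(1)[OF assms(1-4) heads_le_no_head'[OF k]] Yg
      by (simp add: lin scaleC_complex_def algebra_simps)
  qed
  have "vac (suf_op Y Y' n (vecs g g' n)) = pre (vac (Y g)) (vac (Y' g')) n \<and>
    vac (suf_op Y' Y n (vecs g' g n)) = pre (vac (Y' g')) (vac (Y g)) n"
  proof (induction n)
    case (Suc n)
    have h: "basis_vec [] + vecs g' g n \<in> no_head b" "basis_vec [] + vecs g g' n \<in> no_head (\<not> b)"
      by (rule wspan_add[OF Nil_in_no_head heads_le_no_head'[OF vecs_heads(2)[OF g]]],
          rule wspan_add[OF Nil_in_no_head heads_le_no_head[OF vecs_heads(1)[OF g]]])
    have v: "vac (vecs g g' n) = 0" "vac (vecs g' g n) = 0"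
      using vecs_heads[OF g] vac_heads by auto
    show ?case
      unfolding vecs.simps key[OF h(1)] key'[OF h(2)] pre.simps
      using Suc v suf_op_vac[OF assms(1-4) Nil_in_no_head]
      by (simp add: lin vac_basis)
  qed simp
  then show "vac (suf_op Y Y' n (vecs g g' n)) = pre (vac (Y g)) (vac (Y' g')) n"
    and "vac (suf_op Y' Y n (vecs g' g n)) = pre (vac (Y' g')) (vac (Y g)) n" by auto
qed

text \<open>The cross terms vanish: a sum whose first acting factor is on the side opposite to the
  leading letter only creates letters.\<close>

lemma suf_op_pairing_total:
  fixes n :: nat
  assumes "acts b Y" "vac (Y (basis_vec [])) = 0" "acts (\<not> b) Y'" "vac (Y' (basis_vec [])) = 0"
    and g: "g \<in> short b" "vac g = 0" "g' \<in> short (\<not> b)" "vac g' = 0"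
  defines "h \<equiv> basis_vec [] + vecs g g' n + vecs g' g n"
  shows "vac (h + suf_op Y Y' n h + suf_op Y' Y n h) =
    1 + pre (vac (Y g)) (vac (Y' g')) n + pre (vac (Y' g')) (vac (Y g)) n"
proof -
  have cl: "clinear Y" "clinear Y'" using assms(1,3) by (auto simp: acts_def)
  note lin = clinearD[OF clinear_vac] clinearD[OF clinear_suf_op[OF cl]]
    clinearD[OF clinear_suf_op[OF cl(2,1)]]
  note H = vecs_heads[OF g, of n]
  show ?thesis unfolding h_def
    using suf_op_pairing[OF assms(1-8), of n] suf_op_vac[OF assms(1-4) Nil_in_no_head, of n]
      suf_op_vac(1)[OF assms(1-4) heads_le_no_head'[OF H(2)], of n]
      suf_op_vac(2)[OF assms(1-4) heads_le_no_head[OF H(1)], of n] vac_heads[OF H(1)] vac_heads[OF H(2)]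
    by (simp add: lin vac_basis)
qed

text \<open>Left operators prepend, so a product and the word it creates from the vacuum are read in
  the same order.\<close>

lemma pre_op_vecs:
  assumes "acts b Y" "vac (Y (basis_vec [])) = 0" "acts (\<not> b) Y'" "vac (Y' (basis_vec [])) = 0"
  shows "pre_op Y Y' n (basis_vec []) = vecs (Y (basis_vec [])) (Y' (basis_vec [])) n"
    and "pre_op Y' Y n (basis_vec []) = vecs (Y' (basis_vec [])) (Y (basis_vec [])) n"
proof -
  have s: "Y (basis_vec []) \<in> short b" "Y' (basis_vec []) \<in> short (\<not> b)"
    using assms(1,3) Nil_in_short[of b] Nil_in_short[of "\<not> b"] unfolding acts_def by blast+
  note H = vecs_heads[OF s(1) assms(2) s(2) assms(4)]
  have "pre_op Y Y' n (basis_vec []) = vecs (Y (basis_vec [])) (Y' (basis_vec [])) n \<and>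
    pre_op Y' Y n (basis_vec []) = vecs (Y' (basis_vec [])) (Y (basis_vec [])) n"
  proof (induction n)
    case (Suc n)
    have "Y (conc (basis_vec []) h) = conc (Y (basis_vec [])) h" if "h \<in> no_head b" for h
      using assms(1) that Nil_in_short[of b] unfolding acts_def by blast
    from this[OF wspan_add[OF Nil_in_no_head heads_le_no_head'[OF H(2)]]]
    have 1: "Y (basis_vec [] + vecs (Y' (basis_vec [])) (Y (basis_vec [])) n) =
        conc (Y (basis_vec [])) (basis_vec [] + vecs (Y' (basis_vec [])) (Y (basis_vec [])) n)" for n
      by (simp only: conc_Nil_left)
    have "Y' (conc (basis_vec []) h) = conc (Y' (basis_vec [])) h" if "h \<in> no_head (\<not> b)" for h
      using assms(3) that Nil_in_short[of "\<not> b"] unfolding acts_def by blast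
    from this[OF wspan_add[OF Nil_in_no_head heads_le_no_head[OF H(1)]]]
    have 2: "Y' (basis_vec [] + vecs (Y (basis_vec [])) (Y' (basis_vec [])) n) =
        conc (Y' (basis_vec [])) (basis_vec [] + vecs (Y (basis_vec [])) (Y' (basis_vec [])) n)" for n
      by (simp only: conc_Nil_left)
    show ?case
      using Suc 1[of n] 2[of n] by (simp only: pre_op.simps vecs.simps simp_thms)
  qed simp
  then show "pre_op Y Y' n (basis_vec []) = vecs (Y (basis_vec [])) (Y' (basis_vec [])) n"
    and "pre_op Y' Y n (basis_vec []) = vecs (Y' (basis_vec [])) (Y (basis_vec [])) n" by auto
qed

lemma short_one_letter:
  assumes "g \<in> short b" "vac g = 0"
  shows "g \<in> one_letter b"
proof -
  have "g - vac g *\<^sub>C basis_vec [] \<in> one_letter b"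
  proof (rule wspan_map[OF _ _ assms(1), of "\<lambda>g. g - vac g *\<^sub>C basis_vec []"])
    show "clinear (\<lambda>g :: ('a + 'b) list \<Rightarrow>\<^sub>0 complex. g - vac g *\<^sub>C basis_vec [])"
      by (rule clinearI) (simp_all add: clinearD[OF clinear_vac] scaleC_add_left cvec.scale_right_diff_distrib
          scaleC_scaleC scaleC_complex_def)
  qed (auto simp: vac_basis wspan_0 scaleC_one intro!: wspan_basis)
  then show ?thesis by (simp add: assms(2))
qed

text \<open>Right operators append, so the factor that acts first supplies the first letter:
  products ending in \<open>U\<close> create the words that start with the letter of
  \<open>U\<close>. This is why \<open>suf\<close> stands on both sides of the bi-free
  pairing.\<close>

lemma suf_op_racts:
  fixes U :: "(('x + 'y) list \<Rightarrow>\<^sub>0 complex) \<Rightarrow> (('x + 'y) list \<Rightarrow>\<^sub>0 complex)"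
  assumes "racts b U" "vac (U (basis_vec [])) = 0" "racts (\<not> b) U'" "vac (U' (basis_vec [])) = 0"
  shows "suf_op U U' n (basis_vec []) = vecs (U (basis_vec [])) (U' (basis_vec [])) n"
    and "suf_op U' U n (basis_vec []) = vecs (U' (basis_vec [])) (U (basis_vec [])) n"
proof -
  define g where "g = U (basis_vec [])"
  define g' where "g' = U' (basis_vec [])"
  have cl: "clinear U" "clinear U'" using assms(1,3) by (auto simp: racts_def)
  have "g \<in> short b" "g' \<in> short (\<not> b)"
    using assms(1,3) Nil_in_short[of b] Nil_in_short[of "\<not> b"] unfolding racts_def g_def g'_def by blast+
  then have g: "g \<in> one_letter b" "g' \<in> one_letter (\<not> b)"
    using short_one_letter assms(2,4) unfolding g_def g'_def by auto
  have U: "U (basis_vec v) = conc (basis_vec v) g" if "alternating v" "v = [] \<or> isl (last v) = (\<not> b)" for v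
  proof -
    have "U (conc (basis_vec v) (basis_vec [])) = conc (basis_vec v) (U (basis_vec []))"
      using assms(1) that Nil_in_short[of b] unfolding racts_def by blast
    then show ?thesis by (simp only: conc_Nil_right g_def)
  qed
  have U': "U' (basis_vec v) = conc (basis_vec v) g'" if "alternating v" "v = [] \<or> isl (last v) = b" for v
  proof -
    have "v = [] \<or> isl (last v) = (\<not> \<not> b)" using that(2) by simp
    then have "U' (conc (basis_vec v) (basis_vec [])) = conc (basis_vec v) (U' (basis_vec []))"
      using assms(3) that(1) Nil_in_short[of "\<not> b"] unfolding racts_def by blast
    then show ?thesis by (simp only: conc_Nil_right g'_def)
  qed
  \<comment> \<open>An arbitrary untouched prefix \<open>v\<close> is needed, since each application
    moves one more letter into it.\<close>
  have "(\<forall>v. alternating v \<longrightarrow> v = [] \<or> isl (last v) = (\<not> b) \<longrightarrow> suf_op U U' n (basis_vec v) = conc (basis_vec v) (vecs g g' n)) \<and>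
    (\<forall>v. alternating v \<longrightarrow> v = [] \<or> isl (last v) = b \<longrightarrow> suf_op U' U n (basis_vec v) = conc (basis_vec v) (vecs g' g n))"
  proof (induction n)
    case 0
    show ?case by (simp add: clinearD[OF clinear_conc_right])
  next
    case (Suc n)
    have 1: "suf_op U U' (Suc n) (basis_vec v) = conc (basis_vec v) (vecs g g' (Suc n))"
      if v: "alternating v" "v = [] \<or> isl (last v) = (\<not> b)" for v
    proof -
      have "conc (basis_vec v) p + suf_op U' U n (conc (basis_vec v) p) = conc (conc (basis_vec v) p) (basis_vec [] + vecs g' g n)"
        if "p \<in> one_letter b" for p
      proof (rule wspan_eq[OF _ _ _ that])
        show "clinear (\<lambda>p. conc (basis_vec v) p + suf_op U' U n (conc (basis_vec v) p))"
          by (rule clinearI) (simp_all add: clinearD[OF clinear_conc_right] clinearD[OF clinear_suf_op[OF cl(2,1)]] scaleC_add_right)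
        show "clinear (\<lambda>p. conc (conc (basis_vec v) p) (basis_vec [] + vecs g' g n))"
          by (rule clinear_comp[OF clinear_conc_left clinear_conc_right])
        fix w :: "('x + 'y) list" assume "\<exists>l. w = [l] \<and> isl l = b"
        then obtain l where w: "w = [l]" "isl l = b" by auto
        then have "alternating (v @ [l])" using v by (auto simp: alternating_snoc)
        then show "conc (basis_vec v) (basis_vec w) + suf_op U' U n (conc (basis_vec v) (basis_vec w)) =
            conc (conc (basis_vec v) (basis_vec w)) (basis_vec [] + vecs g' g n)"
          using Suc w by (simp add: clinearD[OF clinear_conc_right])
      qed
      from this[OF g(1)] show ?thesis by (simp add: U[OF v] conc_assoc_basis)
    qed
    have 2: "suf_op U' U (Suc n) (basis_vec v) = conc (basis_vec v) (vecs g' g (Suc n))"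
      if v: "alternating v" "v = [] \<or> isl (last v) = b" for v
    proof -
      have "conc (basis_vec v) p + suf_op U U' n (conc (basis_vec v) p) = conc (conc (basis_vec v) p) (basis_vec [] + vecs g g' n)"
        if "p \<in> one_letter (\<not> b)" for p
      proof (rule wspan_eq[OF _ _ _ that])
        show "clinear (\<lambda>p. conc (basis_vec v) p + suf_op U U' n (conc (basis_vec v) p))"
          by (rule clinearI) (simp_all add: clinearD[OF clinear_conc_right] clinearD[OF clinear_suf_op[OF cl]] scaleC_add_right)
        show "clinear (\<lambda>p. conc (conc (basis_vec v) p) (basis_vec [] + vecs g g' n))"
          by (rule clinear_comp[OF clinear_conc_left clinear_conc_right])
        fix w :: "('x + 'y) list" assume "\<exists>l. w = [l] \<and> isl l = (\<not> b)"
        then obtain l where w: "w = [l]" "isl l = (\<not> b)" by auto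
        then have "alternating (v @ [l])" using v by (auto simp: alternating_snoc)
        then show "conc (basis_vec v) (basis_vec w) + suf_op U U' n (conc (basis_vec v) (basis_vec w)) =
            conc (conc (basis_vec v) (basis_vec w)) (basis_vec [] + vecs g g' n)"
          using Suc w by (simp add: clinearD[OF clinear_conc_right])
      qed
      from this[OF g(2)] show ?thesis by (simp add: U'[OF v] conc_assoc_basis)
    qed
    from 1 2 show ?case by blast
  qed
  then have "suf_op U U' n (basis_vec []) = conc (basis_vec []) (vecs g g' n)"
    "suf_op U' U n (basis_vec []) = conc (basis_vec []) (vecs g' g n)"
    using alternating_Nil by blast+
  then show "suf_op U U' n (basis_vec []) = vecs (U (basis_vec [])) (U' (basis_vec [])) n"
    and "suf_op U' U n (basis_vec []) = vecs (U' (basis_vec [])) (U (basis_vec [])) n"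
    by (simp_all only: conc_Nil_left g_def g'_def)
qed

section \<open>Moment identities of free and bi-free pairs\<close>

inductive_set gen_alg :: "'a::cstar_algebra set \<Rightarrow> 'a set" for A where
  one: "1 \<in> gen_alg A"
| gmult: "g \<in> A \<Longrightarrow> x \<in> gen_alg A \<Longrightarrow> g * x \<in> gen_alg A"
| add: "x \<in> gen_alg A \<Longrightarrow> y \<in> gen_alg A \<Longrightarrow> x + y \<in> gen_alg A"
| scale: "x \<in> gen_alg A \<Longrightarrow> c *\<^sub>C x \<in> gen_alg A"

lemma gen_alg_corr: "x \<in> gen_alg (fst ` G) \<Longrightarrow> \<exists>X. corr G x X"
proof (induction rule: gen_alg.induct)
  case (gmult g x)
  then show ?case by (force intro: corr.gmult)
qed (blast intro: corr.intros)+

lemma gen_alg_mult: "x \<in> gen_alg A \<Longrightarrow> y \<in> gen_alg A \<Longrightarrow> x * y \<in> gen_alg A"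
  by (induction rule: gen_alg.induct)
    (auto simp: mult.assoc distrib_right mult_scaleC_left intro: gen_alg.intros)

lemma gen_alg_gen: "g \<in> A \<Longrightarrow> g \<in> gen_alg A"
  using gen_alg.gmult[OF _ gen_alg.one] by fastforce

text \<open>The properties of a free pair that the analytic part needs. The identity \<open>coalgebra\<close> says
  that the derivation which vanishes on \<open>a\<^sub>1\<close> and sends \<open>a\<^sub>2\<close> to \<open>a\<^sub>2 \<otimes> 1 - 1 \<otimes> a\<^sub>2\<close> is killed by
  \<open>\<phi> \<otimes> \<phi>\<close>.\<close>

locale free_pair =
  fixes \<phi> :: "'a::cstar_algebra \<Rightarrow> complex" and a\<^sub>1 a\<^sub>2 :: 'a
  assumes trace: "x \<in> gen_alg {a\<^sub>1, a\<^sub>2} \<Longrightarrow> y \<in> gen_alg {a\<^sub>1, a\<^sub>2} \<Longrightarrow> \<phi> (x * y) = \<phi> (y * x)"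
    and coalgebra1: "s = \<alpha> *\<^sub>C (a\<^sub>1 + a\<^sub>2) + \<beta> *\<^sub>C 1 \<Longrightarrow> \<alpha> \<noteq> 0 \<Longrightarrow>
      (\<Sum>i<n. \<phi> (poly_at p a\<^sub>1 * s ^ i * a\<^sub>2) * \<phi> (s ^ (n - 1 - i))) =
      (\<Sum>i<n. \<phi> (poly_at p a\<^sub>1 * s ^ i) * \<phi> (a\<^sub>2 * s ^ (n - 1 - i)))"
    and coalgebra2: "s = \<alpha> *\<^sub>C (a\<^sub>2 + a\<^sub>1) + \<beta> *\<^sub>C 1 \<Longrightarrow> \<alpha> \<noteq> 0 \<Longrightarrow>
      (\<Sum>i<n. \<phi> (poly_at p a\<^sub>2 * s ^ i * a\<^sub>1) * \<phi> (s ^ (n - 1 - i))) =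
      (\<Sum>i<n. \<phi> (poly_at p a\<^sub>2 * s ^ i) * \<phi> (a\<^sub>1 * s ^ (n - 1 - i)))"
    and pairing: "y\<^sub>1 = poly_at p\<^sub>1 a\<^sub>1 \<Longrightarrow> y\<^sub>2 = poly_at p\<^sub>2 a\<^sub>2 \<Longrightarrow> \<phi> y\<^sub>1 = 0 \<Longrightarrow> \<phi> y\<^sub>2 = 0 \<Longrightarrow>
      \<phi> ((1 + suf y\<^sub>1 y\<^sub>2 n + suf y\<^sub>2 y\<^sub>1 n) * (1 + pre y\<^sub>1 y\<^sub>2 n + pre y\<^sub>2 y\<^sub>1 n)) =
      1 + pre (\<phi> (y\<^sub>1 * y\<^sub>1)) (\<phi> (y\<^sub>2 * y\<^sub>2)) n + pre (\<phi> (y\<^sub>2 * y\<^sub>2)) (\<phi> (y\<^sub>1 * y\<^sub>1)) n"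
    and free: "free_elements \<phi> a\<^sub>1 a\<^sub>2"

text \<open>A single face, modelled by left operators. The right operators that occur below serve as
  a commutant and model no element.\<close>

locale model =
  l1: letter \<iota> b + l2: letter \<kappa> "\<not> b"
  for \<iota> :: "'z::complex_vector \<Rightarrow> 'x::complex_vector + 'y::complex_vector"
    and \<kappa> :: "'u::complex_vector \<Rightarrow> 'x + 'y" and b +
  fixes \<phi> :: "'a::cstar_algebra \<Rightarrow> complex" and a\<^sub>1 a\<^sub>2 :: 'a and T S
  assumes models: "models \<phi> {(a\<^sub>1, lop \<iota> T), (a\<^sub>2, lop \<kappa> S)}"
begin

abbreviation "G \<equiv> {(a\<^sub>1, lop \<iota> T), (a\<^sub>2, lop \<kappa> S)}"
abbreviation "\<Omega> \<equiv> basis_vec ([] :: ('x + 'y) list)"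

lemma clinear_corr: "corr G x X \<Longrightarrow> clinear X"
  by (erule corr_clinear) (auto intro: clinear_lop)

lemmas moment = models_corr[OF models]

lemma corr1: "corr {(a\<^sub>1, lop \<iota> T)} x X \<Longrightarrow> corr G x X"
  by (erule corr_mono) simp

lemma corr2: "corr {(a\<^sub>2, lop \<kappa> S)} x X \<Longrightarrow> corr G x X"
  by (erule corr_mono) simp

text \<open>The right operator built from \<open>T\<close> commutes with all left operators, agrees
  with \<open>lop \<iota> T\<close> on the vacuum, and has the same vacuum coefficient. Moving it
  from the right end of \<open>X\<close> to the left end is the trace property.\<close>

lemma trace1:
  assumes "corr G x X"
  shows "\<phi> (x * a\<^sub>1) = \<phi> (a\<^sub>1 * x)"
proof -
  have a: "corr G a\<^sub>1 (lop \<iota> T)" by (rule corr_gen) simp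
  have c: "rop \<iota> T (X v) = X (rop \<iota> T v)" for v
  proof (rule corr_commute[OF assms clinear_rop])
    fix g L and v assume "(g, L) \<in> G"
    then have "L = lop \<iota> T \<or> L = lop \<kappa> S" by auto
    then show "rop \<iota> T (L v) = L (rop \<iota> T v)"
      by (elim disjE) (simp_all only: rop_lop_commute_same[OF l1.letter_axioms]
        rop_lop_commute_other[OF l1.letter_axioms l2.letter_axioms])
  qed
  have "\<phi> (x * a\<^sub>1) = vac (X (lop \<iota> T \<Omega>))" by (rule moment[OF corr_mult[OF assms a]])
  also have "\<dots> = vac (rop \<iota> T (X \<Omega>))"
    by (simp only: c l1.rop_eq_lop_short[OF Nil_in_short])
  also have "\<dots> = \<phi> (a\<^sub>1 * x)"
    by (simp only: l1.vac_rop moment[OF corr_mult[OF a assms]])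
  finally show ?thesis .
qed

lemma acts1: "corr {(a\<^sub>1, lop \<iota> T)} x X \<Longrightarrow> acts b X"
  by (erule corr_acts) (rule l1.acts_lop)

lemma acts2: "corr {(a\<^sub>2, lop \<kappa> S)} x X \<Longrightarrow> acts (\<not> b) X"
  by (erule corr_acts) (rule l2.acts_lop)

text \<open>The commutator of \<open>U\<close> with the projection \<open>?N\<close> is summed along
  the power of \<open>U\<close>. The sum telescopes to 0 because \<open>?N\<close> kills the vacuum
  and, after commuting past \<open>X\<close>, has no vacuum component in its range. Taking
  \<open>s\<close> affine in the sum allows its powers to be added up to a resolvent later.\<close>

lemma coalgebra:
  assumes s: "s = \<alpha> *\<^sub>C (a\<^sub>1 + a\<^sub>2) + \<beta> *\<^sub>C 1" and "\<alpha> \<noteq> 0"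
  shows "(\<Sum>i<n. \<phi> (poly_at p a\<^sub>1 * s ^ i * a\<^sub>2) * \<phi> (s ^ (n - 1 - i))) =
      (\<Sum>i<n. \<phi> (poly_at p a\<^sub>1 * s ^ i) * \<phi> (a\<^sub>2 * s ^ (n - 1 - i)))"
proof -
  let ?L1 = "lop \<iota> T" and ?L2 = "lop \<kappa> S" and ?x = "poly_at p a\<^sub>1"
  obtain X where X1: "corr {(a\<^sub>1, ?L1)} ?x X" using corr_poly_at[OF singletonI] by blast
  note X = corr1[OF X1]
  define U where "U = (\<lambda>v. \<alpha> *\<^sub>C (?L1 v + ?L2 v) + \<beta> *\<^sub>C v)"
  have a: "corr G a\<^sub>1 ?L1" "corr G a\<^sub>2 ?L2" by (rule corr_gen, simp)+
  have "corr G s U"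
    unfolding s U_def by (rule corr.add[OF corr.scale[OF corr.add[OF a]] corr.scale[OF corr.one]])
  note U = corr_pow[OF this]
  let ?N = "lasts (\<not> b)"
  note lin = clinearD[OF clinear_lop] clinearD[OF clinear_lasts] clinearD[OF clinear_vac] clinearD[OF clinear_corr[OF X]]
  have 1: "?L1 (?N v) = ?N (?L1 v)" for v by (rule l1.lop_lasts)
  \<comment> \<open>The identity is the sum of the vacuum projection and the two projections by last
    letter. Since \<open>?L2\<close> commutes with the one for side \<open>b\<close>, its commutator
    with \<open>?N\<close> is, up to sign, that with the rank-one vacuum projection.\<close>
  have 2: "?L2 (?N v) - ?N (?L2 v) = vac (?L2 v) *\<^sub>C \<Omega> - vac v *\<^sub>C ?L2 \<Omega>" for v
  proof -
    have N: "?N v = v - vac v *\<^sub>C \<Omega> - lasts b v" for v using lasts_decomp[of v b] by (simp add: algebra_simps)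
    have "?L2 (lasts b v) = lasts b (?L2 v)" using l2.lop_lasts[of S v] by simp
    then show ?thesis unfolding N by (simp add: lin)
  qed
  have 3: "U (?N v) - ?N (U v) = \<alpha> *\<^sub>C (vac (?L2 v) *\<^sub>C \<Omega> - vac v *\<^sub>C ?L2 \<Omega>)" for v
    unfolding 2[symmetric] by (simp add: U_def lin 1 cvec.scale_right_diff_distrib scaleC_add_right)
  have XN: "?N (X v) = X (?N v)" for v
    by (rule corr_commute[OF X1 clinear_lasts]) (auto simp: 1)
  \<comment> \<open>The projection is inserted between \<open>i\<close> and \<open>n - i\<close>
    factors; neighbouring values differ by one commutator.\<close>
  define q where "q i = vac (X ((U ^^ i) (?N ((U ^^ (n - i)) \<Omega>))))" for i
  have step: "q (Suc i) - q i = \<alpha> * (\<phi> (?x * s ^ i) * \<phi> (a\<^sub>2 * s ^ (n - 1 - i)) -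
      \<phi> (?x * s ^ i * a\<^sub>2) * \<phi> (s ^ (n - 1 - i)))" if "i < n" for i
  proof -
    define v where "v = (U ^^ (n - 1 - i)) \<Omega>"
    have ni: "n - i = Suc (n - 1 - i)" "n - Suc i = n - 1 - i" using that by auto
    note linU = clinearD[OF clinear_corr[OF U[of i]]]
    have "q (Suc i) - q i = vac (X ((U ^^ i) (U (?N v) - ?N (U v))))"
      unfolding q_def ni v_def by (simp add: lin linU funpow_swap1)
    also have "\<dots> = \<alpha> * (vac (?L2 v) * vac (X ((U ^^ i) \<Omega>)) - vac v * vac (X ((U ^^ i) (?L2 \<Omega>))))"
      unfolding 3 by (simp add: lin linU scaleC_complex_def)
    also have "vac v = \<phi> (s ^ (n - 1 - i))" unfolding v_def by (rule moment[OF U, symmetric])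
    also have "vac (?L2 v) = \<phi> (a\<^sub>2 * s ^ (n - 1 - i))"
      unfolding v_def by (rule moment[OF corr_mult[OF a(2) U], symmetric])
    also have "vac (X ((U ^^ i) \<Omega>)) = \<phi> (?x * s ^ i)" by (rule moment[OF corr_mult[OF X U], symmetric])
    also have "vac (X ((U ^^ i) (?L2 \<Omega>))) = \<phi> (?x * s ^ i * a\<^sub>2)"
      by (rule moment[OF corr_mult[OF corr_mult[OF X U] a(2)], symmetric])
    finally show ?thesis by (simp add: mult.commute)
  qed
  have "q n - q 0 = (\<Sum>i<n. q (Suc i) - q i)" by (simp add: sum_lessThan_telescope)
  also have "\<dots> = (\<Sum>i<n. \<alpha> * (\<phi> (?x * s ^ i) * \<phi> (a\<^sub>2 * s ^ (n - 1 - i)) -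
      \<phi> (?x * s ^ i * a\<^sub>2) * \<phi> (s ^ (n - 1 - i))))"
    by (rule sum.cong) (simp_all add: step)
  also have "\<dots> = \<alpha> * ((\<Sum>i<n. \<phi> (?x * s ^ i) * \<phi> (a\<^sub>2 * s ^ (n - 1 - i))) -
      (\<Sum>i<n. \<phi> (?x * s ^ i * a\<^sub>2) * \<phi> (s ^ (n - 1 - i))))"
    by (simp add: sum_distrib_left sum_subtractf right_diff_distrib)
  finally have "\<alpha> * ((\<Sum>i<n. \<phi> (?x * s ^ i) * \<phi> (a\<^sub>2 * s ^ (n - 1 - i))) -
      (\<Sum>i<n. \<phi> (?x * s ^ i * a\<^sub>2) * \<phi> (s ^ (n - 1 - i)))) = q n - q 0" ..
  moreover have "q n = 0"
    using clinearD(3)[OF clinear_corr[OF U[of n]]] by (simp add: q_def lasts_basis lin)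
  moreover have "q 0 = 0" by (simp add: q_def vac_lasts flip: XN)
  ultimately show ?thesis using \<open>\<alpha> \<noteq> 0\<close> by simp
qed

text \<open>Both factors consist of left operators: the right one creates words from the vacuum,
  hence \<open>pre\<close>, and the left one takes them apart from the head on, hence
  \<open>suf\<close>.\<close>

lemma pairing:
  assumes y: "y\<^sub>1 = poly_at p\<^sub>1 a\<^sub>1" "y\<^sub>2 = poly_at p\<^sub>2 a\<^sub>2" "\<phi> y\<^sub>1 = 0" "\<phi> y\<^sub>2 = 0"
  shows "\<phi> ((1 + suf y\<^sub>1 y\<^sub>2 n + suf y\<^sub>2 y\<^sub>1 n) * (1 + pre y\<^sub>1 y\<^sub>2 n + pre y\<^sub>2 y\<^sub>1 n)) =
      1 + pre (\<phi> (y\<^sub>1 * y\<^sub>1)) (\<phi> (y\<^sub>2 * y\<^sub>2)) n + pre (\<phi> (y\<^sub>2 * y\<^sub>2)) (\<phi> (y\<^sub>1 * y\<^sub>1)) n"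
proof -
  obtain Y\<^sub>1 where Y1: "corr {(a\<^sub>1, lop \<iota> T)} y\<^sub>1 Y\<^sub>1"
    using corr_poly_at[OF singletonI] unfolding y(1) by blast
  obtain Y\<^sub>2 where Y2: "corr {(a\<^sub>2, lop \<kappa> S)} y\<^sub>2 Y\<^sub>2"
    using corr_poly_at[OF singletonI] unfolding y(2) by blast
  note Y = Y1 Y2
  note c = corr1[OF Y(1)] corr2[OF Y(2)]
  note A = acts1[OF Y(1)] acts2[OF Y(2)]
  have v: "vac (Y\<^sub>1 \<Omega>) = 0" "vac (Y\<^sub>2 \<Omega>) = 0" using moment[OF c(1)] moment[OF c(2)] y(3,4) by simp_all
  have sh: "Y\<^sub>1 \<Omega> \<in> short b" "Y\<^sub>2 \<Omega> \<in> short (\<not> b)"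
    using A Nil_in_short[of b] Nil_in_short[of "\<not> b"] unfolding acts_def by blast+
  note P = corr.add[OF corr.add[OF corr.one corr_suf[OF c]] corr_suf[OF c(2,1)]]
    corr.add[OF corr.add[OF corr.one corr_pre[OF c]] corr_pre[OF c(2,1)]]
  have m: "vac (Y\<^sub>1 (Y\<^sub>1 \<Omega>)) = \<phi> (y\<^sub>1 * y\<^sub>1)" "vac (Y\<^sub>2 (Y\<^sub>2 \<Omega>)) = \<phi> (y\<^sub>2 * y\<^sub>2)"
    using moment[OF corr_mult[OF c(1,1)]] moment[OF corr_mult[OF c(2,2)]] by simp_all
  show ?thesis
    by (simp only: moment[OF corr_mult[OF P]] pre_op_vecs[OF A(1) v(1) A(2) v(2)]
      suf_op_pairing_total[OF A(1) v(1) A(2) v(2) sh(1) v(1) sh(2) v(2)] m)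
qed

lemma free: "free_elements \<phi> a\<^sub>1 a\<^sub>2"
  unfolding free_elements_def
proof (intro allI impI, elim conjE)
  fix ps :: "(bool \<times> complex poly) list"
  let ?el = "\<lambda>(i, p). poly_at p (if i then a\<^sub>1 else a\<^sub>2)"
  assume "ps \<noteq> []" "successively (\<lambda>p q. fst p \<noteq> fst q) ps" "\<forall>(i, p)\<in>set ps. \<phi> (poly_at p (if i then a\<^sub>1 else a\<^sub>2)) = 0"
  \<comment> \<open>The whole vector is tracked, not just its vacuum coefficient: it consists of
    words whose head lies on the side of the first factor.\<close>
  then have "\<exists>X. corr G (prod_list (map ?el ps)) X \<and> X \<Omega> \<in> heads (fst (hd ps) = b)"
  proof (induction ps)
    case (Cons ip ps)
    obtain i p where ip: "ip = (i, p)" by (cases ip)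
    have "\<exists>X. corr G (prod_list (map ?el ps)) X \<and> X \<Omega> \<in> no_head (i = b)"
    proof (cases ps)
      case Nil
      show ?thesis unfolding Nil
        by (rule exI[of _ "\<lambda>v. v"], intro conjI Nil_in_no_head) (simp add: corr.one)
    next
      case (Cons jq qs)
      with Cons.prems have "ps \<noteq> []" "successively (\<lambda>p q. fst p \<noteq> fst q) ps" "fst (hd ps) \<noteq> i"
        "\<forall>(i, p)\<in>set ps. \<phi> (poly_at p (if i then a\<^sub>1 else a\<^sub>2)) = 0" by (auto simp: ip)
      with Cons.IH obtain X where X: "corr G (prod_list (map ?el ps)) X" "X \<Omega> \<in> heads (fst (hd ps) = b)" by blast
      have "(fst (hd ps) = b) = (\<not> (i = b))" using \<open>fst (hd ps) \<noteq> i\<close> by auto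
      with X(2) have "X \<Omega> \<in> heads (\<not> (i = b))" by simp
      from heads_le_no_head'[OF this] X(1) show ?thesis by blast
    qed
    then obtain X where X: "corr G (prod_list (map ?el ps)) X" "X \<Omega> \<in> no_head (i = b)" by blast
    have p0: "\<phi> (?el (i, p)) = 0" using Cons.prems by (simp add: ip)
    have "\<exists>Y. corr G (?el (i, p)) Y \<and> acts (i = b) Y"
    proof (cases i)
      case True
      obtain Y where Y: "corr {(a\<^sub>1, lop \<iota> T)} (poly_at p a\<^sub>1) Y" using corr_poly_at[OF singletonI] by blast
      from corr1[OF this] acts1[OF this] True show ?thesis by auto
    next
      case False
      obtain Y where Y: "corr {(a\<^sub>2, lop \<kappa> S)} (poly_at p a\<^sub>2) Y" using corr_poly_at[OF singletonI] by blast
      from corr2[OF this] acts2[OF this] False show ?thesis by auto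
    qed
    then obtain Y where Y: "corr G (?el (i, p)) Y" "acts (i = b) Y" by blast
    have "Y (X \<Omega>) \<in> heads (i = b)"
      by (rule acts_no_head[OF Y(2) _ X(2)]) (use moment[OF Y(1)] p0 in simp)
    then show ?case using corr_mult[OF Y(1) X(1)] by (auto simp: ip)
  qed simp
  then obtain X where X: "corr G (prod_list (map ?el ps)) X" "X \<Omega> \<in> heads (fst (hd ps) = b)" by blast
  show "\<phi> (prod_list (map ?el ps)) = 0"
    by (simp only: moment[OF X(1)] vac_heads[OF X(2)])
qed

end

lemma (in model) swap: "model \<kappa> \<iota> (\<not> b) \<phi> a\<^sub>2 a\<^sub>1 S T"
  using models l1.letter_axioms l2.letter_axioms
  by (simp add: model_def model_axioms_def insert_commute)

lemma models_subset: "models \<phi> H \<Longrightarrow> G \<subseteq> H \<Longrightarrow> models \<phi> G"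
  unfolding models_def by blast

lemma (in model) free_pair: "free_pair \<phi> a\<^sub>1 a\<^sub>2"
proof -
  interpret sw: model \<kappa> \<iota> "\<not> b" \<phi> a\<^sub>2 a\<^sub>1 S T by (rule swap)
  show ?thesis
proof
  have alg: "\<exists>X. corr G x X" if "x \<in> gen_alg {a\<^sub>1, a\<^sub>2}" for x
    using gen_alg_corr[of x G] that by simp
  have lin: "clinear \<phi>" using models by (simp add: models_def)
  show "\<phi> (x * y) = \<phi> (y * x)" if x: "x \<in> gen_alg {a\<^sub>1, a\<^sub>2}" and y: "y \<in> gen_alg {a\<^sub>1, a\<^sub>2}" for x y
    using y x
  proof (induction arbitrary: x rule: gen_alg.induct)
    case (gmult g y)
    have "\<phi> (x * g * y) = \<phi> (y * (x * g))"
      using gmult by (blast intro: gen_alg_mult gen_alg_gen)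
    also have "\<dots> = \<phi> ((y * x) * g)" by (simp add: mult.assoc)
    also have "\<dots> = \<phi> (g * (y * x))"
    proof -
      obtain X where X: "corr G (y * x) X" using alg gen_alg_mult gmult by blast
      then have "corr {(a\<^sub>2, lop \<kappa> S), (a\<^sub>1, lop \<iota> T)} (y * x) X" by (simp add: insert_commute)
      with X gmult(1) show ?thesis using trace1 sw.trace1 by blast
    qed
    finally show ?case by (simp add: mult.assoc)
  qed (simp_all add: distrib_left distrib_right clinearD[OF lin] mult_scaleC_left mult_scaleC_right)
  show "free_elements \<phi> a\<^sub>1 a\<^sub>2" by (rule free)
qed (rule coalgebra sw.coalgebra pairing; assumption)+
qed

section \<open>Pairing of the two faces of a bi-free family\<close>

text \<open>The right operators create words from the vacuum and the left operators take them apart.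
  A letter made by \<open>u\<^sub>1\<close> is removed by \<open>y\<^sub>1\<close>, and one made by
  \<open>u\<^sub>2\<close> by \<open>y\<^sub>2\<close>, which produces the mixed moments.\<close>

lemma bi_pairing:
  fixes \<iota> :: "'z::complex_vector \<Rightarrow> 'x::complex_vector + 'y::complex_vector"
  assumes "letter \<iota> b" "letter \<kappa> (\<not> b)"
    and mod: "models \<phi> {(a\<^sub>1, lop \<iota> T\<^sub>1), (a\<^sub>2, lop \<kappa> T\<^sub>2), (b\<^sub>1, rop \<iota> S\<^sub>1), (b\<^sub>2, rop \<kappa> S\<^sub>2)}" (is "models \<phi> ?G")
    and y: "y\<^sub>1 = poly_at p\<^sub>1 a\<^sub>1" "y\<^sub>2 = poly_at p\<^sub>2 a\<^sub>2" "\<phi> y\<^sub>1 = 0" "\<phi> y\<^sub>2 = 0"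
    and u: "u\<^sub>1 = poly_at q\<^sub>1 b\<^sub>1" "u\<^sub>2 = poly_at q\<^sub>2 b\<^sub>2" "\<phi> u\<^sub>1 = 0" "\<phi> u\<^sub>2 = 0"
  shows "\<phi> ((1 + suf y\<^sub>1 y\<^sub>2 n + suf y\<^sub>2 y\<^sub>1 n) * (1 + suf u\<^sub>1 u\<^sub>2 n + suf u\<^sub>2 u\<^sub>1 n)) =
      1 + pre (\<phi> (y\<^sub>1 * u\<^sub>1)) (\<phi> (y\<^sub>2 * u\<^sub>2)) n + pre (\<phi> (y\<^sub>2 * u\<^sub>2)) (\<phi> (y\<^sub>1 * u\<^sub>1)) n"
proof -
  interpret l1: letter \<iota> b by fact
  interpret l2: letter \<kappa> "\<not> b" by fact
  note moment = models_corr[OF mod]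
  let ?\<Omega> = "basis_vec [] :: ('x + 'y) list \<Rightarrow>\<^sub>0 complex"
  obtain Y\<^sub>1 where Y1: "corr {(a\<^sub>1, lop \<iota> T\<^sub>1)} y\<^sub>1 Y\<^sub>1"
    using corr_poly_at[OF singletonI] unfolding y(1) by blast
  obtain Y\<^sub>2 where Y2: "corr {(a\<^sub>2, lop \<kappa> T\<^sub>2)} y\<^sub>2 Y\<^sub>2"
    using corr_poly_at[OF singletonI] unfolding y(2) by blast
  obtain U\<^sub>1 where U1: "corr {(b\<^sub>1, rop \<iota> S\<^sub>1)} u\<^sub>1 U\<^sub>1"
    using corr_poly_at[OF singletonI] unfolding u(1) by blast
  obtain U\<^sub>2 where U2: "corr {(b\<^sub>2, rop \<kappa> S\<^sub>2)} u\<^sub>2 U\<^sub>2"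
    using corr_poly_at[OF singletonI] unfolding u(2) by blast
  have cy: "corr ?G y\<^sub>1 Y\<^sub>1" by (rule corr_mono[OF Y1]) simp
  have cy': "corr ?G y\<^sub>2 Y\<^sub>2" by (rule corr_mono[OF Y2]) simp
  have cu: "corr ?G u\<^sub>1 U\<^sub>1" by (rule corr_mono[OF U1]) simp
  have cu': "corr ?G u\<^sub>2 U\<^sub>2" by (rule corr_mono[OF U2]) simp
  note A = corr_acts[OF Y1 l1.acts_lop] corr_acts[OF Y2 l2.acts_lop]
  note R = corr_racts[OF U1 l1.racts_rop] corr_racts[OF U2 l2.racts_rop]
  have v: "vac (Y\<^sub>1 ?\<Omega>) = 0" "vac (Y\<^sub>2 ?\<Omega>) = 0" "vac (U\<^sub>1 ?\<Omega>) = 0" "vac (U\<^sub>2 ?\<Omega>) = 0"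
    using moment[OF cy] moment[OF cy'] moment[OF cu] moment[OF cu'] y(3,4) u(3,4) by simp_all
  have sh: "U\<^sub>1 ?\<Omega> \<in> short b" "U\<^sub>2 ?\<Omega> \<in> short (\<not> b)"
    using R Nil_in_short[of b] Nil_in_short[of "\<not> b"] unfolding racts_def by blast+
  note P = corr.add[OF corr.add[OF corr.one corr_suf[OF cy cy']] corr_suf[OF cy' cy]]
    corr.add[OF corr.add[OF corr.one corr_suf[OF cu cu']] corr_suf[OF cu' cu]]
  have m: "vac (Y\<^sub>1 (U\<^sub>1 ?\<Omega>)) = \<phi> (y\<^sub>1 * u\<^sub>1)" "vac (Y\<^sub>2 (U\<^sub>2 ?\<Omega>)) = \<phi> (y\<^sub>2 * u\<^sub>2)"
    using moment[OF corr_mult[OF cy cu]] moment[OF corr_mult[OF cy' cu']] by simp_all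
  show ?thesis
    by (simp only: moment[OF corr_mult[OF P]] suf_op_racts[OF R(1) v(3) R(2) v(4)]
      suf_op_pairing_total[OF A(1) v(1) A(2) v(2) sh(1) v(3) sh(2) v(4)] m)
qed

text \<open>The first model serves the pairing of the faces. In the second the right face is
  reflected, so that left operators model it and everything known about one face applies to
  it.\<close>

lemma bi_free_models:
  assumes "bi_free TYPE('x::complex_vector) TYPE('y::complex_vector) \<phi> (a\<^sub>1, b\<^sub>1) (a\<^sub>2, b\<^sub>2)" "clinear \<phi>"
  obtains T\<^sub>1 T\<^sub>2 S\<^sub>1 S\<^sub>2 where
    "models \<phi> {(a\<^sub>1, lop (Inl :: 'x \<Rightarrow> 'x + 'y) T\<^sub>1), (a\<^sub>2, lop Inr T\<^sub>2), (b\<^sub>1, rop Inl S\<^sub>1), (b\<^sub>2, rop Inr S\<^sub>2)}"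
    "models \<phi> {(b\<^sub>1, lop (Inl :: 'x \<Rightarrow> 'x + 'y) S\<^sub>1), (b\<^sub>2, lop Inr S\<^sub>2)}"
proof -
  from assms(1) obtain T\<^sub>1 S\<^sub>1 :: "complex \<times> 'x \<Rightarrow> complex \<times> 'x" and T\<^sub>2 S\<^sub>2 :: "complex \<times> 'y \<Rightarrow> complex \<times> 'y"
    where cl: "clinear T\<^sub>1" "clinear S\<^sub>1" "clinear T\<^sub>2" "clinear S\<^sub>2"
      and mom: "\<And>m :: face list. \<phi> (prod_list (map (case_face a\<^sub>1 a\<^sub>2 b\<^sub>1 b\<^sub>2) m)) =
           vacuum_state (foldr (\<circ>) (map (case_face
             (lambda_op (Inl :: 'x \<Rightarrow> 'x + 'y) T\<^sub>1) (lambda_op Inr T\<^sub>2) (rho_op Inl S\<^sub>1) (rho_op Inr S\<^sub>2)) m) id)"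
    unfolding bi_free_def by auto
  let ?l1 = "lop (Inl :: 'x \<Rightarrow> 'x + 'y) T\<^sub>1" and ?l2 = "lop (Inr :: 'y \<Rightarrow> 'x + 'y) T\<^sub>2"
    and ?r1 = "rop (Inl :: 'x \<Rightarrow> 'x + 'y) S\<^sub>1" and ?r2 = "rop (Inr :: 'y \<Rightarrow> 'x + 'y) S\<^sub>2"
  let ?G = "{(a\<^sub>1, ?l1), (a\<^sub>2, ?l2), (b\<^sub>1, ?r1), (b\<^sub>2, ?r2)}"
  let ?F = "foldr (\<lambda>(g :: 'a, L) v. L v) :: _ \<Rightarrow> (('x + 'y) list \<Rightarrow>\<^sub>0 complex) \<Rightarrow> _"
  let ?op = "case_face (lambda_op (Inl :: 'x \<Rightarrow> 'x + 'y) T\<^sub>1) (lambda_op Inr T\<^sub>2) (rho_op Inl S\<^sub>1) (rho_op Inr S\<^sub>2)"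
  note ops = letter.lambda_op_abs[OF letter_Inl cl(1)] letter.lambda_op_abs[OF letter_Inr cl(3)]
    letter.rho_op_abs[OF letter_Inl cl(2)] letter.rho_op_abs[OF letter_Inr cl(4)]
  define E where "E m = foldr (\<circ>) (map ?op m) id" for m
  have E: "E [] h = h" "E (f # m) h = ?op f (E m h)" for f m h
    by (simp_all add: E_def)
  have mom: "\<phi> (prod_list (map (case_face a\<^sub>1 a\<^sub>2 b\<^sub>1 b\<^sub>2) m)) = vacuum_state (E m)" for m
    by (simp only: E_def mom)
  have faces: "\<exists>m. map fst w = map (case_face a\<^sub>1 a\<^sub>2 b\<^sub>1 b\<^sub>2) m \<and>
      (\<forall>p. E m (abs_free_prod p) = abs_free_prod (?F w p))" if "set w \<subseteq> ?G" for w
    using that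
  proof (induction w)
    case (Cons gL w)
    then obtain m where m: "map fst w = map (case_face a\<^sub>1 a\<^sub>2 b\<^sub>1 b\<^sub>2) m"
      "\<And>p. E m (abs_free_prod p) = abs_free_prod (?F w p)" by auto
    from Cons.prems consider "gL = (a\<^sub>1, ?l1)" | "gL = (a\<^sub>2, ?l2)" | "gL = (b\<^sub>1, ?r1)" | "gL = (b\<^sub>2, ?r2)"
      by auto
    then show ?case
    proof cases
      case 1
      then show ?thesis using m by (intro exI[of _ "Left1 # m"]) (simp add: ops E)
    next
      case 2
      then show ?thesis using m by (intro exI[of _ "Left2 # m"]) (simp add: ops E)
    next
      case 3
      then show ?thesis using m by (intro exI[of _ "Right1 # m"]) (simp add: ops E)
    next
      case 4
      then show ?thesis using m by (intro exI[of _ "Right2 # m"]) (simp add: ops E)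
    qed
  qed (simp add: E)
  have G: "\<phi> (prod_list (map fst w)) = vac (?F w (basis_vec []))" if w: "set w \<subseteq> ?G" for w
  proof -
    obtain m where m: "map fst w = map (case_face a\<^sub>1 a\<^sub>2 b\<^sub>1 b\<^sub>2) m"
      "\<And>p. E m (abs_free_prod p) = abs_free_prod (?F w p)"
      using faces[OF w] by blast
    show ?thesis
      unfolding m(1) mom vacuum_state_def abs_basis[symmetric] m(2) vacuum_coeff_abs ..
  qed
  then have 1: "models \<phi> ?G"
    unfolding models_def using assms(2) by (auto simp: clinear_lop clinear_rop)
  let ?H = "{(b\<^sub>1, lop (Inl :: 'x \<Rightarrow> 'x + 'y) S\<^sub>1), (b\<^sub>2, lop (Inr :: 'y \<Rightarrow> 'x + 'y) S\<^sub>2)}"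
  have r: "?r1 v = rev_word (lop Inl S\<^sub>1 (rev_word v))" "?r2 v = rev_word (lop Inr S\<^sub>2 (rev_word v))" for v
    by (simp_all add: rop_def)
  \<comment> \<open>A right operator is a left operator conjugated by reversal; along a product the
    inner reversals cancel.\<close>
  have mirror: "\<exists>w'. set w' \<subseteq> ?G \<and> map fst w' = map fst w \<and> (\<forall>p. ?F w' p = rev_word (?F w (rev_word p)))"
    if "set w \<subseteq> ?H" for w
    using that
  proof (induction w)
    case (Cons gL w)
    then obtain w' where w': "set w' \<subseteq> ?G" "map fst w' = map fst w"
      "\<And>p. ?F w' p = rev_word (?F w (rev_word p))" by auto
    from Cons.prems consider "gL = (b\<^sub>1, lop Inl S\<^sub>1)" | "gL = (b\<^sub>2, lop Inr S\<^sub>2)" by auto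
    then show ?case
    proof cases
      case 1
      have "?F ((b\<^sub>1, ?r1) # w') p = rev_word (?F (gL # w) (rev_word p))" for p
        by (simp add: 1 w'(3) r)
      moreover have "set ((b\<^sub>1, ?r1) # w') \<subseteq> ?G" "map fst ((b\<^sub>1, ?r1) # w') = map fst (gL # w)"
        using w'(1,2) 1 by auto
      ultimately show ?thesis by blast
    next
      case 2
      have "?F ((b\<^sub>2, ?r2) # w') p = rev_word (?F (gL # w) (rev_word p))" for p
        by (simp add: 2 w'(3) r)
      moreover have "set ((b\<^sub>2, ?r2) # w') \<subseteq> ?G" "map fst ((b\<^sub>2, ?r2) # w') = map fst (gL # w)"
        using w'(1,2) 2 by auto
      ultimately show ?thesis by blast
    qed
  qed simp
  have "\<phi> (prod_list (map fst w)) = vac (?F w (basis_vec []))" if w: "set w \<subseteq> ?H" for w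
  proof -
    obtain w' where w': "set w' \<subseteq> ?G" "map fst w' = map fst w"
      "\<And>p. ?F w' p = rev_word (?F w (rev_word p))" using mirror[OF w] by blast
    show ?thesis using G[OF w'(1)] by (simp add: w'(2,3) lookup_Nil_rev_word)
  qed
  then have "models \<phi> ?H"
    unfolding models_def using assms(2) by (auto simp: clinear_lop)
  with 1 that show thesis by blast
qed

section \<open>States on C*-algebras\<close>

lemma adj_zero [simp]: "adj (0::'a::cstar_algebra) = 0"
  using adj_add[of "0::'a" 0] by simp

lemma adj_minus: "adj (- x) = - adj (x::'a::cstar_algebra)"
  using adj_add[of x "- x"] by (simp add: eq_neg_iff_add_eq_0 add.commute)

lemma adj_diff: "adj (x - y) = adj x - adj (y::'a::cstar_algebra)"
  using adj_add[of x "- y"] by (simp add: adj_minus)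

lemma adj_one [simp]: "adj (1::'a::cstar_algebra) = 1"
  using adj_mult[of "adj (1::'a)" 1] by (simp add: adj_adj)

lemma adj_power: "adj (x ^ n) = adj (x::'a::cstar_algebra) ^ n"
  by (induction n) (simp_all add: adj_mult power_commutes)

lemma norm_adj [simp]: "norm (adj x) = norm (x::'a::cstar_algebra)"
proof -
  have le: "norm x \<le> norm (adj x)" for x :: 'a
  proof (cases "x = 0")
    case False
    have "norm x * norm x \<le> norm (adj x) * norm x"
      using norm_mult_ineq[of "adj x" x] by (simp only: cstar_identity power2_eq_square)
    with False show ?thesis by (simp only: mult_le_cancel_right_pos zero_less_norm_iff not_False_eq_True)
  qed simp
  from le[of x] le[of "adj x"] show ?thesis by (simp add: adj_adj)
qed

lemma scaleR_eq_scaleC: "r *\<^sub>R (x::'a::cstar_algebra) = complex_of_real r *\<^sub>C x"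
  by (simp add: scaleC_of_real)

lemmas mult_scaleC = mult_scaleC_left mult_scaleC_right

text \<open>The square root of \<open>1 - h\<close> is \<open>1 - u\<close> for the fixed point \<open>u = (h + u\<^sup>2) / 2\<close>.\<close>

lemma sqrt_one_minus:
  fixes h :: "'a::cstar_algebra"
  assumes "adj h = h" "norm h < 1"
  shows "\<exists>c. adj c = c \<and> c * c = 1 - h"
proof -
  let ?r = "norm h"
  let ?S = "{u :: 'a. norm u \<le> ?r \<and> adj u = u}"
  let ?F = "\<lambda>u :: 'a. (1/2) *\<^sub>R (h + u * u)"
  have "continuous_on UNIV (adj :: 'a \<Rightarrow> 'a)"
    unfolding continuous_on_iff dist_norm adj_diff[symmetric] norm_adj by blast
  then have cl: "closed {u :: 'a. adj u = u}"
    by (rule closed_Collect_eq[OF _ continuous_on_id])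
  have "closed {u :: 'a. norm u \<le> ?r}"
    by (intro closed_Collect_le continuous_intros)
  from closed_Int[OF this cl] have "closed ?S" by (simp only: Collect_conj_eq)
  then have complete: "Topological_Spaces.complete ?S" by (rule complete_eq_closed[THEN iffD2])
  have "h \<in> ?S" using assms by simp
  then have nonempty: "?S \<noteq> {}" by blast
  have image: "?F ` ?S \<subseteq> ?S"
  proof safe
    fix u :: 'a assume u: "norm u \<le> ?r" "adj u = u"
    have "norm (h + u * u) \<le> ?r + norm u * norm u"
      by (rule order_trans[OF norm_triangle_ineq add_left_mono[OF norm_mult_ineq]])
    also have "norm u * norm u \<le> ?r * 1"
      using u assms by (intro mult_mono) auto
    finally show "norm (?F u) \<le> ?r" by simp
    show "adj (?F u) = ?F u"
      by (simp add: scaleR_eq_scaleC adj_scaleC adj_add adj_mult u assms)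
  qed
  have lipschitz: "dist (?F u) (?F v) \<le> ?r * dist u v" if "u \<in> ?S" "v \<in> ?S" for u v
  proof -
    have "?F u - ?F v = (1/2) *\<^sub>R (u * (u - v) + (u - v) * v)"
      by (simp add: algebra_simps)
    then have "norm (?F u - ?F v) = (1/2) * norm (u * (u - v) + (u - v) * v)" by simp
    also have "norm (u * (u - v) + (u - v) * v) \<le> norm u * norm (u - v) + norm (u - v) * norm v"
      by (rule order_trans[OF norm_triangle_ineq add_mono[OF norm_mult_ineq norm_mult_ineq]])
    also have "\<dots> \<le> ?r * norm (u - v) + norm (u - v) * ?r"
      using that by (intro add_mono mult_right_mono mult_left_mono) auto
    finally show ?thesis by (simp add: dist_norm)
  qed
  have "\<exists>!u\<in>?S. ?F u = u"
    by (rule Banach_fix[OF complete nonempty norm_ge_zero assms(2) image lipschitz])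
  then obtain u where u: "adj u = u" "?F u = u" by blast
  have "u + u = ?F u + ?F u" by (simp only: u(2))
  also have "\<dots> = h + u * u"
    using scaleR_left_distrib[of "1/2" "1/2" "h + u * u"] by simp
  finally have "(1 - u) * (1 - u) = 1 - h" by (simp add: algebra_simps)
  then show ?thesis using u(1) by (intro exI[of _ "1 - u"]) (simp add: adj_diff)
qed

section \<open>The seminorm of the GNS construction\<close>

locale cstar_state =
  fixes \<phi> :: "'a::cstar_algebra \<Rightarrow> complex"
  assumes lin: "clinear \<phi>" and one: "\<phi> 1 = 1" and pos: "\<phi> (adj x * x) \<in> \<real>\<^sub>\<ge>\<^sub>0"
begin

lemmas linD = clinearD[OF lin, unfolded scaleC_complex_def]

definition nrm :: "'a \<Rightarrow> real"
  where "nrm x = sqrt (Re (\<phi> (adj x * x)))"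

lemma nrm_sq: "(complex_of_real (nrm x))\<^sup>2 = \<phi> (adj x * x)"
  and nrm_sq_Re: "(nrm x)\<^sup>2 = Re (\<phi> (adj x * x))"
proof -
  obtain r where r: "\<phi> (adj x * x) = complex_of_real r" "r \<ge> 0"
    using pos[of x] by (rule nonneg_Reals_cases)
  then show "(nrm x)\<^sup>2 = Re (\<phi> (adj x * x))" by (simp add: nrm_def)
  then show "(complex_of_real (nrm x))\<^sup>2 = \<phi> (adj x * x)" by (simp add: r flip: of_real_power)
qed

lemma nrm_nonneg [simp]: "0 \<le> nrm x"
proof -
  have "0 \<le> Re (\<phi> (adj x * x))" using pos[of x] by (auto elim!: nonneg_Reals_cases)
  then show ?thesis by (simp add: nrm_def)
qed

text \<open>Polarisation: that the values at \<open>x + y\<close> and at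
  \<open>x + \<i> *\<^sub>C y\<close> are real settles the imaginary and the real part of the two
  mixed terms.\<close>

lemma hermitian: "\<phi> (adj y * x) = cnj (\<phi> (adj x * y))"
proof -
  have im: "Im (\<phi> (adj z * z)) = 0" for z using pos[of z] by (auto elim!: nonneg_Reals_cases)
  have "Im (\<phi> (adj x * y)) + Im (\<phi> (adj y * x)) = 0"
    using im[of "x + y"] im[of x] im[of y] by (simp add: adj_add algebra_simps linD)
  moreover have "Re (\<phi> (adj x * y)) = Re (\<phi> (adj y * x))"
    using im[of "x + \<i> *\<^sub>C y"] im[of x] im[of y]
    by (simp add: adj_add adj_scaleC adj_minus distrib_left distrib_right left_diff_distrib right_diff_distrib
        mult_scaleC linD cvec.scale_minus_left)
  ultimately show ?thesis by (simp add: complex_eq_iff)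
qed

lemma adj_eq: "\<phi> (adj x) = cnj (\<phi> x)"
  using hermitian[of x 1] by simp

lemma cauchy_schwarz: "cmod (\<phi> (adj x * y)) \<le> nrm x * nrm y"
proof -
  define p where "p = \<phi> (adj x * y)"
  let ?X = "(nrm x)\<^sup>2" and ?Y = "(nrm y)\<^sup>2" and ?P = "(cmod p)\<^sup>2"
  \<comment> \<open>The quadratic in \<open>t\<close> along the direction \<open>t * cnj p\<close>.
    It is minimal at \<open>1 / ?Y\<close>; if \<open>?Y\<close> vanishes while \<open>?P\<close>
    does not, a large \<open>t\<close> would make it negative.\<close>
  have key: "0 \<le> ?X - 2 * t * ?P + t\<^sup>2 * ?P * ?Y" for t :: real
  proof -
    define s where "s = of_real t * cnj p"
    have pp: "p * cnj p = (complex_of_real (cmod p))\<^sup>2"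
      using complex_norm_square[of p] by simp
    have s: "s * p = of_real t * (p * cnj p)" "cnj s * cnj p = of_real t * (p * cnj p)"
      "s * cnj s = (of_real t)\<^sup>2 * (p * cnj p)"
      by (simp_all add: s_def power2_eq_square)
    have "(complex_of_real (nrm (x - s *\<^sub>C y)))\<^sup>2 =
      \<phi> (adj x * x) - s * p - cnj s * cnj p + s * cnj s * \<phi> (adj y * y)"
      by (simp add: nrm_sq adj_diff adj_scaleC left_diff_distrib right_diff_distrib mult_scaleC linD
          p_def hermitian[of y x] algebra_simps)
    also have "\<dots> = complex_of_real (?X - 2 * t * ?P + t\<^sup>2 * ?P * ?Y)"
      by (simp only: s pp) (simp add: algebra_simps flip: nrm_sq)
    finally have "(nrm (x - s *\<^sub>C y))\<^sup>2 = ?X - 2 * t * ?P + t\<^sup>2 * ?P * ?Y"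
      by (simp only: of_real_eq_iff flip: of_real_power)
    then show ?thesis by (metis zero_le_power2)
  qed
  have "?P \<le> ?X * ?Y"
  proof (cases "?Y = 0")
    case True
    have "?P = 0"
    proof (rule ccontr)
      assume "?P \<noteq> 0"
      with key[of "(?X + 1) / (2 * ?P)"] True show False by (simp add: field_simps)
    qed
    then show ?thesis by simp
  next
    case False
    then have "0 < ?Y" by simp
    moreover have "?X - 2 * (1 / ?Y) * ?P + (1 / ?Y)\<^sup>2 * ?P * ?Y = ?X - ?P / ?Y"
      using False by (simp add: power2_eq_square field_simps)
    ultimately show ?thesis using key[of "1 / ?Y"] by (simp add: field_simps)
  qed
  then have "?P \<le> (nrm x * nrm y)\<^sup>2" by (simp add: power_mult_distrib)
  then show ?thesis unfolding p_def by (rule power2_le_imp_le) simp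
qed

lemma cauchy_schwarz': "cmod (\<phi> (x * y)) \<le> nrm (adj x) * nrm y"
  using cauchy_schwarz[of "adj x" y] by (simp add: adj_adj)

lemma nrm_one [simp]: "nrm 1 = 1"
  by (simp add: nrm_def one)

lemma norm_le_nrm: "cmod (\<phi> x) \<le> nrm x"
  using cauchy_schwarz[of 1 x] by simp

lemma nrm_scale: "nrm (c *\<^sub>C x) = cmod c * nrm x"
proof -
  have "(nrm (c *\<^sub>C x))\<^sup>2 = (cmod c * nrm x)\<^sup>2"
  proof -
    have "(complex_of_real (nrm (c *\<^sub>C x)))\<^sup>2 = (c * cnj c) * \<phi> (adj x * x)"
      by (simp add: nrm_sq adj_scaleC mult_scaleC linD)
    also have "\<dots> = complex_of_real ((cmod c * nrm x)\<^sup>2)"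
      using complex_norm_square[of c] by (simp add: power_mult_distrib nrm_sq)
    finally show ?thesis by (simp only: of_real_eq_iff flip: of_real_power)
  qed
  then show ?thesis by (simp add: power2_eq_iff_nonneg)
qed

lemma nrm_triangle: "nrm (x + y) \<le> nrm x + nrm y"
proof (rule power2_le_imp_le)
  have "(nrm (x + y))\<^sup>2 = (nrm x)\<^sup>2 + (nrm y)\<^sup>2 + 2 * Re (\<phi> (adj x * y))"
    by (simp add: nrm_sq_Re adj_add algebra_simps linD hermitian[of y x])
  also have "\<dots> \<le> (nrm x)\<^sup>2 + (nrm y)\<^sup>2 + 2 * (nrm x * nrm y)"
    using order_trans[OF complex_Re_le_cmod cauchy_schwarz[of x y]] by simp
  finally show "(nrm (x + y))\<^sup>2 \<le> (nrm x + nrm y)\<^sup>2" by (simp add: power2_sum algebra_simps)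
qed simp

lemma nrm_minus: "nrm (- x) = nrm x"
  by (simp add: nrm_def adj_minus)

lemma nrm_diff: "nrm (x - y) \<le> nrm x + nrm y"
  using nrm_triangle[of x "- y"] by (simp add: nrm_minus)

text \<open>For \<open>d > (norm x)\<^sup>2\<close> the element \<open>1 - adj x * x / d\<close> is
  the square of a selfadjoint element, so \<phi> is nonnegative at its compression by
  \<open>z\<close>; then \<open>d\<close> tends to \<open>(norm x)\<^sup>2\<close>.\<close>

lemma nrm_mult: "nrm (x * z) \<le> norm x * nrm z"
proof (rule power2_le_imp_le)
  have *: "(nrm (x * z))\<^sup>2 \<le> ((norm x)\<^sup>2 + e) * (nrm z)\<^sup>2" if "e > 0" for e
  proof -
    define d where "d = (norm x)\<^sup>2 + e"
    have d: "d > 0" using that by (simp add: d_def add_nonneg_pos)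
    define h where "h = (1 / d) *\<^sub>R (adj x * x)"
    have "norm h < 1" using d that by (simp add: h_def cstar_identity d_def)
    moreover have "adj h = h" by (simp add: h_def scaleR_eq_scaleC adj_scaleC adj_mult adj_adj)
    ultimately obtain c where c: "adj c = c" "c * c = 1 - h" using sqrt_one_minus by blast
    have "adj (c * z) * (c * z) = adj z * (c * c) * z" by (simp add: adj_mult c(1) mult.assoc)
    also have "\<dots> = adj z * z - complex_of_real (1 / d) *\<^sub>C (adj (x * z) * (x * z))"
      by (simp add: c(2) h_def scaleR_eq_scaleC algebra_simps mult_scaleC adj_mult)
    finally have "(complex_of_real (nrm (c * z)))\<^sup>2 = complex_of_real ((nrm z)\<^sup>2 - (1 / d) * (nrm (x * z))\<^sup>2)"
      by (simp add: nrm_sq linD)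
    then have "(nrm z)\<^sup>2 - (1 / d) * (nrm (x * z))\<^sup>2 \<ge> 0"
      by (metis of_real_eq_iff of_real_power zero_le_power2)
    then show ?thesis using d by (simp add: field_simps d_def)
  qed
  show "(nrm (x * z))\<^sup>2 \<le> (norm x * nrm z)\<^sup>2"
  proof (cases "(nrm z)\<^sup>2 = 0")
    case True
    then show ?thesis using *[of 1] by simp
  next
    case False
    show ?thesis
    proof (rule field_le_epsilon)
      fix e :: real assume "e > 0"
      then show "(nrm (x * z))\<^sup>2 \<le> (norm x * nrm z)\<^sup>2 + e"
        using *[of "e / (nrm z)\<^sup>2"] False by (simp add: algebra_simps power_mult_distrib)
    qed
  qed
qed simp

lemma norm_le: "cmod (\<phi> x) \<le> norm x"
  using order_trans[OF norm_le_nrm[of x]] nrm_mult[of x 1] by simp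

lemma bounded_linear_state: "bounded_linear \<phi>"
  by (rule bounded_linear_intro[of _ 1])
    (simp_all add: linD scaleR_eq_scaleC norm_le scaleC_complex_def)

end

text \<open>The resolvent of \<open>a\<close> at \<open>\<xi> + i y\<close> as a geometric series: with \<open>s = (a - \<xi> + i t) / (i (t + y))\<close>
  one has \<open>\<xi> + i y - a = i (t + y) (1 - s)\<close>, and \<open>\<parallel>s\<parallel> < 1\<close> when \<open>t\<close> is large.\<close>

lemma resolvent_series:
  fixes a :: "'a::cstar_algebra" and \<xi> y :: real
  assumes a: "adj a = a" and y: "y > 0"
  obtains s \<alpha> \<beta> where "\<alpha> \<noteq> 0" "s = \<alpha> *\<^sub>C a + \<beta> *\<^sub>C 1" "norm s < 1" "Complex \<xi> y *\<^sub>C 1 - a = (1 / \<alpha>) *\<^sub>C (1 - s)"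
proof -
  define b where "b = a - of_real \<xi>"
  have ofr: "of_real r = complex_of_real r *\<^sub>C (1::'a)" for r
    by (simp only: of_real_def[where 'a = 'a] scaleR_eq_scaleC)
  have b: "adj b = b" by (simp add: b_def adj_diff a ofr adj_scaleC)
  \<comment> \<open>Chosen with \<open>2 * t * y = (norm b)\<^sup>2\<close>, whence
    \<open>(norm b)\<^sup>2 + t\<^sup>2 < (t + y)\<^sup>2\<close>; this is the bound needed for
    \<open>v\<close>.\<close>
  define t where "t = (norm b)\<^sup>2 / (2 * y)"
  have t: "t \<ge> 0" using y by (simp add: t_def)
  define \<alpha> where "\<alpha> = 1 / (\<i> * of_real (t + y))"
  have ty: "t + y > 0" using t y by simp
  then have \<alpha>: "\<alpha> \<noteq> 0" by (simp add: \<alpha>_def flip: of_real_add)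
  define v where "v = b + (\<i> * of_real t) *\<^sub>C 1"
  have "adj v * v = b * b + complex_of_real (t\<^sup>2) *\<^sub>C 1"
    by (simp add: v_def adj_add b adj_scaleC distrib_left distrib_right left_diff_distrib mult_scaleC scaleC_scaleC
        power2_eq_square cvec.scale_minus_left cvec.scale_right_diff_distrib algebra_simps)
  from norm_triangle_ineq[of "b * b" "complex_of_real (t\<^sup>2) *\<^sub>C 1", folded this]
  have "(norm v)\<^sup>2 \<le> norm (b * b) + norm (complex_of_real (t\<^sup>2) *\<^sub>C (1::'a))"
    by (simp only: cstar_identity)
  also have "\<dots> = (norm b)\<^sup>2 + t\<^sup>2"
    using cstar_identity[of b] by (simp add: b norm_scaleC norm_power)
  also have "\<dots> < (t + y)\<^sup>2"
  proof -
    have "2 * t * y = (norm b)\<^sup>2" using y by (simp add: t_def)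
    then show ?thesis using y by (simp add: power2_sum)
  qed
  finally have v: "norm v < t + y" by (rule power2_less_imp_less) (use ty in simp)
  have "cmod \<alpha> = 1 / (t + y)" using ty by (simp add: \<alpha>_def norm_mult norm_divide flip: of_real_add)
  then have n: "norm (\<alpha> *\<^sub>C v) < 1" using v ty by (simp add: norm_scaleC)
  define \<beta> where "\<beta> = \<alpha> * (\<i> * of_real t - of_real \<xi>)"
  have s: "\<alpha> *\<^sub>C v = \<alpha> *\<^sub>C a + \<beta> *\<^sub>C 1"
    by (simp add: v_def b_def \<beta>_def ofr scaleC_add_right cvec.scale_right_diff_distrib scaleC_scaleC
        right_diff_distrib scaleC_add_left cvec.scale_left_diff_distrib)
  have "1 / \<alpha> = \<i> * of_real (t + y)" by (simp add: \<alpha>_def)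
  moreover have "(1 / \<alpha>) *\<^sub>C (1 - \<alpha> *\<^sub>C v) = (1 / \<alpha>) *\<^sub>C 1 - v"
    using \<alpha> by (simp add: cvec.scale_right_diff_distrib scaleC_scaleC scaleC_one)
  ultimately have "(1 / \<alpha>) *\<^sub>C (1 - \<alpha> *\<^sub>C v) = (\<i> * of_real (t + y)) *\<^sub>C 1 - v"
    by simp
  also have "\<dots> = Complex \<xi> y *\<^sub>C 1 - a"
    by (simp add: v_def b_def ofr Complex_eq scaleC_add_left algebra_simps)
  finally show thesis using that[OF \<alpha> s n] by simp
qed

section \<open>Resolvent and subordination\<close>

lemma geometric_inverse:
  fixes s :: "'a::{real_normed_algebra_1, banach}"
  assumes "norm s < 1"
  shows "(1 - s) * suminf (\<lambda>n. s ^ n) = 1" "suminf (\<lambda>n. s ^ n) * (1 - s) = 1"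
proof -
  have sm: "summable (\<lambda>n. s ^ n)" by (rule complete_algebra_summable_geometric[OF assms])
  then have sums: "(\<lambda>n. s ^ n) sums suminf (\<lambda>n. s ^ n)" by (rule summable_sums)
  have 0: "(\<lambda>n. s ^ Suc n) sums (suminf (\<lambda>n. s ^ n) - 1)"
    using sums sums_Suc_iff[of "\<lambda>n. s ^ n" "suminf (\<lambda>n. s ^ n) - 1"] by simp
  have "(\<lambda>n. s ^ Suc n) sums (s * suminf (\<lambda>n. s ^ n))" using sums_mult[OF sums, of s] by simp
  moreover have "(\<lambda>n. s ^ Suc n) sums (suminf (\<lambda>n. s ^ n) * s)"
    using sums_mult2[OF sums, of s] by (simp add: power_commutes)
  ultimately have "s * suminf (\<lambda>n. s ^ n) = suminf (\<lambda>n. s ^ n) - 1" "suminf (\<lambda>n. s ^ n) * s = suminf (\<lambda>n. s ^ n) - 1"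
    using 0 sums_unique2 by blast+
  then show "(1 - s) * suminf (\<lambda>n. s ^ n) = 1" "suminf (\<lambda>n. s ^ n) * (1 - s) = 1"
    by (simp_all add: algebra_simps)
qed

lemma gen_alg_power: "x \<in> gen_alg A \<Longrightarrow> x ^ n \<in> gen_alg A"
  by (induction n) (auto intro: gen_alg.one gen_alg_mult)

lemma gen_alg_sum: "(\<And>i. i \<in> I \<Longrightarrow> x i \<in> gen_alg A) \<Longrightarrow> sum x I \<in> gen_alg A"
proof (induction I rule: infinite_finite_induct)
  case (insert i I)
  then show ?case by (auto intro: gen_alg.add)
next
  case (infinite I)
  have "0 *\<^sub>C 1 \<in> gen_alg A" by (rule gen_alg.scale[OF gen_alg.one])
  with infinite show ?case by simp
next
  case empty
  have "0 *\<^sub>C 1 \<in> gen_alg A" by (rule gen_alg.scale[OF gen_alg.one])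
  then show ?case by simp
qed

lemma gen_alg_poly_at: "a \<in> gen_alg A \<Longrightarrow> poly_at p a \<in> gen_alg A"
  unfolding poly_at_def by (intro gen_alg_sum gen_alg.scale gen_alg_power)

text \<open>With \<open>\<omega> = (\<phi>(a\<^sub>1 R) + 1) / \<phi>(R)\<close> the identity for
  \<open>a\<^sub>1\<close> reads \<open>\<phi>((\<omega> - a\<^sub>1) f R) = \<phi>(f)\<close>:
  subordination, which says that \<open>R\<close> has conditional expectation
  \<open>1 / (\<omega> - a\<^sub>1)\<close> on the algebra of \<open>a\<^sub>1\<close>. It is
  multiplied out, so that neither a division nor a conditional expectation is involved.\<close>

lemma (in cstar_state) free_resolvent:
  assumes "free_pair \<phi> a\<^sub>1 a\<^sub>2" "adj a\<^sub>1 = a\<^sub>1" "adj a\<^sub>2 = a\<^sub>2" "y > 0"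
  obtains R where "R * (Complex \<xi> y *\<^sub>C 1 - (a\<^sub>1 + a\<^sub>2)) = 1" "(Complex \<xi> y *\<^sub>C 1 - (a\<^sub>1 + a\<^sub>2)) * R = 1"
    "\<And>f p. f = poly_at p a\<^sub>1 \<Longrightarrow> \<phi> R * (\<phi> (a\<^sub>1 * f * R) + \<phi> f) = \<phi> (f * R) * (\<phi> (a\<^sub>1 * R) + 1)"
    "\<And>f p. f = poly_at p a\<^sub>2 \<Longrightarrow> \<phi> R * (\<phi> (a\<^sub>2 * f * R) + \<phi> f) = \<phi> (f * R) * (\<phi> (a\<^sub>2 * R) + 1)"
proof -
  interpret free_pair \<phi> a\<^sub>1 a\<^sub>2 by fact
  let ?a = "a\<^sub>1 + a\<^sub>2" and ?z = "Complex \<xi> y"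
  have "adj ?a = ?a" by (simp add: adj_add assms)
  from resolvent_series[OF this assms(4), of \<xi>] obtain s \<alpha> \<beta> where
    s: "\<alpha> \<noteq> 0" "s = \<alpha> *\<^sub>C ?a + \<beta> *\<^sub>C 1" "norm s < 1" "?z *\<^sub>C 1 - ?a = (1 / \<alpha>) *\<^sub>C (1 - s)" .
  define S where "S = suminf (\<lambda>n. s ^ n)"
  define R where "R = \<alpha> *\<^sub>C S"
  have inv: "R * (?z *\<^sub>C 1 - ?a) = 1" "(?z *\<^sub>C 1 - ?a) * R = 1"
    unfolding s(4) R_def S_def by (simp_all add: mult_scaleC scaleC_scaleC s(1) scaleC_one geometric_inverse[OF s(3)])
  have sm: "summable (\<lambda>n. norm s ^ n)" using s(3) by (simp add: summable_geometric)
  have sums: "(\<lambda>n. s ^ n) sums S"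
    unfolding S_def by (rule summable_sums[OF complete_algebra_summable_geometric[OF s(3)]])
  have alg: "s \<in> gen_alg {a\<^sub>1, a\<^sub>2}"
    unfolding s(2) by (intro gen_alg.add gen_alg.scale gen_alg.one gen_alg_gen) auto
  have bl: "bounded_linear (\<lambda>r. \<phi> (c * r * d))" for c d
    using bounded_linear_compose[OF bounded_linear_state
        bounded_linear_compose[OF bounded_linear_mult_left bounded_linear_mult_right]] by simp
  have term_sums: "(\<lambda>n. \<phi> (c * s ^ n * d)) sums \<phi> (c * S * d)" for c d
    by (rule bounded_linear.sums[OF bl sums])
  have term_summable: "summable (\<lambda>n. norm (\<phi> (c * s ^ n * d)))" for c d
  proof (rule summable_comparison_test)
    show "summable (\<lambda>n. norm c * norm d * norm s ^ n)" by (rule summable_mult[OF sm])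
    have "cmod (\<phi> (c * s ^ n * d)) \<le> norm c * norm d * norm s ^ n" for n
    proof -
      have "cmod (\<phi> (c * s ^ n * d)) \<le> norm (c * s ^ n * d)" by (rule norm_le)
      also have "\<dots> \<le> norm c * norm (s ^ n) * norm d"
        by (rule order_trans[OF norm_mult_ineq mult_right_mono[OF norm_mult_ineq]]) simp
      also have "\<dots> \<le> norm c * norm s ^ n * norm d"
        by (intro mult_right_mono mult_left_mono norm_power_ineq) auto
      finally show ?thesis by (simp add: mult_ac)
    qed
    then show "\<exists>N. \<forall>n\<ge>N. norm (norm (\<phi> (c * s ^ n * d))) \<le> norm c * norm d * norm s ^ n" by auto
  qed
  \<comment> \<open>The finite identities are the coefficients of Cauchy products; summing them
    gives an identity between products of two values.\<close>
  have prod_sums: "(\<lambda>k. \<Sum>i\<le>k. \<phi> (c * s ^ i * d) * \<phi> (c' * s ^ (k - i) * d')) sums (\<phi> (c * S * d) * \<phi> (c' * S * d'))" for c d c' d'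
    using Cauchy_product_sums[OF term_summable term_summable, of c d c' d'] sums_unique[OF term_sums] by simp
  have main: "\<phi> R * (\<phi> (b * f * R) + \<phi> f) = \<phi> (f * R) * (\<phi> (b * R) + 1)"
    if f: "f = poly_at p b" and bc: "b \<in> {a\<^sub>1, a\<^sub>2}" "b + c = ?a"
      and co: "\<And>n. (\<Sum>i<n. \<phi> (poly_at p b * s ^ i * c) * \<phi> (s ^ (n - 1 - i))) =
        (\<Sum>i<n. \<phi> (poly_at p b * s ^ i) * \<phi> (c * s ^ (n - 1 - i)))" for f p b c
  proof -
    have fa: "f \<in> gen_alg {a\<^sub>1, a\<^sub>2}" and ba: "b \<in> gen_alg {a\<^sub>1, a\<^sub>2}"
      unfolding f using bc(1) by (auto intro: gen_alg_poly_at gen_alg_gen)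
    have "(\<lambda>k. \<Sum>i\<le>k. \<phi> (f * s ^ i * c) * \<phi> (1 * s ^ (k - i) * 1)) =
      (\<lambda>k. \<Sum>i\<le>k. \<phi> (f * s ^ i * 1) * \<phi> (c * s ^ (k - i) * 1))"
      using co[of "Suc k" for k] by (simp add: lessThan_Suc_atMost f fun_eq_iff)
    from prod_sums[of f c 1 1, unfolded this] prod_sums[of f 1 c 1]
    have "\<phi> (f * S * c) * \<phi> S = \<phi> (f * S) * \<phi> (c * S)" using sums_unique2 by fastforce
    then have 1: "\<phi> (f * R * c) * \<phi> R = \<phi> (f * R) * \<phi> (c * R)"
      by (simp add: R_def mult_scaleC linD)
    \<comment> \<open>The trace property concerns the generated algebra, to which \<open>S\<close>
      need not belong; it is applied to the powers of \<open>s\<close> and carried over to their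
      sum.\<close>
    have tr: "\<phi> (f * s ^ n * b) = \<phi> (b * f * s ^ n * 1)" for n
      using trace[of "f * s ^ n" b] by (simp add: gen_alg_mult fa ba alg gen_alg_power mult.assoc)
    have "\<phi> (f * S * b) = \<phi> (b * f * S * 1)"
      using sums_unique2[OF term_sums[of f b, unfolded tr] term_sums[of "b * f" 1]] .
    then have 2: "\<phi> (f * R * b) = \<phi> (b * f * R)" by (simp add: R_def mult_scaleC linD)
    have c: "c = ?a - b" using bc(2) by (simp add: algebra_simps)
    have "R * ?a = ?z *\<^sub>C R - 1" "?a * R = ?z *\<^sub>C R - 1"
      using inv by (simp_all add: right_diff_distrib left_diff_distrib mult_scaleC algebra_simps)
    then have "f * R * c = ?z *\<^sub>C (f * R) - f - f * R * b" "c * R = ?z *\<^sub>C R - 1 - b * R"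
      unfolding c by (simp_all add: right_diff_distrib left_diff_distrib mult.assoc mult_scaleC)
    then have "(?z * \<phi> (f * R) - \<phi> f - \<phi> (b * f * R)) * \<phi> R = \<phi> (f * R) * (?z * \<phi> R - 1 - \<phi> (b * R))"
      using 1 2 by (simp add: linD one)
    then show ?thesis by (simp add: algebra_simps)
  qed
  show thesis
  proof (rule that[OF inv])
    fix f p assume "f = poly_at p a\<^sub>1"
    then show "\<phi> R * (\<phi> (a\<^sub>1 * f * R) + \<phi> f) = \<phi> (f * R) * (\<phi> (a\<^sub>1 * R) + 1)"
      by (rule main[where c = a\<^sub>2]) (use coalgebra1[OF s(2,1)] in auto)
  next
    fix f p assume "f = poly_at p a\<^sub>2"
    then show "\<phi> R * (\<phi> (a\<^sub>2 * f * R) + \<phi> f) = \<phi> (f * R) * (\<phi> (a\<^sub>2 * R) + 1)"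
      by (rule main[where c = a\<^sub>1]) (use coalgebra2[of s \<alpha> \<beta>] s(1,2) in \<open>auto simp: add.commute\<close>)
  qed
qed

section \<open>Peaking polynomials\<close>

lemma poly_at_upto:
  assumes "degree p \<le> n"
  shows "poly_at p a = (\<Sum>i\<le>n. coeff p i *\<^sub>C a ^ i)"
  unfolding poly_at_def using assms
  by (intro sum.mono_neutral_left) (auto simp: coeff_eq_0)

lemma poly_at_add: "poly_at (p + q) a = poly_at p a + poly_at q a"
proof -
  let ?n = "max (degree p) (degree q)"
  show ?thesis
    by (simp add: poly_at_upto[of p ?n] poly_at_upto[of q ?n] poly_at_upto[of "p + q" ?n] degree_add_le
        scaleC_add_left sum.distrib)
qed

lemma poly_at_smult: "poly_at (smult c p) a = c *\<^sub>C poly_at p a"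
  by (simp add: poly_at_upto[of "smult c p" "degree p"] degree_smult_le poly_at_def cvec.scale_sum_right scaleC_scaleC)

lemma poly_at_0 [simp]: "poly_at 0 a = 0"
  by (simp add: poly_at_def)

lemma poly_at_1 [simp]: "poly_at 1 a = 1"
  by (simp add: poly_at_def scaleC_one)

lemma poly_at_diff: "poly_at (p - q) a = poly_at p a - poly_at q a"
  using poly_at_add[of "p - q" q a] by simp

lemma poly_at_pCons: "poly_at (pCons c p) a = c *\<^sub>C 1 + a * poly_at p a"
proof -
  have "poly_at (pCons c p) a = (\<Sum>i\<le>Suc (degree p). coeff (pCons c p) i *\<^sub>C a ^ i)"
    by (rule poly_at_upto) (simp add: degree_pCons_le)
  also have "\<dots> = c *\<^sub>C 1 + (\<Sum>i\<le>degree p. coeff p i *\<^sub>C a ^ Suc i)"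
    by (subst sum.atMost_Suc_shift) simp
  finally show ?thesis by (simp add: poly_at_def sum_distrib_left mult_scaleC)
qed

lemma poly_at_mult: "poly_at (p * q) a = poly_at p a * poly_at q a"
  by (induction p) (simp_all add: poly_at_pCons poly_at_add poly_at_smult distrib_right mult_scaleC mult.assoc)

lemma poly_at_power: "poly_at (p ^ n) a = poly_at p a ^ n"
  by (induction n) (simp_all add: poly_at_mult)

lemma poly_at_linear: "poly_at [:c, 1:] a = a + c *\<^sub>C 1"
  by (simp add: poly_at_pCons add.commute scaleC_one)

text \<open>For \<open>\<bar>t - x\<bar> < M\<close> the base lies in [0, 1] and equals 1 only at
  \<open>x\<close>, so the powers decrease to the indicator function of \<open>x\<close>. Being
  powers, two peaks at the same point multiply to a peak.\<close>

definition peak :: "real \<Rightarrow> real \<Rightarrow> nat \<Rightarrow> complex poly"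
  where "peak x M k = (1 - smult (of_real (1 / M\<^sup>2)) ([:- of_real x, 1:]\<^sup>2)) ^ k"

lemma peak_add: "peak x M (j + k) = peak x M j * peak x M k"
  by (simp add: peak_def power_add)

text \<open>The squared distance from \<open>x\<close> against a peak is a difference of consecutive
  peaks, which becomes small once the values of the state at peaks converge.\<close>

lemma peak_sq:
  assumes "M > 0"
  shows "[:- of_real x, 1:]\<^sup>2 * peak x M k = smult (of_real (M\<^sup>2)) (peak x M k - peak x M (Suc k))"
proof -
  define l where "l = [:- complex_of_real x, 1:]\<^sup>2"
  define r where "r = complex_of_real (1 / M\<^sup>2)"
  have "peak x M k - peak x M (Suc k) = smult r l * peak x M k"
    unfolding peak_def l_def[symmetric] r_def[symmetric] by (simp add: algebra_simps)
  moreover have "complex_of_real (M\<^sup>2) * r = 1" using assms by (simp add: r_def)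
  ultimately show ?thesis by (simp add: l_def[symmetric] del: of_real_power)
qed

text \<open>A peak has value 1 at \<open>x\<close>. The factorisation allows it to be replaced by 1
  in front of anything that is annihilated by \<open>h - x\<close>.\<close>

lemma peak_dvd: "\<exists>g. 1 - peak x M k = g * [:- of_real x, 1:]"
proof -
  define l where "l = [:- complex_of_real x, 1:]"
  define r where "r = complex_of_real (1 / M\<^sup>2)"
  define q where "q = 1 - smult r (l\<^sup>2)"
  have "1 - q ^ k = (1 - q) * (\<Sum>i<k. q ^ i)" by (rule one_diff_power_eq)
  also have "1 - q = smult r l * l"
    by (simp add: q_def power2_eq_square)
  finally have "1 - peak x M k = ((\<Sum>i<k. q ^ i) * smult r l) * l"
    unfolding peak_def l_def[symmetric] r_def[symmetric] q_def[symmetric] by (simp only: mult_ac)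
  then have "\<exists>g. 1 - peak x M k = g * l" by blast
  then show ?thesis by (simp only: l_def)
qed

lemma poly_at_linear_of_real: "poly_at [:- of_real x, 1:] a = a - of_real x *\<^sub>C 1"
  by (simp add: poly_at_linear cvec.scale_minus_left)

lemma adj_sub: "adj a = a \<Longrightarrow> adj (a - of_real x *\<^sub>C 1) = a - of_real x *\<^sub>C (1::'a::cstar_algebra)"
  by (simp add: adj_diff adj_scaleC)

lemma adj_peak:
  assumes "adj a = a"
  shows "adj (poly_at (peak x M k) a) = poly_at (peak x M k) a"
  by (simp add: peak_def poly_at_power poly_at_diff poly_at_smult poly_at_linear_of_real adj_power adj_diff
      adj_scaleC adj_sub[OF assms] assms)

lemma poly_at_commute: "poly_at p a * poly_at q a = poly_at q a * poly_at p a"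
  by (simp add: mult.commute flip: poly_at_mult)

text \<open>Keeps the rate of convergence along with the limit; the interchanges of limits depend on
  it.\<close>

lemma limit_from_bound:
  fixes u :: "nat \<Rightarrow> complex"
  assumes "\<And>k j. cmod (u k - u j) \<le> B * (e k + e j)" "e \<longlonglongrightarrow> 0"
  obtains l where "u \<longlonglongrightarrow> l" "\<And>k. cmod (u k - l) \<le> B * e k"
proof -
  have B: "(\<lambda>k. B * e k) \<longlonglongrightarrow> 0" using tendsto_mult_right_zero[OF assms(2)] by simp
  have "Cauchy u"
  proof (rule metric_CauchyI)
    fix \<epsilon> :: real assume "\<epsilon> > 0"
    then have "eventually (\<lambda>k. \<bar>B * e k\<bar> < \<epsilon> / 2) sequentially"
      using tendstoD[OF B, of "\<epsilon> / 2"] by simp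
    then obtain N where N: "\<And>k. k \<ge> N \<Longrightarrow> \<bar>B * e k\<bar> < \<epsilon> / 2" by (auto simp: eventually_sequentially)
    have "dist (u k) (u j) < \<epsilon>" if "k \<ge> N" "j \<ge> N" for k j
      using assms(1)[of k j] N[OF that(1)] N[OF that(2)] by (simp add: dist_norm distrib_left)
    then show "\<exists>N. \<forall>k\<ge>N. \<forall>j\<ge>N. dist (u k) (u j) < \<epsilon>" by blast
  qed
  then obtain l where l: "u \<longlonglongrightarrow> l" using Cauchy_convergent_iff convergent_def by blast
  have "cmod (u k - l) \<le> B * e k" for k
  proof (rule LIMSEQ_le)
    show "(\<lambda>j. cmod (u k - u j)) \<longlonglongrightarrow> cmod (u k - l)" by (intro tendsto_intros l)
    show "(\<lambda>j. B * e k + B * e j) \<longlonglongrightarrow> B * e k" using tendsto_add[OF tendsto_const B] by simp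
  qed (use assms(1)[of k] in \<open>auto simp: distrib_left\<close>)
  with l that show thesis by blast
qed

text \<open>An interchange of limits: the error \<open>e k\<close> is uniform in \<open>n\<close>,
  and for fixed \<open>k\<close> the rest vanishes as \<open>n\<close> grows.\<close>

lemma limit_from_eventual_bound:
  fixes u :: "nat \<Rightarrow> complex"
  assumes "\<And>k n. cmod (u n - l) \<le> s n k + e k" "\<And>k. (\<lambda>n. s n k) \<longlonglongrightarrow> 0" "e \<longlonglongrightarrow> 0"
  shows "u \<longlonglongrightarrow> l"
proof (rule metric_LIMSEQ_I)
  fix \<epsilon> :: real assume "\<epsilon> > 0"
  then have "eventually (\<lambda>k. \<bar>e k\<bar> < \<epsilon> / 2) sequentially" using tendstoD[OF assms(3), of "\<epsilon> / 2"] by simp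
  then obtain k where k: "\<bar>e k\<bar> < \<epsilon> / 2" by (auto simp: eventually_sequentially)
  have "eventually (\<lambda>n. \<bar>s n k\<bar> < \<epsilon> / 2) sequentially"
    using tendstoD[OF assms(2)[of k], of "\<epsilon> / 2"] \<open>\<epsilon> > 0\<close> by simp
  then obtain N where N: "\<And>n. n \<ge> N \<Longrightarrow> \<bar>s n k\<bar> < \<epsilon> / 2" by (auto simp: eventually_sequentially)
  have "dist (u n) l < \<epsilon>" if "n \<ge> N" for n
    using assms(1)[of n k] N[OF that] k by (simp add: dist_norm)
  then show "\<exists>N. \<forall>n\<ge>N. dist (u n) l < \<epsilon>" by blast
qed

text \<open>The vectors \<open>P k\<close> converge in the GNS space to the spectral projection of \<open>h\<close> at \<open>x\<close>, whose
  trace is \<open>m\<close>.\<close>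

locale peak_seq = cstar_state \<phi> for \<phi> :: "'a::cstar_algebra \<Rightarrow> complex" +
  fixes h :: 'a and x M m :: real
  assumes selfadj: "adj h = h" and M: "M > 0"
    and lim: "(\<lambda>k. \<phi> (poly_at (peak x M k) h)) \<longlonglongrightarrow> complex_of_real m"
begin

definition "P k = poly_at (peak x M k) h"
definition "c k = Re (\<phi> (P k))"
text \<open>The distance of \<open>P k\<close> from its limit in the GNS space:
  \<open>c (k + k)\<close> is the squared norm of \<open>P k\<close>, and \<open>m\<close> is both
  that of the limit and the limiting inner product.\<close>

definition "e k = sqrt (c (k + k) - m)"

lemma adj_P: "adj (P k) = P k"
  unfolding P_def by (rule adj_peak[OF selfadj])

lemma P_mult: "P j * P k = P (j + k)"
  by (simp add: P_def peak_add poly_at_mult)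

lemma phi_P: "\<phi> (P k) = complex_of_real (c k)"
  using adj_eq[of "P k"] by (simp add: adj_P c_def complex_eq_iff)

lemma c_lim: "c \<longlonglongrightarrow> m"
  using tendsto_Re[OF lim] by (simp add: c_def[abs_def] P_def)

lemma c_double_lim: "(\<lambda>k. c (k + k)) \<longlonglongrightarrow> m" "(\<lambda>k. c (Suc (k + k))) \<longlonglongrightarrow> m" "(\<lambda>k. c (j + k)) \<longlonglongrightarrow> m"
  by (rule filterlim_compose[OF c_lim], rule filterlim_at_top_mono[OF filterlim_ident], simp)+

lemma nrm_P: "(nrm (P k))\<^sup>2 = c (k + k)"
  by (simp add: nrm_sq_Re adj_P P_mult c_def)

lemma nrm_P_lim: "(\<lambda>k. nrm (P k)) \<longlonglongrightarrow> sqrt m"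
proof -
  have "nrm (P k) = sqrt (c (k + k))" for k by (simp flip: nrm_P)
  then show ?thesis using tendsto_real_sqrt[OF c_double_lim(1)] by simp
qed

lemma nrm_diff_sq: "(nrm (P k - P j))\<^sup>2 = c (k + k) - 2 * c (k + j) + c (j + j)"
  by (simp add: nrm_sq_Re adj_diff adj_P left_diff_distrib right_diff_distrib P_mult linD phi_P add.commute)

lemma nrm_diff_lim: "(\<lambda>j. (nrm (P k - P j))\<^sup>2) \<longlonglongrightarrow> c (k + k) - m"
proof -
  have "(\<lambda>j. c (k + k) - 2 * c (k + j) + c (j + j)) \<longlonglongrightarrow> c (k + k) - 2 * m + m"
    by (intro tendsto_intros c_double_lim)
  then show ?thesis by (simp add: nrm_diff_sq)
qed

lemma e_nonneg: "0 \<le> e k"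
proof -
  have "0 \<le> c (k + k) - m" by (rule LIMSEQ_le_const[OF nrm_diff_lim]) auto
  then show ?thesis by (simp add: e_def)
qed

lemma nrm_diff_lim_e: "(\<lambda>j. nrm (P k - P j)) \<longlonglongrightarrow> e k"
  using tendsto_real_sqrt[OF nrm_diff_lim[of k]] by (simp add: e_def)

lemma e_lim: "e \<longlonglongrightarrow> 0"
proof -
  have "(\<lambda>k. sqrt (c (k + k) - m)) \<longlonglongrightarrow> sqrt (m - m)"
    by (intro tendsto_intros c_double_lim)
  then show ?thesis by (simp add: e_def[abs_def])
qed

lemma nrm_diff_le: "nrm (P k - P j) \<le> e k + e j"
proof (rule LIMSEQ_le)
  show "(\<lambda>i. nrm (P k - P j)) \<longlonglongrightarrow> nrm (P k - P j)" by simp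
  show "(\<lambda>i. nrm (P k - P i) + nrm (P j - P i)) \<longlonglongrightarrow> e k + e j"
    by (intro tendsto_intros nrm_diff_lim_e)
  have "nrm (P k - P j) \<le> nrm (P k - P i) + nrm (P j - P i)" for i
    using nrm_diff[of "P k - P i" "P j - P i"] by simp
  then show "\<exists>N. \<forall>n\<ge>N. nrm (P k - P j) \<le> nrm (P k - P n) + nrm (P j - P n)" by blast
qed

text \<open>By \<open>peak_sq\<close> the squared norm is a multiple of the difference of two
  consecutive values of \<open>c\<close>, which share the limit \<open>m\<close>.\<close>

lemma residual_lim: "(\<lambda>k. nrm ((h - of_real x *\<^sub>C 1) * P k)) \<longlonglongrightarrow> 0"
proof -
  have "(nrm ((h - of_real x *\<^sub>C 1) * P k))\<^sup>2 = M\<^sup>2 * (c (k + k) - c (Suc (k + k)))" for k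
  proof -
    let ?l = "[:- complex_of_real x, 1:]"
    have "adj ((h - of_real x *\<^sub>C 1) * P k) * ((h - of_real x *\<^sub>C 1) * P k) = poly_at (peak x M k * ?l * (?l * peak x M k)) h"
      by (simp add: adj_mult adj_P adj_sub[OF selfadj] poly_at_mult poly_at_linear_of_real P_def[symmetric] del: mult_pCons_left mult_pCons_right)
    also have "peak x M k * ?l * (?l * peak x M k) = ?l\<^sup>2 * peak x M (k + k)"
      by (simp only: peak_add power2_eq_square mult_ac)
    also have "\<dots> = smult (of_real (M\<^sup>2)) (peak x M (k + k) - peak x M (Suc (k + k)))"
      by (rule peak_sq[OF M])
    finally show ?thesis
      by (simp add: nrm_sq_Re poly_at_smult poly_at_diff linD c_def P_def)
  qed
  then have "nrm ((h - of_real x *\<^sub>C 1) * P k) = sqrt (M\<^sup>2 * (c (k + k) - c (Suc (k + k))))" for k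
    by (rule real_sqrt_unique[OF _ nrm_nonneg, symmetric])
  moreover have "(\<lambda>k. sqrt (M\<^sup>2 * (c (k + k) - c (Suc (k + k))))) \<longlonglongrightarrow> sqrt (M\<^sup>2 * (m - m))"
    by (intro tendsto_intros c_double_lim)
  ultimately show ?thesis by simp
qed

text \<open>Cauchy-Schwarz against 1 gives \<open>m\<^sup>2 \<le> m\<close> in the limit.\<close>

lemma m_bounds: "0 \<le> m" "m \<le> 1"
proof -
  have "0 \<le> c (k + k)" for k by (simp flip: nrm_P)
  then show 0: "0 \<le> m" by (intro LIMSEQ_le_const[OF c_double_lim(1)]) auto
  have "(c k)\<^sup>2 \<le> c (k + k)" for k
  proof -
    have "\<bar>c k\<bar> \<le> nrm (P k)" using norm_le_nrm[of "P k"] by (simp add: phi_P)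
    then have "\<bar>c k\<bar>\<^sup>2 \<le> (nrm (P k))\<^sup>2" by (intro power_mono) auto
    then show ?thesis by (simp add: nrm_P)
  qed
  then have "m\<^sup>2 \<le> m"
    by (intro LIMSEQ_le[OF tendsto_power[OF c_lim] c_double_lim(1)]) auto
  then show "m \<le> 1" using 0 by (cases "m = 0") (auto simp: power2_eq_square)
qed

text \<open>The limit stands in for the value at a spectral projection, which need not lie in the
  algebra; the error is uniform over all \<open>z\<close> with bounded
  \<open>nrm (adj z)\<close>.\<close>

lemma functional_limit:
  obtains l where "(\<lambda>k. \<phi> (z * P k)) \<longlonglongrightarrow> l" "\<And>k. cmod (\<phi> (z * P k) - l) \<le> nrm (adj z) * e k"
proof -
  have "cmod (\<phi> (z * P k) - \<phi> (z * P j)) \<le> nrm (adj z) * (e k + e j)" for k j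
  proof -
    have "\<phi> (z * P k) - \<phi> (z * P j) = \<phi> (z * (P k - P j))" by (simp add: right_diff_distrib linD)
    then show ?thesis
      using cauchy_schwarz'[of z "P k - P j"] mult_left_mono[OF nrm_diff_le[of k j] nrm_nonneg[of "adj z"]] by simp
  qed
  from limit_from_bound[OF this e_lim] that show thesis by blast
qed

lemma functional_limit':
  obtains l where "(\<lambda>k. \<phi> (P k * w)) \<longlonglongrightarrow> l" "\<And>k. cmod (\<phi> (P k * w) - l) \<le> nrm w * e k"
proof -
  have "cmod (\<phi> (P k * w) - \<phi> (P j * w)) \<le> nrm w * (e k + e j)" for k j
  proof -
    have "\<phi> (P k * w) - \<phi> (P j * w) = \<phi> ((P k - P j) * w)" by (simp add: left_diff_distrib linD)
    then show ?thesis
      using cauchy_schwarz'[of "P k - P j" w] mult_right_mono[OF nrm_diff_le[of k j] nrm_nonneg[of w]]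
      by (simp add: adj_diff adj_P mult.commute)
  qed
  from limit_from_bound[OF this e_lim] that show thesis by blast
qed

lemma one_minus_P: "\<exists>g. 1 - P k = poly_at g h * (h - of_real x *\<^sub>C 1)"
proof -
  obtain g where "1 - peak x M k = g * [:- of_real x, 1:]" using peak_dvd by blast
  from arg_cong[OF this, of "\<lambda>p. poly_at p h"] show ?thesis
    by (auto simp add: poly_at_diff poly_at_mult poly_at_linear_of_real P_def simp del: mult_pCons_left mult_pCons_right)
qed

end

text \<open>The first-order expansion of the subordination function \<open>\<omega>\<close> at the atom; here
  \<open>\<omega> = (\<phi> (h * Q n) + i y) / \<phi> (Q n)\<close>.\<close>

lemma (in peak_seq) first_order:
  fixes Q :: "nat \<Rightarrow> 'a" and y :: "nat \<Rightarrow> real" and \<mu> :: complex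
  assumes id: "\<And>n f p. f = poly_at p h \<Longrightarrow>
      \<phi> (Q n) * (\<phi> (h * f * Q n) + \<i> * of_real (y n) * \<phi> f) = \<phi> (f * Q n) * (\<phi> (h * Q n) + \<i> * of_real (y n))"
    and y: "\<And>n. y n > 0" and Q: "\<And>n. nrm (Q n) \<le> 1"
    and Qlim: "(\<lambda>n. \<phi> (Q n)) \<longlonglongrightarrow> \<mu>" "\<mu> \<noteq> 0"
    and zero: "\<And>g. (\<lambda>n. \<phi> (poly_at g h * (h - of_real x *\<^sub>C 1) * Q n)) \<longlonglongrightarrow> 0"
  shows "(\<lambda>n. ((\<phi> (h * Q n) + \<i> * of_real (y n)) / \<phi> (Q n) - of_real x) / (\<i> * of_real (y n))) \<longlonglongrightarrow> of_real m / \<mu>"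
proof -
  \<comment> \<open>\<open>l n\<close> plays the part of \<open>\<phi>(P Q\<^sub>n)\<close>, where
    \<open>P\<close> is the spectral projection of \<open>h\<close> at \<open>x\<close>.\<close>
  have "\<exists>l. (\<lambda>k. \<phi> (P k * Q n)) \<longlonglongrightarrow> l \<and> (\<forall>k. cmod (\<phi> (P k * Q n) - l) \<le> nrm (Q n) * e k)" for n
    by (rule functional_limit'[of "Q n"]) blast
  then obtain l where l: "\<And>n. (\<lambda>k. \<phi> (P k * Q n)) \<longlonglongrightarrow> l n" "\<And>n k. cmod (\<phi> (P k * Q n) - l n) \<le> nrm (Q n) * e k"
    by metis
  \<comment> \<open>For fixed \<open>k\<close> the element \<open>1 - P k\<close> has the factor
    \<open>h - x\<close>, which \<open>zero\<close> removes in the limit.\<close>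
  have PQ: "(\<lambda>n. \<phi> (P k * Q n)) \<longlonglongrightarrow> \<mu>" for k
  proof -
    obtain g where g: "1 - P k = poly_at g h * (h - of_real x *\<^sub>C 1)" using one_minus_P by blast
    have "P k = 1 - poly_at g h * (h - of_real x *\<^sub>C 1)" by (simp flip: g)
    then have "\<phi> (P k * Q n) = \<phi> (Q n) - \<phi> (poly_at g h * (h - of_real x *\<^sub>C 1) * Q n)" for n
      by (simp only: left_diff_distrib mult_1_left linD)
    then show ?thesis using tendsto_diff[OF Qlim(1) zero[of g]] by simp
  qed
  have "l \<longlonglongrightarrow> \<mu>"
  proof (rule limit_from_eventual_bound[OF _ _ e_lim])
    show "(\<lambda>n. cmod (\<phi> (P k * Q n) - \<mu>)) \<longlonglongrightarrow> 0" for k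
      using PQ[of k] by (simp add: LIM_zero tendsto_norm_zero)
    show "cmod (l n - \<mu>) \<le> cmod (\<phi> (P k * Q n) - \<mu>) + e k" for k n
    proof -
      have "cmod (l n - \<mu>) \<le> cmod (\<phi> (P k * Q n) - \<mu>) + cmod (\<phi> (P k * Q n) - l n)"
        using norm_triangle_ineq4[of "\<phi> (P k * Q n) - \<mu>" "\<phi> (P k * Q n) - l n"] by simp
      also have "cmod (\<phi> (P k * Q n) - l n) \<le> 1 * e k"
        by (rule order_trans[OF l(2) mult_right_mono[OF Q e_nonneg]])
      finally show ?thesis by simp
    qed
  qed
  \<comment> \<open>The identity with \<open>f = P k\<close> for growing \<open>k\<close>: the term
    with \<open>h - x\<close> disappears and \<open>\<phi> (P k)\<close> becomes \<open>m\<close>.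
    The deviation of \<omega> from \<open>x\<close> is thus known exactly for every
    \<open>n\<close>, without an error term.\<close>
  have theta: "\<i> * of_real (y n) * of_real m = l n * ((\<phi> (h * Q n) + \<i> * of_real (y n)) / \<phi> (Q n) - of_real x)"
    if nz: "\<phi> (Q n) \<noteq> 0" for n
  proof -
    define \<theta> where "\<theta> = (\<phi> (h * Q n) + \<i> * of_real (y n)) / \<phi> (Q n) - of_real x"
    have step: "\<i> * of_real (y n) * \<phi> (P k) = \<phi> (P k * Q n) * \<theta> - \<phi> ((h - of_real x *\<^sub>C 1) * P k * Q n)" for k
    proof -
      have "\<phi> (Q n) * (\<phi> (h * P k * Q n) + \<i> * of_real (y n) * \<phi> (P k)) = \<phi> (P k * Q n) * (\<phi> (h * Q n) + \<i> * of_real (y n))"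
        by (rule id) (simp add: P_def)
      then have "\<phi> (h * P k * Q n) + \<i> * of_real (y n) * \<phi> (P k) = \<phi> (P k * Q n) * (\<theta> + of_real x)"
        using nz by (simp add: \<theta>_def field_simps)
      then show ?thesis by (simp add: left_diff_distrib mult_scaleC linD algebra_simps)
    qed
    have "(\<lambda>k. \<phi> ((h - of_real x *\<^sub>C 1) * P k * Q n)) \<longlonglongrightarrow> 0"
    proof (rule Lim_null_comparison[OF _ residual_lim])
      have "cmod (\<phi> ((h - of_real x *\<^sub>C 1) * P k * Q n)) \<le> nrm ((h - of_real x *\<^sub>C 1) * P k)" for k
      proof -
        have "adj ((h - of_real x *\<^sub>C 1) * P k) = (h - of_real x *\<^sub>C 1) * P k"
          unfolding adj_mult adj_P adj_sub[OF selfadj]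
          unfolding P_def poly_at_linear_of_real[symmetric] by (rule poly_at_commute)
        then show ?thesis
          using cauchy_schwarz'[of "(h - of_real x *\<^sub>C 1) * P k" "Q n"]
            mult_left_mono[OF Q[of n] nrm_nonneg[of "(h - of_real x *\<^sub>C 1) * P k"]] by simp
      qed
      then show "\<forall>\<^sub>F k in sequentially. cmod (\<phi> ((h - of_real x *\<^sub>C 1) * P k * Q n)) \<le> nrm ((h - of_real x *\<^sub>C 1) * P k)" by simp
    qed
    from tendsto_diff[OF tendsto_mult[OF l(1)[of n] tendsto_const[of \<theta>]] this]
    have "(\<lambda>k. \<i> * of_real (y n) * \<phi> (P k)) \<longlonglongrightarrow> l n * \<theta>" by (simp flip: step)
    moreover have "(\<lambda>k. \<i> * of_real (y n) * \<phi> (P k)) \<longlonglongrightarrow> \<i> * of_real (y n) * of_real m"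
      unfolding P_def by (intro tendsto_intros lim)
    ultimately show ?thesis unfolding \<theta>_def by (rule LIMSEQ_unique[THEN sym])
  qed
  have "eventually (\<lambda>n. \<phi> (Q n) \<noteq> 0) sequentially" "eventually (\<lambda>n. l n \<noteq> 0) sequentially"
    using tendsto_imp_eventually_ne[OF Qlim(1,2)] tendsto_imp_eventually_ne[OF \<open>l \<longlonglongrightarrow> \<mu>\<close> Qlim(2)] by auto
  then have "eventually (\<lambda>n. of_real m / l n = ((\<phi> (h * Q n) + \<i> * of_real (y n)) / \<phi> (Q n) - of_real x) / (\<i> * of_real (y n))) sequentially"
  proof eventually_elim
    case (elim n)
    have "\<i> * complex_of_real (y n) \<noteq> 0" using y[of n] by simp
    then show ?case using theta[OF elim(1)] elim(2) by (simp add: frac_eq_eq mult.commute)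
  qed
  moreover have "(\<lambda>n. of_real m / l n) \<longlonglongrightarrow> of_real m / \<mu>"
    by (intro tendsto_intros \<open>l \<longlonglongrightarrow> \<mu>\<close> Qlim(2))
  ultimately show ?thesis by (rule Lim_transform_eventually[rotated])
qed

section \<open>Atoms of the sum of a free pair\<close>

text \<open>The resolvent times \<open>i y\<close> approximates the spectral projection of the sum.
  In the limit, subordination with \<open>f = a'\<close> becomes equality in the Cauchy-Schwarz
  inequality for the projection and its image under \<open>a'\<close>, which makes it an
  eigenvector; the next order in \<open>y\<close> yields the masses.\<close>

lemma (in cstar_state) face_atoms:
  fixes \<mu>\<^sub>1 \<mu>\<^sub>2 :: "real \<Rightarrow> real"
  assumes fp: "free_pair \<phi> a\<^sub>1 a\<^sub>2" and adj: "adj a\<^sub>1 = a\<^sub>1" "adj a\<^sub>2 = a\<^sub>2"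
    and ps: "peak_seq \<phi> (a\<^sub>1 + a\<^sub>2) \<xi> M m" "m > 0"
    and m1: "\<And>x. \<exists>M. peak_seq \<phi> a\<^sub>1 x M (\<mu>\<^sub>1 x)" and m2: "\<And>x. \<exists>M. peak_seq \<phi> a\<^sub>2 x M (\<mu>\<^sub>2 x)"
  obtains \<xi>\<^sub>1 \<xi>\<^sub>2 where "\<xi>\<^sub>1 + \<xi>\<^sub>2 = \<xi>" "\<mu>\<^sub>1 \<xi>\<^sub>1 + \<mu>\<^sub>2 \<xi>\<^sub>2 = 1 + m"
    "(\<lambda>k. nrm ((a\<^sub>1 - of_real \<xi>\<^sub>1 *\<^sub>C 1) * poly_at (peak \<xi> M k) (a\<^sub>1 + a\<^sub>2))) \<longlonglongrightarrow> 0"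
    "(\<lambda>k. nrm ((a\<^sub>2 - of_real \<xi>\<^sub>2 *\<^sub>C 1) * poly_at (peak \<xi> M k) (a\<^sub>1 + a\<^sub>2))) \<longlonglongrightarrow> 0"
proof -
  interpret free_pair \<phi> a\<^sub>1 a\<^sub>2 by fact
  interpret P: peak_seq \<phi> "a\<^sub>1 + a\<^sub>2" \<xi> M m by fact
  let ?a = "a\<^sub>1 + a\<^sub>2" and ?A = "{a\<^sub>1, a\<^sub>2}"
  define y where "y n = 1 / real (Suc n)" for n
  have y: "y n > 0" for n by (simp add: y_def)
  have ylim: "y \<longlonglongrightarrow> 0" unfolding y_def using LIMSEQ_inverse_real_of_nat by (simp add: inverse_eq_divide)
  define z where "z n = Complex \<xi> (y n)" for n
  have "\<exists>R. R * (z n *\<^sub>C 1 - ?a) = 1 \<and> (z n *\<^sub>C 1 - ?a) * R = 1 \<and>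
    (\<forall>p. \<phi> R * (\<phi> (a\<^sub>1 * poly_at p a\<^sub>1 * R) + \<phi> (poly_at p a\<^sub>1)) = \<phi> (poly_at p a\<^sub>1 * R) * (\<phi> (a\<^sub>1 * R) + 1)) \<and>
    (\<forall>p. \<phi> R * (\<phi> (a\<^sub>2 * poly_at p a\<^sub>2 * R) + \<phi> (poly_at p a\<^sub>2)) = \<phi> (poly_at p a\<^sub>2 * R) * (\<phi> (a\<^sub>2 * R) + 1))" for n
    by (rule free_resolvent[OF fp adj y[of n], of \<xi>]) (auto simp: z_def)
  then obtain R where R: "\<And>n. R n * (z n *\<^sub>C 1 - ?a) = 1" "\<And>n. (z n *\<^sub>C 1 - ?a) * R n = 1"
    and id1: "\<And>n p. \<phi> (R n) * (\<phi> (a\<^sub>1 * poly_at p a\<^sub>1 * R n) + \<phi> (poly_at p a\<^sub>1)) = \<phi> (poly_at p a\<^sub>1 * R n) * (\<phi> (a\<^sub>1 * R n) + 1)"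
    and id2: "\<And>n p. \<phi> (R n) * (\<phi> (a\<^sub>2 * poly_at p a\<^sub>2 * R n) + \<phi> (poly_at p a\<^sub>2)) = \<phi> (poly_at p a\<^sub>2 * R n) * (\<phi> (a\<^sub>2 * R n) + 1)"
    by metis
  define b where "b = ?a - of_real \<xi> *\<^sub>C 1"
  have b: "adj b = b" unfolding b_def by (rule adj_sub[OF P.selfadj])
  define w where "w n = \<i> * complex_of_real (y n)" for n
  have zb: "z n *\<^sub>C 1 - ?a = w n *\<^sub>C 1 - b" for n
    by (simp add: z_def b_def w_def Complex_eq scaleC_add_left algebra_simps)
  note R = R[unfolded zb]
  define Q where "Q n = w n *\<^sub>C R n" for n
  \<comment> \<open>The mixed terms cancel, as \<open>w n\<close> is purely imaginary and
    \<open>b\<close> selfadjoint.\<close>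
  have expand: "(nrm ((w n *\<^sub>C 1 - b) * v))\<^sup>2 = (nrm (b * v))\<^sup>2 + (y n * nrm v)\<^sup>2" for n v
  proof -
    have "adj ((w n *\<^sub>C 1 - b) * v) * ((w n *\<^sub>C 1 - b) * v) =
        adj (b * v) * (b * v) + complex_of_real ((y n)\<^sup>2) *\<^sub>C (adj v * v)"
      by (simp add: adj_mult adj_diff adj_scaleC b w_def left_diff_distrib right_diff_distrib mult_scaleC
          scaleC_scaleC cvec.scale_minus_left mult.assoc power2_eq_square distrib_left distrib_right algebra_simps)
    then show ?thesis by (simp add: nrm_sq_Re linD power_mult_distrib)
  qed
  have R_bound: "y n * nrm (R n * v) \<le> nrm v" "nrm (b * (R n * v)) \<le> nrm v" for n v
  proof -
    have "(w n *\<^sub>C 1 - b) * (R n * v) = v" using R(2)[of n] by (simp flip: mult.assoc)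
    then have "(nrm v)\<^sup>2 = (nrm (b * (R n * v)))\<^sup>2 + (y n * nrm (R n * v))\<^sup>2" using expand[of n "R n * v"] by simp
    then have "(y n * nrm (R n * v))\<^sup>2 \<le> (nrm v)\<^sup>2" and 2: "(nrm (b * (R n * v)))\<^sup>2 \<le> (nrm v)\<^sup>2" by simp_all
    then show "y n * nrm (R n * v) \<le> nrm v" by (intro power2_le_imp_le[of "y n * nrm (R n * v)"]) auto
    from 2 show "nrm (b * (R n * v)) \<le> nrm v" by (rule power2_le_imp_le) simp
  qed
  have bR: "b * R n = w n *\<^sub>C R n - 1" "R n * b = w n *\<^sub>C R n - 1" for n
    using R[of n] by (simp_all add: left_diff_distrib right_diff_distrib mult_scaleC algebra_simps)
  have Q_le: "nrm (Q n * v) \<le> nrm v" for n v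
    using R_bound(1)[of n v] y[of n] by (simp add: Q_def mult_scaleC nrm_scale w_def norm_mult)
  have Q_sub: "1 - Q n = - (R n * b)" for n by (simp add: Q_def bR)
  \<comment> \<open>Peaks \<open>P j\<close> with \<open>j\<close> tending to infinity mediate
    between \<open>Q n\<close> and \<open>P k\<close>: the factor \<open>1 / y n\<close> does no
    harm, since \<open>n\<close> is fixed while \<open>b * P j\<close> tends to 0. On
    \<open>1 - P k\<close>, which has the factor \<open>b\<close>, the element \<open>Q n\<close> is
    of order \<open>y n\<close>.\<close>
  have approx: "\<exists>G. \<forall>n. nrm (Q n - P.P k) \<le> y n * G + 2 * P.e k" for k
  proof -
    obtain p where p: "1 - P.P k = poly_at p ?a * b" using P.one_minus_P unfolding b_def by blast
    have "b = poly_at [:- of_real \<xi>, 1:] ?a" by (simp only: b_def poly_at_linear_of_real)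
    then have p: "1 - P.P k = b * poly_at p ?a" using p poly_at_commute by metis
    have "nrm (Q n - P.P k) \<le> y n * nrm (poly_at p ?a) + 2 * P.e k" for n
    proof (rule LIMSEQ_le)
      show "(\<lambda>j. nrm (Q n - P.P k)) \<longlonglongrightarrow> nrm (Q n - P.P k)" by simp
      show "(\<lambda>j. y n * nrm (poly_at p ?a) + 2 * nrm (P.P k - P.P j) + (1 / y n) * nrm (b * P.P j)) \<longlonglongrightarrow>
          y n * nrm (poly_at p ?a) + 2 * P.e k"
        using tendsto_add[OF tendsto_add[OF tendsto_const tendsto_mult[OF tendsto_const P.nrm_diff_lim_e[of k]]]
            tendsto_mult[OF tendsto_const P.residual_lim], of "y n * nrm (poly_at p ?a)" 2 "1 / y n"]
        by (simp add: b_def P.P_def)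
      have "nrm (Q n - P.P k) \<le> y n * nrm (poly_at p ?a) + 2 * nrm (P.P k - P.P j) + (1 / y n) * nrm (b * P.P j)" for j
      proof -
        have eq: "Q n - P.P k = (Q n * (b * poly_at p ?a) + Q n * (P.P k - P.P j)) + (R n * (b * P.P j) - (P.P k - P.P j))"
        proof -
          have "R n * (b * P.P j) = - ((1 - Q n) * P.P j)" by (simp add: Q_sub mult.assoc)
          then show ?thesis unfolding p[symmetric] by (simp add: algebra_simps)
        qed
        have "nrm (Q n * (b * poly_at p ?a)) = y n * nrm (R n * b * poly_at p ?a)"
          using y[of n] by (simp add: Q_def mult_scaleC nrm_scale w_def norm_mult mult.assoc)
        also have "R n * b * poly_at p ?a = b * (R n * poly_at p ?a)"
          by (simp only: bR flip: mult.assoc)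
        also have "y n * nrm (b * (R n * poly_at p ?a)) \<le> y n * nrm (poly_at p ?a)"
          using R_bound(2) y[of n] by (intro mult_left_mono) auto
        finally have 1: "nrm (Q n * (b * poly_at p ?a)) \<le> y n * nrm (poly_at p ?a)" .
        have 2: "nrm (Q n * (P.P k - P.P j)) \<le> nrm (P.P k - P.P j)" by (rule Q_le)
        have 3: "nrm (R n * (b * P.P j)) \<le> (1 / y n) * nrm (b * P.P j)"
          using R_bound(1)[of n "b * P.P j"] y[of n] by (simp add: field_simps)
        show ?thesis
          unfolding eq
          using nrm_triangle[of "Q n * (b * poly_at p ?a) + Q n * (P.P k - P.P j)" "R n * (b * P.P j) - (P.P k - P.P j)"]
            nrm_triangle[of "Q n * (b * poly_at p ?a)" "Q n * (P.P k - P.P j)"]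
            nrm_diff[of "R n * (b * P.P j)" "P.P k - P.P j"] 1 2 3 by linarith
      qed
      then show "\<exists>N. \<forall>j\<ge>N. nrm (Q n - P.P k) \<le> y n * nrm (poly_at p ?a) + 2 * nrm (P.P k - P.P j) + (1 / y n) * nrm (b * P.P j)"
        by blast
    qed
    then show ?thesis by blast
  qed
  have Q_lim: "(\<lambda>n. \<phi> (v * Q n)) \<longlonglongrightarrow> l" if l: "(\<lambda>k. \<phi> (v * P.P k)) \<longlonglongrightarrow> l" for v l
  proof -
    obtain G where G: "\<And>n k. nrm (Q n - P.P k) \<le> y n * G k + 2 * P.e k" using approx by metis
    obtain l' where l': "(\<lambda>k. \<phi> (v * P.P k)) \<longlonglongrightarrow> l'" "\<And>k. cmod (\<phi> (v * P.P k) - l') \<le> nrm (adj v) * P.e k"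
      by (rule P.functional_limit[of v]) blast
    have "l' = l" using LIMSEQ_unique[OF l'(1) l] .
    show ?thesis
    proof (rule limit_from_eventual_bound[where s = "\<lambda>n k. nrm (adj v) * (y n * G k)" and e = "\<lambda>k. nrm (adj v) * (3 * P.e k)"])
      show "(\<lambda>k. nrm (adj v) * (3 * P.e k)) \<longlonglongrightarrow> 0" using tendsto_mult_right_zero[OF tendsto_mult_right_zero[OF P.e_lim]] by blast
      show "(\<lambda>n. nrm (adj v) * (y n * G k)) \<longlonglongrightarrow> 0" for k
        using tendsto_mult_right_zero[OF tendsto_mult_left_zero[OF ylim]] by blast
      fix k n
      have "\<phi> (v * Q n) - l = \<phi> (v * (Q n - P.P k)) + (\<phi> (v * P.P k) - l)" by (simp add: right_diff_distrib linD)
      then have "cmod (\<phi> (v * Q n) - l) \<le> cmod (\<phi> (v * (Q n - P.P k))) + cmod (\<phi> (v * P.P k) - l)"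
        by (simp only: norm_triangle_ineq)
      also have "cmod (\<phi> (v * (Q n - P.P k))) \<le> nrm (adj v) * (y n * G k + 2 * P.e k)"
        by (rule order_trans[OF cauchy_schwarz' mult_left_mono[OF G nrm_nonneg]])
      also have "cmod (\<phi> (v * P.P k) - l) \<le> nrm (adj v) * P.e k" using l'(2) \<open>l' = l\<close> by simp
      finally show "cmod (\<phi> (v * Q n) - l) \<le> nrm (adj v) * (y n * G k) + nrm (adj v) * (3 * P.e k)"
        by (simp add: algebra_simps)
    qed
  qed
  have Pm: "(\<lambda>k. \<phi> (P.P k)) \<longlonglongrightarrow> of_real m" using P.lim by (simp add: P.P_def)
  have Qm: "(\<lambda>n. \<phi> (Q n)) \<longlonglongrightarrow> of_real m" using Q_lim[of 1] Pm by simp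
  have wlim: "w \<longlonglongrightarrow> 0"
    using tendsto_mult[OF tendsto_const[of \<i>] tendsto_of_real[OF ylim]] by (simp add: w_def[abs_def])
  have w0: "w n \<noteq> 0" for n using y[of n] by (simp add: w_def)
  have Palg: "P.P k \<in> gen_alg ?A" for k
    unfolding P.P_def by (intro gen_alg_poly_at gen_alg.add gen_alg_gen) auto
  have side: "\<exists>\<xi>'. (\<lambda>k. \<phi> (a' * P.P k)) \<longlonglongrightarrow> of_real (\<xi>' * m) \<and>
      (\<lambda>k. nrm ((a' - of_real \<xi>' *\<^sub>C 1) * P.P k)) \<longlonglongrightarrow> 0 \<and>
      (\<lambda>n. ((\<phi> (a' * Q n) + w n) / \<phi> (Q n) - of_real \<xi>') / w n) \<longlonglongrightarrow> of_real (\<mu>' \<xi>') / of_real m"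
    if a': "a' \<in> ?A" and m': "\<And>x. \<exists>M. peak_seq \<phi> a' x M (\<mu>' x)"
      and idR: "\<And>n p. \<phi> (R n) * (\<phi> (a' * poly_at p a' * R n) + \<phi> (poly_at p a')) = \<phi> (poly_at p a' * R n) * (\<phi> (a' * R n) + 1)"
    for a' \<mu>'
  proof -
    have sa: "adj a' = a'" using a' adj by auto
    have alg: "a' \<in> gen_alg ?A" using a' by (rule gen_alg_gen)
    have id: "\<phi> (Q n) * (\<phi> (a' * f * Q n) + w n * \<phi> f) = \<phi> (f * Q n) * (\<phi> (a' * Q n) + w n)"
      if "f = poly_at p a'" for n f p
    proof -
      have "w n * (w n * (\<phi> (R n) * (\<phi> (a' * f * R n) + \<phi> f))) = w n * (w n * (\<phi> (f * R n) * (\<phi> (a' * R n) + 1)))"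
        by (simp only: that idR)
      then show ?thesis by (simp add: Q_def mult_scaleC linD algebra_simps)
    qed
    obtain l1 where l1: "(\<lambda>k. \<phi> (a' * P.P k)) \<longlonglongrightarrow> l1" by (rule P.functional_limit)
    obtain l2 where l2: "(\<lambda>k. \<phi> (a' * a' * P.P k)) \<longlonglongrightarrow> l2" by (rule P.functional_limit)
    have "a' = poly_at [:0, 1:] a'" by (simp add: poly_at_linear)
    note id' = id[OF this]
    \<comment> \<open>In the limit \<open>m * \<phi>(a' a' P) = \<phi>(a' P)\<^sup>2\<close>; as
      \<open>m\<close> is the squared norm of \<open>P\<close>, this is equality in
      Cauchy-Schwarz.\<close>
    have "(\<lambda>n. \<phi> (Q n) * (\<phi> (a' * a' * Q n) + w n * \<phi> a')) \<longlonglongrightarrow> of_real m * (l2 + 0 * \<phi> a')"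
      by (intro tendsto_intros Qm Q_lim l2 wlim)
    moreover have "(\<lambda>n. \<phi> (a' * Q n) * (\<phi> (a' * Q n) + w n)) \<longlonglongrightarrow> l1 * (l1 + 0)"
      by (intro tendsto_intros Q_lim l1 wlim)
    ultimately have sq: "of_real m * l2 = l1 * l1"
      using LIMSEQ_unique by (simp add: id') blast
    \<comment> \<open>The candidate eigenvalue is real because both factors are selfadjoint and
      \<phi> is tracial on the algebra they generate.\<close>
    have "cnj (\<phi> (a' * P.P k)) = \<phi> (a' * P.P k)" for k
      using adj_eq[of "a' * P.P k"] trace[OF alg Palg[of k]] by (simp add: adj_mult sa P.adj_P)
    then have "(\<lambda>k. \<phi> (a' * P.P k)) \<longlonglongrightarrow> cnj l1" using tendsto_cnj[OF l1] by simp
    then have "cnj l1 = l1" using l1 by (rule LIMSEQ_unique)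
    then have l1r: "l1 = of_real (Re l1)" by (simp add: complex_eq_iff)
    define \<xi>' where "\<xi>' = Re l1 / m"
    have l1x: "l1 = of_real (\<xi>' * m)" using l1r ps(2) by (simp add: \<xi>'_def)
    have l2x: "l2 = of_real (\<xi>' * \<xi>' * m)"
    proof -
      have "of_real m * l2 = of_real m * complex_of_real (\<xi>' * \<xi>' * m)" unfolding sq l1x by simp
      then show ?thesis using ps(2) by simp
    qed
    let ?d = "a' - of_real \<xi>' *\<^sub>C 1"
    have dalg: "?d \<in> gen_alg ?A"
    proof -
      have "poly_at [:- of_real \<xi>', 1:] a' \<in> gen_alg ?A" by (rule gen_alg_poly_at[OF alg])
      then show ?thesis by (simp only: poly_at_linear_of_real)
    qed
    have dd: "?d * ?d = a' * a' - (2 * of_real \<xi>') *\<^sub>C a' + (of_real (\<xi>' * \<xi>')) *\<^sub>C 1"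
      by (simp add: left_diff_distrib right_diff_distrib mult_scaleC scaleC_scaleC scaleC_add_left[of 1 1, simplified]
          cvec.scale_left_distrib[symmetric] algebra_simps)
    have "(\<lambda>k. \<phi> (?d * ?d * P.P (k + k))) \<longlonglongrightarrow> 0"
    proof -
      have "(\<lambda>k. \<phi> (a' * a' * P.P k) - 2 * of_real \<xi>' * \<phi> (a' * P.P k) + of_real (\<xi>' * \<xi>') * \<phi> (P.P k)) \<longlonglongrightarrow>
          l2 - 2 * of_real \<xi>' * l1 + of_real (\<xi>' * \<xi>') * of_real m"
        by (intro tendsto_intros l1 l2 Pm)
      also have "l2 - 2 * of_real \<xi>' * l1 + of_real (\<xi>' * \<xi>') * of_real m = 0" by (simp add: l1x l2x)
      finally have "(\<lambda>k. \<phi> (?d * ?d * P.P k)) \<longlonglongrightarrow> 0"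
        unfolding dd by (simp add: distrib_right left_diff_distrib mult_scaleC linD)
      then show ?thesis
        by (rule filterlim_compose) (rule filterlim_at_top_mono[OF filterlim_ident], simp)
    qed
    \<comment> \<open>The trace property merges the two peaks, so the squared norm is a value of
      \<phi> at \<open>?d * ?d\<close> times one peak.\<close>
    moreover have "(nrm (?d * P.P k))\<^sup>2 = Re (\<phi> (?d * ?d * P.P (k + k)))" for k
    proof -
      have "(nrm (?d * P.P k))\<^sup>2 = Re (\<phi> (P.P k * (?d * (?d * P.P k))))"
        by (simp add: nrm_sq_Re adj_mult P.adj_P adj_sub[OF sa] mult.assoc)
      also have "\<phi> (P.P k * (?d * (?d * P.P k))) = \<phi> ((?d * (?d * P.P k)) * P.P k)"
        by (rule trace[OF Palg gen_alg_mult[OF dalg gen_alg_mult[OF dalg Palg]]])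
      finally show ?thesis by (simp add: mult.assoc P.P_mult)
    qed
    ultimately have "(\<lambda>k. sqrt ((nrm (?d * P.P k))\<^sup>2)) \<longlonglongrightarrow> sqrt 0"
      by (intro tendsto_real_sqrt) (auto dest: tendsto_Re)
    then have res: "(\<lambda>k. nrm (?d * P.P k)) \<longlonglongrightarrow> 0" by simp
    obtain M' where "peak_seq \<phi> a' \<xi>' M' (\<mu>' \<xi>')" using m' by blast
    then interpret P': peak_seq \<phi> a' \<xi>' M' "\<mu>' \<xi>'" .
    have "(\<lambda>n. ((\<phi> (a' * Q n) + \<i> * of_real (y n)) / \<phi> (Q n) - of_real \<xi>') / (\<i> * of_real (y n))) \<longlonglongrightarrow> of_real (\<mu>' \<xi>') / of_real m"
    proof (rule P'.first_order[OF id[unfolded w_def] y _ Qm])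
      show "nrm (Q n) \<le> 1" for n using Q_le[of n 1] by simp
      show "complex_of_real m \<noteq> 0" using ps(2) by simp
      fix g
      have "(\<lambda>k. \<phi> (poly_at g a' * ?d * P.P k)) \<longlonglongrightarrow> 0"
      proof (rule Lim_null_comparison)
        show "\<forall>\<^sub>F k in sequentially. cmod (\<phi> (poly_at g a' * ?d * P.P k)) \<le> nrm (adj (poly_at g a')) * nrm (?d * P.P k)"
          using cauchy_schwarz'[of "poly_at g a'"] by (simp add: mult.assoc)
        show "(\<lambda>k. nrm (adj (poly_at g a')) * nrm (?d * P.P k)) \<longlonglongrightarrow> 0" by (rule tendsto_mult_right_zero[OF res])
      qed
      then show "(\<lambda>n. \<phi> (poly_at g a' * ?d * Q n)) \<longlonglongrightarrow> 0" by (rule Q_lim)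
    qed
    with l1 res show ?thesis unfolding l1x w_def by blast
  qed
  obtain \<xi>\<^sub>1 where x1: "(\<lambda>k. \<phi> (a\<^sub>1 * P.P k)) \<longlonglongrightarrow> of_real (\<xi>\<^sub>1 * m)"
      "(\<lambda>k. nrm ((a\<^sub>1 - of_real \<xi>\<^sub>1 *\<^sub>C 1) * P.P k)) \<longlonglongrightarrow> 0"
      "(\<lambda>n. ((\<phi> (a\<^sub>1 * Q n) + w n) / \<phi> (Q n) - of_real \<xi>\<^sub>1) / w n) \<longlonglongrightarrow> of_real (\<mu>\<^sub>1 \<xi>\<^sub>1) / of_real m"
    using side[of a\<^sub>1 \<mu>\<^sub>1, OF _ m1 id1] by blast
  obtain \<xi>\<^sub>2 where x2: "(\<lambda>k. \<phi> (a\<^sub>2 * P.P k)) \<longlonglongrightarrow> of_real (\<xi>\<^sub>2 * m)"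
      "(\<lambda>k. nrm ((a\<^sub>2 - of_real \<xi>\<^sub>2 *\<^sub>C 1) * P.P k)) \<longlonglongrightarrow> 0"
      "(\<lambda>n. ((\<phi> (a\<^sub>2 * Q n) + w n) / \<phi> (Q n) - of_real \<xi>\<^sub>2) / w n) \<longlonglongrightarrow> of_real (\<mu>\<^sub>2 \<xi>\<^sub>2) / of_real m"
    using side[of a\<^sub>2 \<mu>\<^sub>2, OF _ m2 id2] by blast
  have sum: "\<xi>\<^sub>1 + \<xi>\<^sub>2 = \<xi>"
  proof -
    have "(\<lambda>k. \<phi> (1 * (b * P.P k))) \<longlonglongrightarrow> 0"
    proof (rule Lim_null_comparison[OF _ P.residual_lim])
      show "\<forall>\<^sub>F k in sequentially. cmod (\<phi> (1 * (b * P.P k))) \<le> nrm ((?a - of_real \<xi> *\<^sub>C 1) * P.P k)"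
        using norm_le_nrm by (simp add: b_def)
    qed
    moreover have "(\<lambda>k. \<phi> (a\<^sub>1 * P.P k) + \<phi> (a\<^sub>2 * P.P k) - of_real \<xi> * \<phi> (P.P k)) \<longlonglongrightarrow> of_real (\<xi>\<^sub>1 * m) + of_real (\<xi>\<^sub>2 * m) - of_real \<xi> * of_real m"
      by (intro tendsto_intros x1 x2 Pm)
    moreover have "\<phi> (1 * (b * P.P k)) = \<phi> (a\<^sub>1 * P.P k) + \<phi> (a\<^sub>2 * P.P k) - of_real \<xi> * \<phi> (P.P k)" for k
      by (simp add: b_def distrib_right left_diff_distrib mult_scaleC linD)
    ultimately have "(\<lambda>k. \<phi> (a\<^sub>1 * P.P k) + \<phi> (a\<^sub>2 * P.P k) - of_real \<xi> * \<phi> (P.P k)) \<longlonglongrightarrow> 0"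
      and "(\<lambda>k. \<phi> (a\<^sub>1 * P.P k) + \<phi> (a\<^sub>2 * P.P k) - of_real \<xi> * \<phi> (P.P k)) \<longlonglongrightarrow> of_real (\<xi>\<^sub>1 * m) + of_real (\<xi>\<^sub>2 * m) - of_real \<xi> * of_real m"
      by simp_all
    then have "0 = complex_of_real (\<xi>\<^sub>1 * m) + of_real (\<xi>\<^sub>2 * m) - of_real \<xi> * of_real m"
      by (rule LIMSEQ_unique)
    then have "complex_of_real ((\<xi>\<^sub>1 + \<xi>\<^sub>2 - \<xi>) * m) = 0" by (simp add: algebra_simps)
    then show ?thesis using ps(2) by (simp only: of_real_eq_0_iff mult_eq_0_iff) simp
  qed
  have "\<mu>\<^sub>1 \<xi>\<^sub>1 + \<mu>\<^sub>2 \<xi>\<^sub>2 = 1 + m"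
  proof -
    have m0: "complex_of_real m \<noteq> 0" using ps(2) by simp
    \<comment> \<open>The relation
      \<open>\<omega>\<^sub>1 + \<omega>\<^sub>2 = z + 1 / \<phi>(R)\<close>, after subtracting
      \<open>\<xi>\<^sub>1 + \<xi>\<^sub>2 = \<xi>\<close> and dividing by
      \<open>w n\<close>.\<close>
    have "eventually (\<lambda>n. 1 + 1 / \<phi> (Q n) = ((\<phi> (a\<^sub>1 * Q n) + w n) / \<phi> (Q n) - of_real \<xi>\<^sub>1) / w n +
        ((\<phi> (a\<^sub>2 * Q n) + w n) / \<phi> (Q n) - of_real \<xi>\<^sub>2) / w n) sequentially"
      using tendsto_imp_eventually_ne[OF Qm m0]
    proof eventually_elim
      case (elim n)
      have "b * Q n = w n *\<^sub>C Q n - w n *\<^sub>C 1"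
        by (simp add: Q_def mult_scaleC bR cvec.scale_right_diff_distrib scaleC_scaleC)
      then have "\<phi> (b * Q n) = w n * \<phi> (Q n) - w n" by (simp add: linD one)
      moreover have "\<phi> (b * Q n) = \<phi> (a\<^sub>1 * Q n) + \<phi> (a\<^sub>2 * Q n) - (of_real \<xi>\<^sub>1 + of_real \<xi>\<^sub>2) * \<phi> (Q n)"
        by (simp add: b_def distrib_right left_diff_distrib mult_scaleC linD flip: sum)
      ultimately have key: "\<phi> (a\<^sub>1 * Q n) + \<phi> (a\<^sub>2 * Q n) = (w n + of_real \<xi>\<^sub>1 + of_real \<xi>\<^sub>2) * \<phi> (Q n) - w n"
        by (simp add: algebra_simps)
      have "((\<phi> (a\<^sub>1 * Q n) + w n) / \<phi> (Q n) - of_real \<xi>\<^sub>1) / w n + ((\<phi> (a\<^sub>2 * Q n) + w n) / \<phi> (Q n) - of_real \<xi>\<^sub>2) / w n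
        = ((\<phi> (a\<^sub>1 * Q n) + \<phi> (a\<^sub>2 * Q n) + 2 * w n) / \<phi> (Q n) - of_real \<xi>\<^sub>1 - of_real \<xi>\<^sub>2) / w n"
        by (simp add: add_divide_distrib diff_divide_distrib)
      also have "\<dots> = 1 + 1 / \<phi> (Q n)"
        unfolding key using elim w0[of n] by (simp add: field_simps)
      finally show ?case ..
    qed
    from Lim_transform_eventually[OF _ this] tendsto_add[OF tendsto_const tendsto_divide[OF tendsto_const Qm m0]]
    have "(\<lambda>n. ((\<phi> (a\<^sub>1 * Q n) + w n) / \<phi> (Q n) - of_real \<xi>\<^sub>1) / w n +
        ((\<phi> (a\<^sub>2 * Q n) + w n) / \<phi> (Q n) - of_real \<xi>\<^sub>2) / w n) \<longlonglongrightarrow> 1 + 1 / of_real m" by blast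
    from LIMSEQ_unique[OF this tendsto_add[OF x1(3) x2(3)]]
    have "complex_of_real (1 + m) = complex_of_real (\<mu>\<^sub>1 \<xi>\<^sub>1 + \<mu>\<^sub>2 \<xi>\<^sub>2)" using m0 by (simp add: field_simps)
    then show ?thesis by (simp only: of_real_eq_iff)
  qed
  with sum x1(2) x2(2) show thesis using that unfolding P.P_def by blast
qed

section \<open>Alternating geometric series\<close>

lemma adj_suf: "adj y = y \<Longrightarrow> adj y' = y' \<Longrightarrow> adj (suf y y' n) = pre y y' (n :: nat)"
  for y y' :: "'a::cstar_algebra"
  by (induction y y' n rule: suf.induct) (simp_all add: adj_mult adj_add)

lemma pre_tendsto:
  fixes f g :: "nat \<Rightarrow> 'b::{real_normed_algebra_1}"
  shows "f \<longlonglongrightarrow> x \<Longrightarrow> g \<longlonglongrightarrow> x' \<Longrightarrow> (\<lambda>n. pre (f n) (g n) N) \<longlonglongrightarrow> pre x x' N"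
  by (induction N arbitrary: f g x x') (auto intro!: tendsto_intros)

lemma pre_of_real: "pre (of_real x) (of_real x') N = (of_real (pre x x' N) :: complex)"
  by (induction x x' N rule: pre.induct) simp_all

definition alt_sum :: "'b::ring_1 \<Rightarrow> 'b \<Rightarrow> nat \<Rightarrow> 'b"
  where "alt_sum x x' N = 1 + pre x x' N + pre x' x N"

lemma alt_sum_of_real: "alt_sum (of_real x) (of_real x') N = (of_real (alt_sum x x' N) :: complex)"
  by (simp add: alt_sum_def pre_of_real)

lemma alt_sum_tendsto:
  fixes f g :: "nat \<Rightarrow> 'b::{real_normed_algebra_1}"
  assumes "f \<longlonglongrightarrow> x" "g \<longlonglongrightarrow> x'"
  shows "(\<lambda>n. alt_sum (f n) (g n) N) \<longlonglongrightarrow> alt_sum x x' N"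
  unfolding alt_sum_def by (intro tendsto_intros pre_tendsto assms)

text \<open>Only the product of the two ratios is small, not each of them, so the recursion
  contracts over two steps: even indices converge geometrically, and the odd ones follow by one more
  step.\<close>

lemma pre_closed_form:
  fixes x x' :: real
  assumes "\<bar>x * x'\<bar> < 1"
  shows "(\<lambda>N. pre x x' N) \<longlonglongrightarrow> x * (1 + x') / (1 - x * x')"
proof -
  define L where "L u v = u * (1 + v) / (1 - u * v)" for u v :: real
  have nz: "1 - x * x' \<noteq> 0" using assms by auto
  have fix_eq: "L u v = u * (1 + L v u)" if "u * v = x * x'" for u v
  proof -
    have "1 - u * v \<noteq> 0" "1 - v * u \<noteq> 0" using nz that by (simp_all add: mult.commute)
    then show ?thesis by (simp add: L_def field_simps)
  qed
  have "\<bar>pre u v (N + N) - L u v\<bar> \<le> \<bar>x * x'\<bar> ^ N * \<bar>L u v\<bar>" if uv: "u * v = x * x'" for u v N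
  proof (induction N)
    case (Suc N)
    have "L u v = u * (1 + v * (1 + L u v))"
      using fix_eq[OF uv] fix_eq[of v u] uv by (simp add: mult.commute)
    then have "pre u v (Suc N + Suc N) - L u v = (u * v) * (pre u v (N + N) - L u v)"
      by (simp add: algebra_simps)
    then have "\<bar>pre u v (Suc N + Suc N) - L u v\<bar> = \<bar>x * x'\<bar> * \<bar>pre u v (N + N) - L u v\<bar>"
      by (simp only: uv abs_mult)
    also have "\<dots> \<le> \<bar>x * x'\<bar> * (\<bar>x * x'\<bar> ^ N * \<bar>L u v\<bar>)" by (rule mult_left_mono[OF Suc]) simp
    finally show ?case by simp
  qed simp
  then have even: "(\<lambda>N. pre u v (N + N)) \<longlonglongrightarrow> L u v" if "u * v = x * x'" for u v
  proof -
    have "(\<lambda>N. \<bar>x * x'\<bar> ^ N * \<bar>L u v\<bar>) \<longlonglongrightarrow> 0"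
      using tendsto_mult_left_zero[OF LIMSEQ_power_zero[of "\<bar>x * x'\<bar>"]] assms by simp
    then have "(\<lambda>N. pre u v (N + N) - L u v) \<longlonglongrightarrow> 0"
      by (rule Lim_null_comparison[rotated]) (use \<open>\<And>u v N. u * v = x * x' \<Longrightarrow> \<bar>pre u v (N + N) - L u v\<bar> \<le> \<bar>x * x'\<bar> ^ N * \<bar>L u v\<bar>\<close>[OF that] in simp)
    then show ?thesis by (simp add: LIM_zero_cancel)
  qed
  have odd: "(\<lambda>N. pre x x' (Suc (N + N))) \<longlonglongrightarrow> L x x'"
  proof -
    have "(\<lambda>N. x * (1 + pre x' x (N + N))) \<longlonglongrightarrow> x * (1 + L x' x)"
      by (intro tendsto_intros even) (simp add: mult.commute)
    then show ?thesis using fix_eq[of x x'] by simp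
  qed
  show ?thesis
    using limseq_even_odd[of "\<lambda>N. pre x x' N" "L x x'"] even[of x x'] odd
    by (simp add: L_def mult_2)
qed

lemma alt_sum_closed_form:
  fixes x x' :: real
  assumes "\<bar>x * x'\<bar> < 1"
  shows "(\<lambda>N. alt_sum x x' N) \<longlonglongrightarrow> (1 + x) * (1 + x') / (1 - x * x')"
proof -
  have "(\<lambda>N. alt_sum x x' N) \<longlonglongrightarrow> 1 + x * (1 + x') / (1 - x * x') + x' * (1 + x) / (1 - x' * x)"
    unfolding alt_sum_def
    by (intro tendsto_intros pre_closed_form) (use assms in \<open>simp_all add: mult.commute\<close>)
  also have "1 + x * (1 + x') / (1 - x * x') + x' * (1 + x) / (1 - x' * x) =
      ((1 - x * x') + x * (1 + x') + x' * (1 + x)) / (1 - x * x')"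
  proof -
    have "1 - x * x' \<noteq> 0" using assms by auto
    then show ?thesis by (simp add: add_divide_distrib mult.commute[of x' x])
  qed
  also have "(1 - x * x') + x * (1 + x') + x' * (1 + x) = (1 + x) * (1 + x')" by (simp add: algebra_simps)
  finally show ?thesis .
qed

lemma gen_alg_adj:
  assumes "x \<in> gen_alg A" "\<And>g. g \<in> A \<Longrightarrow> adj g = g"
  shows "adj x \<in> gen_alg A"
  using assms(1)
proof (induction rule: gen_alg.induct)
  case (gmult g x)
  then show ?case by (simp add: adj_mult assms(2) gen_alg_mult gen_alg_gen)
qed (auto simp: adj_add adj_scaleC intro: gen_alg.intros)

lemma gen_alg_diff: "x \<in> gen_alg A \<Longrightarrow> y \<in> gen_alg A \<Longrightarrow> x - y \<in> gen_alg A"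
  using gen_alg.add[OF _ gen_alg.scale[of y A "- 1"], of x] by (simp add: cvec.scale_minus_left scaleC_one)

lemma gen_alg_suf: "y \<in> gen_alg A \<Longrightarrow> y' \<in> gen_alg A \<Longrightarrow> suf y y' n \<in> gen_alg A"
proof (induction y y' n rule: suf.induct)
  case (1 y y')
  then show ?case using gen_alg_diff[OF gen_alg.one gen_alg.one] by simp
qed (auto intro: gen_alg_mult gen_alg.add gen_alg.one)

text \<open>On a face the trace property makes the adjoint isometric, so estimates in
  \<open>nrm\<close> also serve for the left factor in the Cauchy-Schwarz inequality.\<close>

lemma (in cstar_state) nrm_adj:
  assumes "free_pair \<phi> a\<^sub>1 a\<^sub>2" "adj a\<^sub>1 = a\<^sub>1" "adj a\<^sub>2 = a\<^sub>2" "x \<in> gen_alg {a\<^sub>1, a\<^sub>2}"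
  shows "nrm (adj x) = nrm x"
proof -
  have "adj x \<in> gen_alg {a\<^sub>1, a\<^sub>2}" by (rule gen_alg_adj[OF assms(4)]) (use assms in auto)
  then have "\<phi> (x * adj x) = \<phi> (adj x * x)" by (rule free_pair.trace[OF assms(1,4)])
  then show ?thesis by (simp add: nrm_def adj_adj)
qed

section \<open>Centred approximations of spectral projections\<close>

text \<open>The polynomial version of \<open>P\<^sub>j / m\<^sub>j - 1\<close>. Dividing by the
  value of \<phi> at the peak, not by the limit of these values, makes the element centred exactly,
  as the pairing identities demand.\<close>

definition (in cstar_state) centred :: "real \<Rightarrow> real \<Rightarrow> nat \<Rightarrow> 'a \<Rightarrow> 'a"
  where "centred x M n a = (1 / \<phi> (poly_at (peak x M n) a)) *\<^sub>C poly_at (peak x M n) a - 1"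

context peak_seq
begin

abbreviation "C n \<equiv> centred x M n h"

lemma C_eq: "C n = complex_of_real (1 / c n) *\<^sub>C P n - 1"
  by (simp add: centred_def phi_P flip: P_def)

lemma C_poly: "C n = poly_at (smult (1 / \<phi> (P n)) (peak x M n) - 1) h"
  by (simp add: centred_def poly_at_diff poly_at_smult P_def)

lemma adj_C: "adj (C n) = C n"
  by (simp add: C_eq adj_diff adj_scaleC adj_P)

lemma phi_C: "c n \<noteq> 0 \<Longrightarrow> \<phi> (C n) = 0"
  by (simp add: C_eq linD phi_P one)

lemma phi_C_mult:
  assumes "peak_seq \<phi> h' x' M' m'" "c n \<noteq> 0" "peak_seq.c \<phi> h' x' M' n \<noteq> 0"
  shows "\<phi> (C n * centred x' M' n h') =
    \<phi> (P n * peak_seq.P h' x' M' n) / of_real (c n * peak_seq.c \<phi> h' x' M' n) - 1"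
proof -
  interpret P': peak_seq \<phi> h' x' M' m' by fact
  show ?thesis using assms(2,3)
    by (simp add: C_eq P'.C_eq left_diff_distrib right_diff_distrib mult_scaleC linD phi_P P'.phi_P one)
qed

text \<open>For an exact projection of trace \<open>m\<close> this would be
  \<open>1 / m - 1\<close>.\<close>

definition "bet n = (nrm (C n))\<^sup>2"

lemma phi_C_sq: "\<phi> (C n * C n) = of_real (bet n)"
  using nrm_sq[of "C n"] by (simp add: bet_def adj_C)

lemma bet_eq: "c n \<noteq> 0 \<Longrightarrow> bet n = c (n + n) / (c n)\<^sup>2 - 1"
proof -
  assume "c n \<noteq> 0"
  from phi_C_mult[OF peak_seq_axioms this this]
  have "complex_of_real (bet n) = of_real (c (n + n) / (c n)\<^sup>2 - 1)"
    by (simp add: phi_C_sq P_mult phi_P power2_eq_square)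
  then show ?thesis by (simp only: of_real_eq_iff)
qed

lemma c_ev: "m \<noteq> 0 \<Longrightarrow> eventually (\<lambda>n. c n \<noteq> 0) sequentially"
  by (rule tendsto_imp_eventually_ne[OF c_lim])

lemma bet_lim:
  assumes "m \<noteq> 0"
  shows "bet \<longlonglongrightarrow> 1 / m - 1"
proof -
  have "(\<lambda>n. c (n + n) / (c n)\<^sup>2 - 1) \<longlonglongrightarrow> m / m\<^sup>2 - 1"
    by (intro tendsto_intros c_double_lim c_lim) (use assms in simp)
  moreover have "eventually (\<lambda>n. c (n + n) / (c n)\<^sup>2 - 1 = bet n) sequentially"
    using c_ev[OF assms] by eventually_elim (simp add: bet_eq)
  ultimately have "bet \<longlonglongrightarrow> m / m\<^sup>2 - 1" by (rule Lim_transform_eventually)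
  then show ?thesis using assms by (simp add: power2_eq_square)
qed

lemma inv_c_lim: "m \<noteq> 0 \<Longrightarrow> (\<lambda>n. 1 / c n - 1) \<longlonglongrightarrow> 1 / m - 1"
  by (intro tendsto_intros c_lim)

text \<open>On vectors that \<open>h\<close> nearly multiplies by \<open>x\<close> a peak at
  \<open>x\<close> nearly acts as 1, since \<open>1 - P n\<close> has the factor
  \<open>h - x\<close>.\<close>

lemma C_eigen:
  assumes "c n \<noteq> 0" and res: "(\<lambda>k. nrm ((h - of_real x *\<^sub>C 1) * T k)) \<longlonglongrightarrow> 0"
  shows "(\<lambda>k. nrm ((C n - of_real (1 / c n - 1) *\<^sub>C 1) * T k)) \<longlonglongrightarrow> 0"
proof -
  obtain g where g: "1 - P n = poly_at g h * (h - of_real x *\<^sub>C 1)" using one_minus_P by blast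
  have "C n - of_real (1 / c n - 1) *\<^sub>C 1 = - (complex_of_real (1 / c n) *\<^sub>C (1 - P n))"
    by (simp add: C_eq cvec.scale_right_diff_distrib cvec.scale_left_diff_distrib scaleC_one)
  then have eq: "(C n - of_real (1 / c n - 1) *\<^sub>C 1) * T k =
      - ((complex_of_real (1 / c n) *\<^sub>C poly_at g h) * ((h - of_real x *\<^sub>C 1) * T k))" for k
    unfolding g by (simp add: mult_scaleC mult.assoc)
  show ?thesis
  proof (rule Lim_null_comparison)
    let ?K = "norm (complex_of_real (1 / c n) *\<^sub>C poly_at g h)"
    show "\<forall>\<^sub>F k in sequentially. norm (nrm ((C n - of_real (1 / c n - 1) *\<^sub>C 1) * T k)) \<le> ?K * nrm ((h - of_real x *\<^sub>C 1) * T k)"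
      unfolding eq nrm_minus by (intro always_eventually allI) (simp add: nrm_mult)
    show "(\<lambda>k. ?K * nrm ((h - of_real x *\<^sub>C 1) * T k)) \<longlonglongrightarrow> 0" by (rule tendsto_mult_right_zero[OF res])
  qed
qed

end

text \<open>On a common approximate eigenvector the noncommutative sum acts as its scalar
  counterpart.\<close>

lemma (in cstar_state) suf_eigen:
  assumes "(\<lambda>k. nrm ((y - of_real b *\<^sub>C 1) * T k)) \<longlonglongrightarrow> 0" "(\<lambda>k. nrm ((y' - of_real b' *\<^sub>C 1) * T k)) \<longlonglongrightarrow> 0"
  shows "(\<lambda>k. nrm ((suf y y' N - of_real (pre b b' N) *\<^sub>C 1) * T k)) \<longlonglongrightarrow> 0"
  using assms
proof (induction N arbitrary: y y' b b')
  case 0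
  then show ?case by (simp add: nrm_def linD)
next
  case (Suc N)
  let ?s = "suf y' y N" and ?B = "pre b' b N"
  have eq: "(suf y y' (Suc N) - of_real (pre b b' (Suc N)) *\<^sub>C 1) * T k =
      (1 + ?s) * ((y - of_real b *\<^sub>C 1) * T k) + of_real b *\<^sub>C ((?s - of_real ?B *\<^sub>C 1) * T k)" for k
    by (simp add: distrib_right distrib_left left_diff_distrib right_diff_distrib mult_scaleC scaleC_scaleC
        scaleC_add_left scaleC_add_right cvec.scale_right_diff_distrib mult.assoc scaleC_one algebra_simps)
  show ?case
  proof (rule Lim_null_comparison)
    show "\<forall>\<^sub>F k in sequentially. norm (nrm ((suf y y' (Suc N) - of_real (pre b b' (Suc N)) *\<^sub>C 1) * T k)) \<le>
        norm (1 + ?s) * nrm ((y - of_real b *\<^sub>C 1) * T k) + \<bar>b\<bar> * nrm ((?s - of_real ?B *\<^sub>C 1) * T k)"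
      unfolding eq using nrm_triangle nrm_mult
      by (intro always_eventually allI) (smt (verit) nrm_nonneg nrm_scale norm_of_real real_norm_def)
    show "(\<lambda>k. norm (1 + ?s) * nrm ((y - of_real b *\<^sub>C 1) * T k) + \<bar>b\<bar> * nrm ((?s - of_real ?B *\<^sub>C 1) * T k)) \<longlonglongrightarrow> 0"
      using tendsto_add[OF tendsto_mult_right_zero[OF Suc.prems(1)] tendsto_mult_right_zero[OF Suc.IH[OF Suc.prems(2,1)]]]
      by simp
  qed
qed

definition alt_sum_suf :: "'b::ring_1 \<Rightarrow> 'b \<Rightarrow> nat \<Rightarrow> 'b"
  where "alt_sum_suf y y' N = 1 + suf y y' N + suf y' y N"

text \<open>In the GNS space the spectral projection of \<open>a\<^sub>1 + a\<^sub>2\<close> at its atom, applied to the vacuum, is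
  \<open>m\<close> times the sum of all alternating words in the centred spectral projections of \<open>a\<^sub>1\<close> and \<open>a\<^sub>2\<close>.\<close>

lemma (in cstar_state) face_approx:
  fixes a\<^sub>1 a\<^sub>2 :: 'a
  assumes fp: "free_pair \<phi> a\<^sub>1 a\<^sub>2" and adj: "adj a\<^sub>1 = a\<^sub>1" "adj a\<^sub>2 = a\<^sub>2"
    and ps: "peak_seq \<phi> (a\<^sub>1 + a\<^sub>2) \<xi> M m" "m > 0"
    and p1: "peak_seq \<phi> a\<^sub>1 \<xi>\<^sub>1 M\<^sub>1 m\<^sub>1" and p2: "peak_seq \<phi> a\<^sub>2 \<xi>\<^sub>2 M\<^sub>2 m\<^sub>2" and msum: "m\<^sub>1 + m\<^sub>2 = 1 + m"
    and res1: "(\<lambda>k. nrm ((a\<^sub>1 - of_real \<xi>\<^sub>1 *\<^sub>C 1) * poly_at (peak \<xi> M k) (a\<^sub>1 + a\<^sub>2))) \<longlonglongrightarrow> 0"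
    and res2: "(\<lambda>k. nrm ((a\<^sub>2 - of_real \<xi>\<^sub>2 *\<^sub>C 1) * poly_at (peak \<xi> M k) (a\<^sub>1 + a\<^sub>2))) \<longlonglongrightarrow> 0"
  defines "L \<equiv> \<lambda>N n. alt_sum_suf (centred \<xi>\<^sub>1 M\<^sub>1 n a\<^sub>1) (centred \<xi>\<^sub>2 M\<^sub>2 n a\<^sub>2) N"
  obtains V U D S where
    "\<And>N. eventually (\<lambda>n. (\<lambda>k. (nrm (poly_at (peak \<xi> M k) (a\<^sub>1 + a\<^sub>2) - of_real m *\<^sub>C L N n))\<^sup>2) \<longlonglongrightarrow> V N n \<and>
      (nrm (L N n))\<^sup>2 = U N n) sequentially"
    "\<And>N. V N \<longlonglongrightarrow> D N" "D \<longlonglongrightarrow> 0" "\<And>N. U N \<longlonglongrightarrow> S N" "S \<longlonglongrightarrow> 1 / m"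
proof -
  interpret free_pair \<phi> a\<^sub>1 a\<^sub>2 by fact
  interpret P: peak_seq \<phi> "a\<^sub>1 + a\<^sub>2" \<xi> M m by fact
  interpret P1: peak_seq \<phi> a\<^sub>1 \<xi>\<^sub>1 M\<^sub>1 m\<^sub>1 by fact
  interpret P2: peak_seq \<phi> a\<^sub>2 \<xi>\<^sub>2 M\<^sub>2 m\<^sub>2 by fact
  have mpos: "m\<^sub>1 > 0" "m\<^sub>2 > 0" using P1.m_bounds P2.m_bounds msum ps(2) by auto
  define B1 where "B1 = 1 / m\<^sub>1 - 1"
  define B2 where "B2 = 1 / m\<^sub>2 - 1"
  define S where "S = alt_sum B1 B2"
  define b1 where "b1 n = 1 / P1.c n - 1" for n
  define b2 where "b2 n = 1 / P2.c n - 1" for n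
  define U where "U N n = alt_sum (P1.bet n) (P2.bet n) N" for N n
  \<comment> \<open>The expanded squared distance; its mixed term uses that the projection is an
    eigenvector of \<open>L N n\<close>. The limits are nested: \<open>k\<close> sharpens the
    projection of the sum, \<open>n\<close> those of the summands, and \<open>N\<close> bounds the
    length of the words.\<close>
  define V where "V N n = m - 2 * m\<^sup>2 * alt_sum (b1 n) (b2 n) N + m\<^sup>2 * U N n" for N n
  define D where "D N = m - 2 * m\<^sup>2 * S N + m\<^sup>2 * S N" for N
  have Ulim: "U N \<longlonglongrightarrow> S N" for N
    unfolding U_def S_def B1_def B2_def
    by (rule alt_sum_tendsto[OF P1.bet_lim P2.bet_lim]) (use mpos in simp_all)
  have Vlim: "V N \<longlonglongrightarrow> D N" for N
    unfolding V_def D_def b1_def b2_def S_def B1_def B2_def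
    by (intro tendsto_intros Ulim[unfolded S_def B1_def B2_def] alt_sum_tendsto P1.inv_c_lim P2.inv_c_lim) (use mpos in simp_all)
  have Bge: "B1 \<ge> 0" "B2 \<ge> 0" using P1.m_bounds P2.m_bounds mpos by (simp_all add: B1_def B2_def)
  \<comment> \<open>The mass relation enters here: it makes the ratio of the series smaller than 1
    and its value exactly \<open>1 / m\<close>.\<close>
  have prod: "1 - B1 * B2 = m / (m\<^sub>1 * m\<^sub>2)"
  proof -
    have "m = m\<^sub>1 + m\<^sub>2 - 1" using msum by simp
    then show ?thesis using mpos by (simp add: B1_def B2_def field_simps)
  qed
  have "m / (m\<^sub>1 * m\<^sub>2) > 0" using mpos ps(2) by simp
  then have "\<bar>B1 * B2\<bar> < 1" using prod Bge by (simp add: abs_mult)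
  from alt_sum_closed_form[OF this]
  have "S \<longlonglongrightarrow> (1 + B1) * (1 + B2) / (1 - B1 * B2)" by (simp add: S_def)
  moreover have "(1 + B1) * (1 + B2) / (1 - B1 * B2) = 1 / m"
    unfolding prod using mpos ps(2) by (simp add: B1_def B2_def)
  ultimately have Slim: "S \<longlonglongrightarrow> 1 / m" by simp
  have "D \<longlonglongrightarrow> m - 2 * m\<^sup>2 * (1 / m) + m\<^sup>2 * (1 / m)"
    unfolding D_def by (intro tendsto_intros Slim)
  then have Dlim: "D \<longlonglongrightarrow> 0" using ps(2) by (simp add: power2_eq_square)
  have "eventually (\<lambda>n. (\<lambda>k. (nrm (P.P k - of_real m *\<^sub>C L N n))\<^sup>2) \<longlonglongrightarrow> V N n \<and> (nrm (L N n))\<^sup>2 = U N n) sequentially" for N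
    using P1.c_ev[OF mpos(1)[THEN less_imp_neq, symmetric]] P2.c_ev[OF mpos(2)[THEN less_imp_neq, symmetric]]
  proof eventually_elim
    case (elim n)
    note c = elim
    let ?y1 = "P1.C n" and ?y2 = "P2.C n" and ?L = "L N n"
    define W where "W = 1 + pre ?y1 ?y2 N + pre ?y2 ?y1 N"
    have W: "adj ?L = W"
      by (simp add: L_def alt_sum_suf_def W_def adj_add adj_suf P1.adj_C P2.adj_C)
    have alg1: "?y1 \<in> gen_alg {a\<^sub>1, a\<^sub>2}" unfolding P1.C_poly by (intro gen_alg_poly_at gen_alg_gen) simp
    have alg2: "?y2 \<in> gen_alg {a\<^sub>1, a\<^sub>2}" unfolding P2.C_poly by (intro gen_alg_poly_at gen_alg_gen) simp
    have Lalg: "?L \<in> gen_alg {a\<^sub>1, a\<^sub>2}"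
      unfolding L_def alt_sum_suf_def by (intro gen_alg.add gen_alg.one gen_alg_suf alg1 alg2)
    have Walg: "W \<in> gen_alg {a\<^sub>1, a\<^sub>2}"
      unfolding W[symmetric] by (rule gen_alg_adj[OF Lalg]) (use adj in auto)
    have Palg: "P.P k \<in> gen_alg {a\<^sub>1, a\<^sub>2}" for k
      unfolding P.P_def by (intro gen_alg_poly_at gen_alg.add gen_alg_gen) auto
    have "\<phi> (?L * W) = alt_sum (of_real (P1.bet n)) (of_real (P2.bet n)) N"
      unfolding L_def alt_sum_suf_def W_def pairing[OF P1.C_poly P2.C_poly P1.phi_C[OF c(1)] P2.phi_C[OF c(2)]]
        P1.phi_C_sq P2.phi_C_sq alt_sum_def ..
    also have "\<phi> (?L * W) = \<phi> (W * ?L)" by (rule trace[OF Lalg Walg])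
    finally have WL: "\<phi> (W * ?L) = of_real (U N n)" by (simp only: U_def alt_sum_of_real)
    then have 1: "(nrm ?L)\<^sup>2 = U N n" by (simp add: nrm_sq_Re W)
    have e1: "(\<lambda>k. nrm ((?y1 - of_real (b1 n) *\<^sub>C 1) * P.P k)) \<longlonglongrightarrow> 0"
      unfolding b1_def by (rule P1.C_eigen[OF c(1)]) (use res1 in \<open>simp add: P.P_def\<close>)
    have e2: "(\<lambda>k. nrm ((?y2 - of_real (b2 n) *\<^sub>C 1) * P.P k)) \<longlonglongrightarrow> 0"
      unfolding b2_def by (rule P2.C_eigen[OF c(2)]) (use res2 in \<open>simp add: P.P_def\<close>)
    let ?s1 = "(suf ?y1 ?y2 N - of_real (pre (b1 n) (b2 n) N) *\<^sub>C 1)"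
    let ?s2 = "(suf ?y2 ?y1 N - of_real (pre (b2 n) (b1 n) N) *\<^sub>C 1)"
    let ?b = "alt_sum (b1 n) (b2 n) N"
    have LP: "\<phi> (?L * P.P k) = \<phi> (?s1 * P.P k) + \<phi> (?s2 * P.P k) + of_real ?b * \<phi> (P.P k)" for k
      by (simp add: L_def alt_sum_suf_def alt_sum_def left_diff_distrib distrib_right mult_scaleC linD scaleC_add_left
          algebra_simps)
    have null: "(\<lambda>k. \<phi> (T k)) \<longlonglongrightarrow> 0" if "(\<lambda>k. nrm (T k)) \<longlonglongrightarrow> 0" for T
      by (rule Lim_null_comparison[OF _ that]) (simp add: norm_le_nrm)
    have "(\<lambda>k. \<phi> (?L * P.P k)) \<longlonglongrightarrow> 0 + 0 + of_real ?b * of_real m"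
      unfolding LP using P.lim
      by (intro tendsto_intros null suf_eigen e1 e2) (simp add: P.P_def)
    then have LPlim: "(\<lambda>k. Re (\<phi> (?L * P.P k))) \<longlonglongrightarrow> ?b * m"
      using tendsto_Re by fastforce
    have "(nrm (P.P k - of_real m *\<^sub>C ?L))\<^sup>2 = P.c (k + k) - 2 * m * Re (\<phi> (?L * P.P k)) + m\<^sup>2 * U N n" for k
    proof -
      have "\<phi> (P.P k * ?L) = \<phi> (?L * P.P k)" by (rule trace[OF Palg Lalg])
      moreover have "\<phi> (W * P.P k) = cnj (\<phi> (P.P k * ?L))"
        using adj_eq[of "P.P k * ?L"] by (simp add: adj_mult W P.adj_P)
      moreover have "adj (P.P k - of_real m *\<^sub>C ?L) * (P.P k - of_real m *\<^sub>C ?L) =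
          P.P (k + k) - of_real m *\<^sub>C (P.P k * ?L) - of_real m *\<^sub>C (W * P.P k) + of_real (m\<^sup>2) *\<^sub>C (W * ?L)"
        by (simp add: adj_diff adj_scaleC P.adj_P W left_diff_distrib right_diff_distrib mult_scaleC scaleC_scaleC
            P.P_mult power2_eq_square algebra_simps)
      ultimately show ?thesis by (simp add: nrm_sq_Re linD WL P.phi_P)
    qed
    moreover have "(\<lambda>k. P.c (k + k) - 2 * m * Re (\<phi> (?L * P.P k)) + m\<^sup>2 * U N n) \<longlonglongrightarrow> m - 2 * m * (?b * m) + m\<^sup>2 * U N n"
      by (intro tendsto_intros P.c_double_lim LPlim)
    moreover have "m - 2 * m * (?b * m) + m\<^sup>2 * U N n = V N n"
      by (simp add: V_def power2_eq_square)
    ultimately have "(\<lambda>k. (nrm (P.P k - of_real m *\<^sub>C ?L))\<^sup>2) \<longlonglongrightarrow> V N n"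
      by (simp only:)
    with 1 show ?case by blast
  qed
  from this[unfolded P.P_def] Vlim Dlim Ulim Slim show thesis by (rule that)
qed

section \<open>Both faces together\<close>

text \<open>The masses enter only as limits of \<phi> at peaks, so the statement is one about
  numbers. The function \<open>K\<close> fixes one radius per point, so that the same peaks occur in
  the marginal and in the joint limits.\<close>

lemma (in cstar_state) bi_atoms:
  fixes a\<^sub>1 a\<^sub>2 b\<^sub>1 b\<^sub>2 :: 'a and \<mu>\<^sub>1 \<mu>\<^sub>2 \<nu>\<^sub>1 \<nu>\<^sub>2 K :: "real \<Rightarrow> real" and \<eta>\<^sub>1 \<eta>\<^sub>2 :: "real \<Rightarrow> real \<Rightarrow> real"
  assumes fa: "free_pair \<phi> a\<^sub>1 a\<^sub>2" and fb: "free_pair \<phi> b\<^sub>1 b\<^sub>2"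
    and adj: "adj a\<^sub>1 = a\<^sub>1" "adj a\<^sub>2 = a\<^sub>2" "adj b\<^sub>1 = b\<^sub>1" "adj b\<^sub>2 = b\<^sub>2"
    and bip: "\<And>y\<^sub>1 y\<^sub>2 u\<^sub>1 u\<^sub>2 p\<^sub>1 p\<^sub>2 q\<^sub>1 q\<^sub>2 N. y\<^sub>1 = poly_at p\<^sub>1 a\<^sub>1 \<Longrightarrow> y\<^sub>2 = poly_at p\<^sub>2 a\<^sub>2 \<Longrightarrow> \<phi> y\<^sub>1 = 0 \<Longrightarrow> \<phi> y\<^sub>2 = 0 \<Longrightarrow>
      u\<^sub>1 = poly_at q\<^sub>1 b\<^sub>1 \<Longrightarrow> u\<^sub>2 = poly_at q\<^sub>2 b\<^sub>2 \<Longrightarrow> \<phi> u\<^sub>1 = 0 \<Longrightarrow> \<phi> u\<^sub>2 = 0 \<Longrightarrow>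
      \<phi> (alt_sum_suf y\<^sub>1 y\<^sub>2 N * alt_sum_suf u\<^sub>1 u\<^sub>2 N) = alt_sum (\<phi> (y\<^sub>1 * u\<^sub>1)) (\<phi> (y\<^sub>2 * u\<^sub>2)) N"
    and pa: "peak_seq \<phi> (a\<^sub>1 + a\<^sub>2) \<xi> (K \<xi>) m" "m > 0" and pb: "peak_seq \<phi> (b\<^sub>1 + b\<^sub>2) \<zeta> (K \<zeta>) n" "n > 0"
    and p1: "\<And>x. peak_seq \<phi> a\<^sub>1 x (K x) (\<mu>\<^sub>1 x)" and p2: "\<And>x. peak_seq \<phi> a\<^sub>2 x (K x) (\<mu>\<^sub>2 x)"
    and q1: "\<And>x. peak_seq \<phi> b\<^sub>1 x (K x) (\<nu>\<^sub>1 x)" and q2: "\<And>x. peak_seq \<phi> b\<^sub>2 x (K x) (\<nu>\<^sub>2 x)"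
    and e1: "\<And>x z. (\<lambda>k. \<phi> (poly_at (peak x (K x) k) a\<^sub>1 * poly_at (peak z (K z) k) b\<^sub>1)) \<longlonglongrightarrow> of_real (\<eta>\<^sub>1 x z)"
    and e2: "\<And>x z. (\<lambda>k. \<phi> (poly_at (peak x (K x) k) a\<^sub>2 * poly_at (peak z (K z) k) b\<^sub>2)) \<longlonglongrightarrow> of_real (\<eta>\<^sub>2 x z)"
    and e: "(\<lambda>k. \<phi> (poly_at (peak \<xi> (K \<xi>) k) (a\<^sub>1 + a\<^sub>2) * poly_at (peak \<zeta> (K \<zeta>) k) (b\<^sub>1 + b\<^sub>2))) \<longlonglongrightarrow> of_real \<eta>" "\<eta> > 0"
    and nonneg: "\<And>x z. \<eta>\<^sub>1 x z \<ge> 0" "\<And>x z. \<eta>\<^sub>2 x z \<ge> 0"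
  obtains \<xi>\<^sub>1 \<xi>\<^sub>2 \<zeta>\<^sub>1 \<zeta>\<^sub>2 where "\<xi>\<^sub>1 + \<xi>\<^sub>2 = \<xi>" "\<zeta>\<^sub>1 + \<zeta>\<^sub>2 = \<zeta>" "\<eta>\<^sub>1 \<xi>\<^sub>1 \<zeta>\<^sub>1 > 0" "\<eta>\<^sub>2 \<xi>\<^sub>2 \<zeta>\<^sub>2 > 0"
    "1 + m * n / \<eta> = \<mu>\<^sub>1 \<xi>\<^sub>1 * \<nu>\<^sub>1 \<zeta>\<^sub>1 / \<eta>\<^sub>1 \<xi>\<^sub>1 \<zeta>\<^sub>1 + \<mu>\<^sub>2 \<xi>\<^sub>2 * \<nu>\<^sub>2 \<zeta>\<^sub>2 / \<eta>\<^sub>2 \<xi>\<^sub>2 \<zeta>\<^sub>2"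
proof -
  interpret P: peak_seq \<phi> "a\<^sub>1 + a\<^sub>2" \<xi> "K \<xi>" m by fact
  interpret Q: peak_seq \<phi> "b\<^sub>1 + b\<^sub>2" \<zeta> "K \<zeta>" n by fact
  obtain \<xi>\<^sub>1 \<xi>\<^sub>2 where x: "\<xi>\<^sub>1 + \<xi>\<^sub>2 = \<xi>" "\<mu>\<^sub>1 \<xi>\<^sub>1 + \<mu>\<^sub>2 \<xi>\<^sub>2 = 1 + m"
    and xr: "(\<lambda>k. nrm ((a\<^sub>1 - of_real \<xi>\<^sub>1 *\<^sub>C 1) * poly_at (peak \<xi> (K \<xi>) k) (a\<^sub>1 + a\<^sub>2))) \<longlonglongrightarrow> 0"
    "(\<lambda>k. nrm ((a\<^sub>2 - of_real \<xi>\<^sub>2 *\<^sub>C 1) * poly_at (peak \<xi> (K \<xi>) k) (a\<^sub>1 + a\<^sub>2))) \<longlonglongrightarrow> 0"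
    by (rule face_atoms[OF fa adj(1,2) pa exI[of "\<lambda>M. peak_seq \<phi> a\<^sub>1 x M (\<mu>\<^sub>1 x)" "K x" for x, OF p1]
          exI[of "\<lambda>M. peak_seq \<phi> a\<^sub>2 x M (\<mu>\<^sub>2 x)" "K x" for x, OF p2]]) blast
  obtain \<zeta>\<^sub>1 \<zeta>\<^sub>2 where z: "\<zeta>\<^sub>1 + \<zeta>\<^sub>2 = \<zeta>" "\<nu>\<^sub>1 \<zeta>\<^sub>1 + \<nu>\<^sub>2 \<zeta>\<^sub>2 = 1 + n"
    and zr: "(\<lambda>k. nrm ((b\<^sub>1 - of_real \<zeta>\<^sub>1 *\<^sub>C 1) * poly_at (peak \<zeta> (K \<zeta>) k) (b\<^sub>1 + b\<^sub>2))) \<longlonglongrightarrow> 0"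
    "(\<lambda>k. nrm ((b\<^sub>2 - of_real \<zeta>\<^sub>2 *\<^sub>C 1) * poly_at (peak \<zeta> (K \<zeta>) k) (b\<^sub>1 + b\<^sub>2))) \<longlonglongrightarrow> 0"
    by (rule face_atoms[OF fb adj(3,4) pb exI[of "\<lambda>M. peak_seq \<phi> b\<^sub>1 x M (\<nu>\<^sub>1 x)" "K x" for x, OF q1]
          exI[of "\<lambda>M. peak_seq \<phi> b\<^sub>2 x M (\<nu>\<^sub>2 x)" "K x" for x, OF q2]]) blast
  interpret P1: peak_seq \<phi> a\<^sub>1 \<xi>\<^sub>1 "K \<xi>\<^sub>1" "\<mu>\<^sub>1 \<xi>\<^sub>1" by (rule p1)
  interpret P2: peak_seq \<phi> a\<^sub>2 \<xi>\<^sub>2 "K \<xi>\<^sub>2" "\<mu>\<^sub>2 \<xi>\<^sub>2" by (rule p2)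
  interpret Q1: peak_seq \<phi> b\<^sub>1 \<zeta>\<^sub>1 "K \<zeta>\<^sub>1" "\<nu>\<^sub>1 \<zeta>\<^sub>1" by (rule q1)
  interpret Q2: peak_seq \<phi> b\<^sub>2 \<zeta>\<^sub>2 "K \<zeta>\<^sub>2" "\<nu>\<^sub>2 \<zeta>\<^sub>2" by (rule q2)
  define m\<^sub>1 m\<^sub>2 n\<^sub>1 n\<^sub>2 where mn: "m\<^sub>1 = \<mu>\<^sub>1 \<xi>\<^sub>1" "m\<^sub>2 = \<mu>\<^sub>2 \<xi>\<^sub>2" "n\<^sub>1 = \<nu>\<^sub>1 \<zeta>\<^sub>1" "n\<^sub>2 = \<nu>\<^sub>2 \<zeta>\<^sub>2"
  have pos: "m\<^sub>1 > 0" "m\<^sub>2 > 0" "n\<^sub>1 > 0" "n\<^sub>2 > 0" and le: "m\<^sub>1 \<le> 1" "m\<^sub>2 \<le> 1" "n\<^sub>1 \<le> 1" "n\<^sub>2 \<le> 1"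
    using P1.m_bounds P2.m_bounds Q1.m_bounds Q2.m_bounds x(2) z(2) pa(2) pb(2) by (auto simp: mn)
  define h\<^sub>1 h\<^sub>2 where h: "h\<^sub>1 = \<eta>\<^sub>1 \<xi>\<^sub>1 \<zeta>\<^sub>1" "h\<^sub>2 = \<eta>\<^sub>2 \<xi>\<^sub>2 \<zeta>\<^sub>2"
  \<comment> \<open>\<open>1 + \<alpha>\<^sub>j\<close> compares the joint mass with the product of
    the marginal masses.\<close>
  define \<alpha>\<^sub>1 \<alpha>\<^sub>2 where al: "\<alpha>\<^sub>1 = h\<^sub>1 / (m\<^sub>1 * n\<^sub>1) - 1" "\<alpha>\<^sub>2 = h\<^sub>2 / (m\<^sub>2 * n\<^sub>2) - 1"
  let ?y1 = P1.C and ?y2 = P2.C and ?u1 = Q1.C and ?u2 = Q2.C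
  define L where "L N k = alt_sum_suf (?y1 k) (?y2 k) N" for N k
  define L' where "L' N k = alt_sum_suf (?u1 k) (?u2 k) N" for N k
  have ev: "eventually (\<lambda>k. P1.c k \<noteq> 0 \<and> P2.c k \<noteq> 0 \<and> Q1.c k \<noteq> 0 \<and> Q2.c k \<noteq> 0) sequentially"
    using P1.c_ev P2.c_ev Q1.c_ev Q2.c_ev pos by (auto simp: mn eventually_conj_iff)
  have lim1: "(\<lambda>k. \<phi> (?y1 k * ?u1 k)) \<longlonglongrightarrow> of_real \<alpha>\<^sub>1"
  proof -
    have "(\<lambda>k. \<phi> (P1.P k * Q1.P k) / of_real (P1.c k * Q1.c k) - 1) \<longlonglongrightarrow> of_real h\<^sub>1 / of_real (m\<^sub>1 * n\<^sub>1) - 1"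
      using pos e1[of \<xi>\<^sub>1 \<zeta>\<^sub>1] unfolding mn h
      by (intro tendsto_intros P1.c_lim Q1.c_lim) (simp_all add: P1.P_def Q1.P_def)
    moreover have "eventually (\<lambda>k. \<phi> (P1.P k * Q1.P k) / of_real (P1.c k * Q1.c k) - 1 = \<phi> (?y1 k * ?u1 k)) sequentially"
      using ev by eventually_elim (simp add: P1.phi_C_mult[OF q1])
    ultimately show ?thesis unfolding al by (simp add: Lim_transform_eventually)
  qed
  have lim2: "(\<lambda>k. \<phi> (?y2 k * ?u2 k)) \<longlonglongrightarrow> of_real \<alpha>\<^sub>2"
  proof -
    have "(\<lambda>k. \<phi> (P2.P k * Q2.P k) / of_real (P2.c k * Q2.c k) - 1) \<longlonglongrightarrow> of_real h\<^sub>2 / of_real (m\<^sub>2 * n\<^sub>2) - 1"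
      using pos e2[of \<xi>\<^sub>2 \<zeta>\<^sub>2] unfolding mn h
      by (intro tendsto_intros P2.c_lim Q2.c_lim) (simp_all add: P2.P_def Q2.P_def)
    moreover have "eventually (\<lambda>k. \<phi> (P2.P k * Q2.P k) / of_real (P2.c k * Q2.c k) - 1 = \<phi> (?y2 k * ?u2 k)) sequentially"
      using ev by eventually_elim (simp add: P2.phi_C_mult[OF q2])
    ultimately show ?thesis unfolding al by (simp add: Lim_transform_eventually)
  qed
  have cs: "\<alpha>\<^sup>2 \<le> (1 / u - 1) * (1 / v - 1)"
    if "(\<lambda>k. \<phi> (y k * w k)) \<longlonglongrightarrow> of_real \<alpha>" "\<And>k. adj (y k) = y k" "(\<lambda>k. (nrm (y k))\<^sup>2) \<longlonglongrightarrow> 1 / u - 1" "(\<lambda>k. (nrm (w k))\<^sup>2) \<longlonglongrightarrow> 1 / v - 1"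
    for \<alpha> u v :: real and y w
  proof -
    have "(\<lambda>k. (cmod (\<phi> (y k * w k)))\<^sup>2) \<longlonglongrightarrow> (cmod (of_real \<alpha>))\<^sup>2" by (intro tendsto_intros that)
    moreover have "(cmod (\<phi> (y k * w k)))\<^sup>2 \<le> (nrm (y k))\<^sup>2 * (nrm (w k))\<^sup>2" for k
      using power_mono[OF cauchy_schwarz'[of "y k" "w k"], of 2] by (simp add: that(2) power_mult_distrib)
    ultimately have "(cmod (of_real \<alpha>))\<^sup>2 \<le> (1 / u - 1) * (1 / v - 1)"
      by (intro LIMSEQ_le[OF _ tendsto_mult[OF that(3,4)]]) auto
    then show ?thesis by simp
  qed
  have nz: "\<mu>\<^sub>1 \<xi>\<^sub>1 \<noteq> 0" "\<mu>\<^sub>2 \<xi>\<^sub>2 \<noteq> 0" "\<nu>\<^sub>1 \<zeta>\<^sub>1 \<noteq> 0" "\<nu>\<^sub>2 \<zeta>\<^sub>2 \<noteq> 0" using pos by (auto simp: mn)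
  have a1: "\<alpha>\<^sub>1\<^sup>2 \<le> (1 / m\<^sub>1 - 1) * (1 / n\<^sub>1 - 1)"
    by (rule cs[OF lim1 P1.adj_C]) (use P1.bet_lim[OF nz(1)] Q1.bet_lim[OF nz(3)] in \<open>simp_all add: mn P1.bet_def[abs_def] Q1.bet_def[abs_def]\<close>)
  have a2: "\<alpha>\<^sub>2\<^sup>2 \<le> (1 / m\<^sub>2 - 1) * (1 / n\<^sub>2 - 1)"
    by (rule cs[OF lim2 P2.adj_C]) (use P2.bet_lim[OF nz(2)] Q2.bet_lim[OF nz(4)] in \<open>simp_all add: mn P2.bet_def[abs_def] Q2.bet_def[abs_def]\<close>)
  have small: "(1 / u - 1) * (1 / v - 1) < 1" if "u > 0" "v > 0" "u + v > 1" for u v :: real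
  proof -
    have "(1 / u - 1) * (1 / v - 1) = 1 - (u + v - 1) / (u * v)" using that by (simp add: field_simps)
    then show ?thesis using that by simp
  qed
  \<comment> \<open>Cauchy-Schwarz does not make each \<alpha> small. The factors are regrouped by
    face, because the mass relation bounds the product over the two indices within one face.\<close>
  have "(\<alpha>\<^sub>1 * \<alpha>\<^sub>2)\<^sup>2 \<le> ((1 / m\<^sub>1 - 1) * (1 / n\<^sub>1 - 1)) * ((1 / m\<^sub>2 - 1) * (1 / n\<^sub>2 - 1))"
    unfolding power_mult_distrib by (rule mult_mono[OF a1 a2]) (use pos le in auto)
  also have "\<dots> = ((1 / m\<^sub>1 - 1) * (1 / m\<^sub>2 - 1)) * ((1 / n\<^sub>1 - 1) * (1 / n\<^sub>2 - 1))" by (simp only: mult_ac)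
  also have "\<dots> \<le> ((1 / m\<^sub>1 - 1) * (1 / m\<^sub>2 - 1)) * 1"
    using small[of n\<^sub>1 n\<^sub>2] pos le z(2) pb(2) by (intro mult_left_mono mult_nonneg_nonneg) (auto simp: mn)
  also have "\<dots> < 1" using small[of m\<^sub>1 m\<^sub>2] pos x(2) pa(2) by (simp add: mn)
  finally have "\<bar>\<alpha>\<^sub>1 * \<alpha>\<^sub>2\<bar> < 1" by (simp only: abs_square_less_1)
  note closed = alt_sum_closed_form[OF this]
  obtain V U D S where F: "\<And>N. eventually (\<lambda>k. (\<lambda>i. (nrm (P.P i - of_real m *\<^sub>C L N k))\<^sup>2) \<longlonglongrightarrow> V N k \<and> (nrm (L N k))\<^sup>2 = U N k) sequentially"
    "\<And>N. V N \<longlonglongrightarrow> D N" "D \<longlonglongrightarrow> 0" "\<And>N. U N \<longlonglongrightarrow> S N" "S \<longlonglongrightarrow> 1 / m"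
    by (rule face_approx[OF fa adj(1,2) pa p1 p2 x(2) xr]) (rule that, unfold P.P_def L_def, assumption+)
  obtain V' U' D' S' where F': "\<And>N. eventually (\<lambda>k. (\<lambda>i. (nrm (Q.P i - of_real n *\<^sub>C L' N k))\<^sup>2) \<longlonglongrightarrow> V' N k \<and> (nrm (L' N k))\<^sup>2 = U' N k) sequentially"
    "\<And>N. V' N \<longlonglongrightarrow> D' N" "D' \<longlonglongrightarrow> 0" "\<And>N. U' N \<longlonglongrightarrow> S' N" "S' \<longlonglongrightarrow> 1 / n"
    by (rule face_approx[OF fb adj(3,4) pb q1 q2 z(2) zr]) (rule that, unfold Q.P_def L'_def, assumption+)
  have PQ: "(\<lambda>i. \<phi> (P.P i * Q.P i)) \<longlonglongrightarrow> of_real \<eta>" using e(1) by (simp add: P.P_def Q.P_def)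
  define A where "A N k = complex_of_real (m * n) * alt_sum (\<phi> (?y1 k * ?u1 k)) (\<phi> (?y2 k * ?u2 k)) N" for N k
  \<comment> \<open>The two projections are replaced by alternating sums one after the other; the
    bound is the limit in \<open>i\<close> with \<open>N\<close> and \<open>k\<close> fixed.\<close>
  have bound: "eventually (\<lambda>k. cmod (of_real \<eta> - A N k) \<le> sqrt m * sqrt (V' N k) + n * sqrt (V N k) * sqrt (U' N k)) sequentially" for N
    using F(1)[of N] F'(1)[of N] ev
  proof eventually_elim
    case (elim k)
    have LL: "\<phi> ((of_real m *\<^sub>C L N k) * (of_real n *\<^sub>C L' N k)) = A N k"
      unfolding L_def L'_def A_def mult_scaleC scaleC_scaleC linD
      using elim(3) by (simp add: bip[OF P1.C_poly P2.C_poly P1.phi_C P2.phi_C Q1.C_poly Q2.C_poly Q1.phi_C Q2.phi_C])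
    have adjn: "nrm (adj (P.P i - of_real m *\<^sub>C L N k)) = nrm (P.P i - of_real m *\<^sub>C L N k)" for i
    proof (rule nrm_adj[OF fa adj(1,2)])
      have y: "?y1 k \<in> gen_alg {a\<^sub>1, a\<^sub>2}" "?y2 k \<in> gen_alg {a\<^sub>1, a\<^sub>2}"
        unfolding P1.C_poly P2.C_poly by (intro gen_alg_poly_at gen_alg_gen, simp)+
      have "P.P i \<in> gen_alg {a\<^sub>1, a\<^sub>2}"
        unfolding P.P_def by (intro gen_alg_poly_at gen_alg.add gen_alg_gen) auto
      with y show "P.P i - of_real m *\<^sub>C L N k \<in> gen_alg {a\<^sub>1, a\<^sub>2}"
        unfolding L_def alt_sum_suf_def
        by (intro gen_alg_diff gen_alg.scale gen_alg.add gen_alg.one gen_alg_suf)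
    qed
    have "cmod (\<phi> (P.P i * Q.P i) - A N k) \<le>
        nrm (P.P i) * sqrt ((nrm (Q.P i - of_real n *\<^sub>C L' N k))\<^sup>2) + sqrt ((nrm (P.P i - of_real m *\<^sub>C L N k))\<^sup>2) * (n * sqrt (U' N k))" for i
    proof -
      have "\<phi> (P.P i * Q.P i) - A N k = \<phi> (P.P i * (Q.P i - of_real n *\<^sub>C L' N k)) + \<phi> ((P.P i - of_real m *\<^sub>C L N k) * (of_real n *\<^sub>C L' N k))"
        unfolding LL[symmetric] by (simp only: left_diff_distrib right_diff_distrib linD) simp
      also have "cmod \<dots> \<le> nrm (P.P i) * nrm (Q.P i - of_real n *\<^sub>C L' N k) + nrm (P.P i - of_real m *\<^sub>C L N k) * nrm (of_real n *\<^sub>C L' N k)"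
        using cauchy_schwarz'[of "P.P i" "Q.P i - of_real n *\<^sub>C L' N k"]
          cauchy_schwarz'[of "P.P i - of_real m *\<^sub>C L N k" "of_real n *\<^sub>C L' N k"]
        by (intro norm_triangle_mono) (simp_all add: P.adj_P adjn)
      also have "nrm (of_real n *\<^sub>C L' N k) = n * sqrt (U' N k)"
        using elim(2) pb(2) by (simp add: nrm_scale flip: conjunct2[OF elim(2)])
      finally show ?thesis by simp
    qed
    moreover have "(\<lambda>i. cmod (\<phi> (P.P i * Q.P i) - A N k)) \<longlonglongrightarrow> cmod (of_real \<eta> - A N k)"
      by (intro tendsto_intros PQ)
    moreover have "(\<lambda>i. nrm (P.P i) * sqrt ((nrm (Q.P i - of_real n *\<^sub>C L' N k))\<^sup>2) + sqrt ((nrm (P.P i - of_real m *\<^sub>C L N k))\<^sup>2) * (n * sqrt (U' N k)))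
        \<longlonglongrightarrow> sqrt m * sqrt (V' N k) + sqrt (V N k) * (n * sqrt (U' N k))"
      by (intro tendsto_add tendsto_mult tendsto_const tendsto_real_sqrt P.nrm_P_lim) (use elim in auto)
    ultimately have "cmod (of_real \<eta> - A N k) \<le> sqrt m * sqrt (V' N k) + sqrt (V N k) * (n * sqrt (U' N k))"
      by (intro LIMSEQ_le) auto
    then show ?case by (simp add: mult_ac)
  qed
  have bound2: "cmod (of_real \<eta> - of_real (m * n * alt_sum \<alpha>\<^sub>1 \<alpha>\<^sub>2 N)) \<le> sqrt m * sqrt (D' N) + n * sqrt (D N) * sqrt (S' N)" for N
  proof (rule tendsto_le[OF _ _ _ bound[of N]])
    show "(\<lambda>k. sqrt m * sqrt (V' N k) + n * sqrt (V N k) * sqrt (U' N k)) \<longlonglongrightarrow> sqrt m * sqrt (D' N) + n * sqrt (D N) * sqrt (S' N)"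
      by (intro tendsto_intros F F')
    have "A N \<longlonglongrightarrow> of_real (m * n) * alt_sum (of_real \<alpha>\<^sub>1) (of_real \<alpha>\<^sub>2) N"
      unfolding A_def by (intro tendsto_intros alt_sum_tendsto lim1 lim2)
    then have "A N \<longlonglongrightarrow> of_real (m * n * alt_sum \<alpha>\<^sub>1 \<alpha>\<^sub>2 N)" by (simp add: alt_sum_of_real)
    then show "(\<lambda>k. cmod (of_real \<eta> - A N k)) \<longlonglongrightarrow> cmod (of_real \<eta> - of_real (m * n * alt_sum \<alpha>\<^sub>1 \<alpha>\<^sub>2 N))"
      by (intro tendsto_intros)
  qed simp
  have "cmod (of_real \<eta> - of_real (m * n * ((1 + \<alpha>\<^sub>1) * (1 + \<alpha>\<^sub>2) / (1 - \<alpha>\<^sub>1 * \<alpha>\<^sub>2)))) \<le> sqrt m * sqrt 0 + n * sqrt 0 * sqrt (1 / n)"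
  proof (rule LIMSEQ_le)
    show "(\<lambda>N. cmod (of_real \<eta> - of_real (m * n * alt_sum \<alpha>\<^sub>1 \<alpha>\<^sub>2 N))) \<longlonglongrightarrow> cmod (of_real \<eta> - of_real (m * n * ((1 + \<alpha>\<^sub>1) * (1 + \<alpha>\<^sub>2) / (1 - \<alpha>\<^sub>1 * \<alpha>\<^sub>2))))"
      by (intro tendsto_intros closed)
    show "(\<lambda>N. sqrt m * sqrt (D' N) + n * sqrt (D N) * sqrt (S' N)) \<longlonglongrightarrow> sqrt m * sqrt 0 + n * sqrt 0 * sqrt (1 / n)"
      by (intro tendsto_intros F F')
  qed (use bound2 in blast)
  then have "complex_of_real \<eta> = of_real (m * n * ((1 + \<alpha>\<^sub>1) * (1 + \<alpha>\<^sub>2) / (1 - \<alpha>\<^sub>1 * \<alpha>\<^sub>2)))" by simp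
  then have eta: "\<eta> = m * n * ((1 + \<alpha>\<^sub>1) * (1 + \<alpha>\<^sub>2) / (1 - \<alpha>\<^sub>1 * \<alpha>\<^sub>2))" by (simp only: of_real_eq_iff)
  \<comment> \<open>In terms of \<open>t\<^sub>j = 1 + \<alpha>\<^sub>j\<close> the denominator is
    \<open>t\<^sub>1 + t\<^sub>2 - t\<^sub>1 * t\<^sub>2\<close>, and taking reciprocals separates
    the two indices.\<close>
  define t\<^sub>1 t\<^sub>2 where t: "t\<^sub>1 = h\<^sub>1 / (m\<^sub>1 * n\<^sub>1)" "t\<^sub>2 = h\<^sub>2 / (m\<^sub>2 * n\<^sub>2)"
  have eta': "\<eta> = m * n * (t\<^sub>1 * t\<^sub>2 / (t\<^sub>1 + t\<^sub>2 - t\<^sub>1 * t\<^sub>2))"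
    unfolding eta al t by (simp add: algebra_simps)
  \<comment> \<open>The existence of the atoms: a vanishing joint mass would make \<eta> vanish. The
    denominator is covered as well, since division by 0 yields 0.\<close>
  then have nt: "t\<^sub>1 \<noteq> 0" "t\<^sub>2 \<noteq> 0" "t\<^sub>1 + t\<^sub>2 - t\<^sub>1 * t\<^sub>2 \<noteq> 0" using e(2) by auto
  then have h0: "h\<^sub>1 \<noteq> 0" "h\<^sub>2 \<noteq> 0" by (auto simp: t)
  then have hp: "h\<^sub>1 > 0" "h\<^sub>2 > 0" using nonneg[of \<xi>\<^sub>1 \<zeta>\<^sub>1] nonneg[of \<xi>\<^sub>2 \<zeta>\<^sub>2] by (auto simp: h)
  have "1 + m * n / \<eta> = 1 / t\<^sub>1 + 1 / t\<^sub>2"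
    unfolding eta' using nt pa(2) pb(2) by (simp add: field_simps)
  then have "1 + m * n / \<eta> = m\<^sub>1 * n\<^sub>1 / h\<^sub>1 + m\<^sub>2 * n\<^sub>2 / h\<^sub>2" by (simp add: t)
  with x(1) z(1) hp show thesis unfolding mn h by (rule that)
qed

section \<open>Atoms of measures from moments\<close>

lemma compactly_supported_bound:
  assumes "compactly_supported_prob \<mu>"
  obtains B where "B > 0" "AE p in \<mu>. norm p < B"
proof -
  obtain K where K: "compact K" "emeasure \<mu> (- K) = 0" and s: "sets \<mu> = sets borel"
    using assms unfolding compactly_supported_prob_def by blast
  obtain B where B: "B > 0" "\<And>p. p \<in> K \<Longrightarrow> norm p < B"
    using compact_imp_bounded[OF K(1)] unfolding bounded_pos_less by blast
  have "- K \<in> null_sets \<mu>"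
    using K compact_imp_closed[OF K(1)] by (auto simp: null_sets_def s)
  then have "AE p in \<mu>. p \<notin> - K" by (rule AE_not_in)
  then have "AE p in \<mu>. norm p < B" by eventually_elim (use B in auto)
  with B(1) that show thesis by blast
qed

text \<open>Dominated convergence with bound 1. With two functions it gives the mass of a joint
  atom; with a constant second function, that of an atom of a marginal or of a measure on the
  line.\<close>

lemma peak_integral_limit:
  fixes g\<^sub>1 g\<^sub>2 :: "'s \<Rightarrow> real"
  assumes fin: "finite_measure \<eta>" and meas [measurable]: "g\<^sub>1 \<in> borel_measurable \<eta>" "g\<^sub>2 \<in> borel_measurable \<eta>"
    and b1: "AE p in \<eta>. \<bar>g\<^sub>1 p - x\<bar> < K\<^sub>1" and b2: "AE p in \<eta>. \<bar>g\<^sub>2 p - z\<bar> < K\<^sub>2"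
  shows "(\<lambda>k. \<integral>p. (1 - ((g\<^sub>1 p - x) / K\<^sub>1)\<^sup>2) ^ k * (1 - ((g\<^sub>2 p - z) / K\<^sub>2)\<^sup>2) ^ k \<partial>\<eta>) \<longlonglongrightarrow>
    measure \<eta> {p \<in> space \<eta>. g\<^sub>1 p = x \<and> g\<^sub>2 p = z}"
proof -
  interpret finite_measure \<eta> by fact
  let ?S = "{p \<in> space \<eta>. g\<^sub>1 p = x \<and> g\<^sub>2 p = z}"
  have S [measurable]: "?S \<in> sets \<eta>" by measurable
  have bd: "0 \<le> 1 - (t / K)\<^sup>2" "1 - (t / K)\<^sup>2 \<le> 1" "t \<noteq> 0 \<Longrightarrow> 1 - (t / K)\<^sup>2 < 1" if "\<bar>t\<bar> < K" for t K :: real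
  proof -
    have "K > 0" using that by linarith
    then have "\<bar>t / K\<bar> \<le> 1" using that by simp
    then show "0 \<le> 1 - (t / K)\<^sup>2" by (simp add: abs_square_le_1)
    show "1 - (t / K)\<^sup>2 \<le> 1" by simp
    show "t \<noteq> 0 \<Longrightarrow> 1 - (t / K)\<^sup>2 < 1" using that by simp
  qed
  have lim: "(\<lambda>k. (1 - (t / K)\<^sup>2) ^ k) \<longlonglongrightarrow> (if t = 0 then 1 else 0)" if "\<bar>t\<bar> < K" for t K :: real
  proof (cases "t = 0")
    case False
    then show ?thesis using bd[OF that] by (auto intro!: LIMSEQ_power_zero)
  next
    case True
    then have "(\<lambda>k. (1 - (t / K)\<^sup>2) ^ k) = (\<lambda>k. 1)" by (simp add: fun_eq_iff)
    with True show ?thesis by simp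
  qed
  have "(\<lambda>k. \<integral>p. (1 - ((g\<^sub>1 p - x) / K\<^sub>1)\<^sup>2) ^ k * (1 - ((g\<^sub>2 p - z) / K\<^sub>2)\<^sup>2) ^ k \<partial>\<eta>) \<longlonglongrightarrow> (\<integral>p. indicator ?S p \<partial>\<eta>)"
  proof (rule integral_dominated_convergence[where w = "\<lambda>_. 1"])
    show "AE p in \<eta>. (\<lambda>k. (1 - ((g\<^sub>1 p - x) / K\<^sub>1)\<^sup>2) ^ k * (1 - ((g\<^sub>2 p - z) / K\<^sub>2)\<^sup>2) ^ k) \<longlonglongrightarrow> indicator ?S p"
      using b1 b2 AE_space
    proof eventually_elim
      case (elim p)
      from tendsto_mult[OF lim[OF elim(1)] lim[OF elim(2)]] elim(3)
      show ?case by (auto simp: indicator_def split: if_splits)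
    qed
    show "AE p in \<eta>. norm ((1 - ((g\<^sub>1 p - x) / K\<^sub>1)\<^sup>2) ^ k * (1 - ((g\<^sub>2 p - z) / K\<^sub>2)\<^sup>2) ^ k) \<le> 1" for k
      using b1 b2
    proof eventually_elim
      case (elim p)
      have "(1 - ((g\<^sub>1 p - x) / K\<^sub>1)\<^sup>2) ^ k \<le> 1" "(1 - ((g\<^sub>2 p - z) / K\<^sub>2)\<^sup>2) ^ k \<le> 1"
        using bd[OF elim(1)] bd[OF elim(2)] by (auto intro: power_le_one)
      then show ?case using bd[OF elim(1)] bd[OF elim(2)] by (simp add: mult_le_one abs_mult)
    qed
  qed simp_all
  then show ?thesis by simp
qed

lemma poly_peak: "poly (peak x K k) (of_real t) = of_real ((1 - ((t - x) / K)\<^sup>2) ^ k)"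
  by (simp add: peak_def poly_power power_divide)

lemma fst_snd_measurable:
  assumes "sets \<eta> = sets (borel :: (real \<times> real) measure)"
  shows "fst \<in> borel_measurable \<eta>" "snd \<in> borel_measurable \<eta>"
  unfolding measurable_cong_sets[OF assms refl]
  by (rule borel_measurable_continuous_onI, rule continuous_on_fst, rule continuous_on_id)
    (rule borel_measurable_continuous_onI, rule continuous_on_snd, rule continuous_on_id)

text \<open>The distribution prescribes integrals of monomials; the almost sure bound makes these
  integrable, so that integral and sum can be exchanged.\<close>

lemma pair_moments:
  assumes "pair_distribution \<phi> (a, b) \<eta>" "clinear \<phi>"
  shows "\<phi> (poly_at p a * poly_at q b) = (\<integral>x. poly p (of_real (fst x)) * poly q (of_real (snd x)) \<partial>\<eta>)"
proof -
  have cs: "compactly_supported_prob \<eta>" and mom: "\<And>i j. \<phi> (a ^ i * b ^ j) = of_real (\<integral>(t, s). t ^ i * s ^ j \<partial>\<eta>)"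
    using assms(1) by (auto simp: pair_distribution_def)
  interpret prob_space \<eta> using cs by (simp add: compactly_supported_prob_def)
  have sets [measurable_cong]: "sets \<eta> = sets borel" using cs by (simp add: compactly_supported_prob_def)
  obtain B where B: "B > 0" "AE x in \<eta>. norm x < B" by (rule compactly_supported_bound[OF cs])
  note meas [measurable] = fst_snd_measurable[OF sets]
  have int: "integrable \<eta> (\<lambda>x. complex_of_real (fst x ^ i * snd x ^ j))" for i j
  proof (rule integrable_const_bound[where B = "B ^ i * B ^ j"])
    show "AE x in \<eta>. norm (complex_of_real (fst x ^ i * snd x ^ j)) \<le> B ^ i * B ^ j"
      using B(2)
    proof eventually_elim
      case (elim x)
      have "\<bar>fst x\<bar> \<le> B" "\<bar>snd x\<bar> \<le> B"
        using elim norm_fst_le[of "fst x" "snd x"] norm_snd_le[of "snd x" "fst x"]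
        by (simp_all del: norm_fst_le norm_snd_le)
      then have "\<bar>fst x\<bar> ^ i * \<bar>snd x\<bar> ^ j \<le> B ^ i * B ^ j"
        using B(1) by (intro mult_mono power_mono) auto
      then show ?case by (simp add: norm_mult norm_power)
    qed
  qed measurable
  note lin = clinearD[OF assms(2), unfolded scaleC_complex_def]
  have "\<phi> (poly_at p a * poly_at q b) = (\<Sum>i\<le>degree p. \<Sum>j\<le>degree q. coeff p i * coeff q j * \<phi> (a ^ i * b ^ j))"
    by (simp add: poly_at_def sum_product mult_scaleC lin mult.commute mult.left_commute)
  also have "\<dots> = (\<Sum>i\<le>degree p. \<Sum>j\<le>degree q. coeff p i * coeff q j * (\<integral>x. complex_of_real (fst x ^ i * snd x ^ j) \<partial>\<eta>))"
    unfolding mom integral_complex_of_real by (simp add: case_prod_beta')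
  also have "\<dots> = (\<integral>x. (\<Sum>i\<le>degree p. \<Sum>j\<le>degree q. coeff p i * coeff q j * complex_of_real (fst x ^ i * snd x ^ j)) \<partial>\<eta>)"
    by (simp add: int Bochner_Integration.integral_sum del: of_real_mult of_real_power)
  also have "\<dots> = (\<integral>x. poly p (of_real (fst x)) * poly q (of_real (snd x)) \<partial>\<eta>)"
    by (simp add: poly_altdef sum_product mult_ac)
  finally show ?thesis .
qed

lemma single_moments:
  assumes "distribution \<phi> a \<mu>" "clinear \<phi>"
  shows "\<phi> (poly_at p a) = (\<integral>x. poly p (of_real x) \<partial>\<mu>)"
proof -
  have cs: "compactly_supported_prob \<mu>" and mom: "\<And>i. \<phi> (a ^ i) = of_real (\<integral>t. t ^ i \<partial>\<mu>)"
    using assms(1) by (auto simp: distribution_def)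
  interpret prob_space \<mu> using cs by (simp add: compactly_supported_prob_def)
  have sets [measurable_cong]: "sets \<mu> = sets borel" using cs by (simp add: compactly_supported_prob_def)
  obtain B where B: "B > 0" "AE x in \<mu>. norm x < B" by (rule compactly_supported_bound[OF cs])
  have int: "integrable \<mu> (\<lambda>x. complex_of_real (x ^ i))" for i
  proof (rule integrable_const_bound[where B = "B ^ i"])
    show "AE x in \<mu>. norm (complex_of_real (x ^ i)) \<le> B ^ i"
      using B(2) by eventually_elim (auto simp: norm_power intro: power_mono)
  qed measurable
  note lin = clinearD[OF assms(2), unfolded scaleC_complex_def]
  have "\<phi> (poly_at p a) = (\<Sum>i\<le>degree p. coeff p i * (\<integral>x. complex_of_real (x ^ i) \<partial>\<mu>))"
    unfolding integral_complex_of_real by (simp add: poly_at_def lin mom)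
  also have "\<dots> = (\<integral>x. (\<Sum>i\<le>degree p. coeff p i * complex_of_real (x ^ i)) \<partial>\<mu>)"
    by (simp add: int Bochner_Integration.integral_sum del: of_real_power)
  finally show ?thesis by (simp add: poly_altdef)
qed

text \<open>A strict bound, so that \<open>B + \<bar>x\<bar>\<close> strictly dominates the distance
  from \<open>x\<close> almost everywhere and is a valid radius for a peak at
  \<open>x\<close>.\<close>

definition support_bound :: "'s::real_normed_vector measure \<Rightarrow> real \<Rightarrow> bool"
  where "support_bound \<mu> B \<longleftrightarrow> (AE p in \<mu>. norm p < B)"

lemma support_bound_mono: "support_bound \<mu> B \<Longrightarrow> B \<le> B' \<Longrightarrow> support_bound \<mu> B'"
  unfolding support_bound_def by (erule eventually_mono) simp

lemma pair_peak_limit: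
  assumes "pair_distribution \<phi> (a, b) \<eta>" "clinear \<phi>" "support_bound \<eta> B"
  shows "(\<lambda>k. \<phi> (poly_at (peak x (B + \<bar>x\<bar>) k) a * poly_at (peak z (B + \<bar>z\<bar>) k) b)) \<longlonglongrightarrow> of_real (measure \<eta> {(x, z)})"
    and "(\<lambda>k. \<phi> (poly_at (peak x (B + \<bar>x\<bar>) k) a)) \<longlonglongrightarrow> of_real (measure (fst_marginal \<eta>) {x})"
    and "(\<lambda>k. \<phi> (poly_at (peak z (B + \<bar>z\<bar>) k) b)) \<longlonglongrightarrow> of_real (measure (snd_marginal \<eta>) {z})"
proof -
  have cs: "compactly_supported_prob \<eta>" using assms(1) by (auto simp: pair_distribution_def)
  interpret prob_space \<eta> using cs by (simp add: compactly_supported_prob_def)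
  have sets [measurable_cong]: "sets \<eta> = sets borel" using cs by (simp add: compactly_supported_prob_def)
  have space: "space \<eta> = UNIV" using sets_eq_imp_space_eq[OF sets] by simp
  note meas [measurable] = fst_snd_measurable[OF sets]
  have fin: "finite_measure \<eta>" by unfold_locales
  have bf: "AE p in \<eta>. \<bar>fst p - x\<bar> < B + \<bar>x\<bar>" for x
    using assms(3) unfolding support_bound_def
  proof eventually_elim
    case (elim p)
    then show ?case using norm_fst_le[of "fst p" "snd p"] by (simp del: norm_fst_le)
  qed
  have bs: "AE p in \<eta>. \<bar>snd p - x\<bar> < B + \<bar>x\<bar>" for x
    using assms(3) unfolding support_bound_def
  proof eventually_elim
    case (elim p)
    then show ?case using norm_snd_le[of "snd p" "fst p"] by (simp del: norm_snd_le)
  qed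
  \<comment> \<open>The constant 0 as second function, at the point 0 and with radius 1, contributes
    the factor 1.\<close>
  have b1: "AE p in \<eta>. \<bar>(0::real) - 0\<bar> < 1" by simp
  have E: "{p \<in> space \<eta>. fst p = x \<and> snd p = z} = {(x, z)}" by (auto simp: space)
  have m1: "measure (fst_marginal \<eta>) {x} = measure \<eta> {p \<in> space \<eta>. fst p = x \<and> (0::real) = 0}"
    by (simp add: fst_marginal_def measure_distr vimage_def space)
  have m2: "measure (snd_marginal \<eta>) {z} = measure \<eta> {p \<in> space \<eta>. snd p = z \<and> (0::real) = 0}"
    by (simp add: snd_marginal_def measure_distr vimage_def space)
  have 1: "\<phi> (poly_at (peak x (B + \<bar>x\<bar>) k) a * poly_at (peak z (B + \<bar>z\<bar>) k) b) =
      of_real (\<integral>p. (1 - ((fst p - x) / (B + \<bar>x\<bar>))\<^sup>2) ^ k * (1 - ((snd p - z) / (B + \<bar>z\<bar>))\<^sup>2) ^ k \<partial>\<eta>)" for k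
    unfolding pair_moments[OF assms(1,2)] poly_peak of_real_mult[symmetric] integral_complex_of_real ..
  show "(\<lambda>k. \<phi> (poly_at (peak x (B + \<bar>x\<bar>) k) a * poly_at (peak z (B + \<bar>z\<bar>) k) b)) \<longlonglongrightarrow> of_real (measure \<eta> {(x, z)})"
    unfolding 1 using peak_integral_limit[OF fin meas bf bs, of x z] unfolding E by (rule tendsto_of_real)
  have 2: "\<phi> (poly_at (peak x (B + \<bar>x\<bar>) k) a) = of_real (\<integral>p. (1 - ((fst p - x) / (B + \<bar>x\<bar>))\<^sup>2) ^ k \<partial>\<eta>)" for k
    using pair_moments[OF assms(1,2), of "peak x (B + \<bar>x\<bar>) k" 1]
    by (simp add: poly_peak flip: integral_complex_of_real)
  show "(\<lambda>k. \<phi> (poly_at (peak x (B + \<bar>x\<bar>) k) a)) \<longlonglongrightarrow> of_real (measure (fst_marginal \<eta>) {x})"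
    unfolding 2 m1 using peak_integral_limit[OF fin meas(1) borel_measurable_const bf b1, of x] by (intro tendsto_of_real) simp
  have 3: "\<phi> (poly_at (peak z (B + \<bar>z\<bar>) k) b) = of_real (\<integral>p. (1 - ((snd p - z) / (B + \<bar>z\<bar>))\<^sup>2) ^ k \<partial>\<eta>)" for k
    using pair_moments[OF assms(1,2), of 1 "peak z (B + \<bar>z\<bar>) k"]
    by (simp add: poly_peak flip: integral_complex_of_real)
  show "(\<lambda>k. \<phi> (poly_at (peak z (B + \<bar>z\<bar>) k) b)) \<longlonglongrightarrow> of_real (measure (snd_marginal \<eta>) {z})"
    unfolding 3 m2 using peak_integral_limit[OF fin meas(2) borel_measurable_const bs b1, of z] by (intro tendsto_of_real) simp
qed

lemma single_peak_limit:
  assumes "distribution \<phi> a \<mu>" "clinear \<phi>" "support_bound \<mu> B"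
  shows "(\<lambda>k. \<phi> (poly_at (peak x (B + \<bar>x\<bar>) k) a)) \<longlonglongrightarrow> of_real (measure \<mu> {x})"
proof -
  have cs: "compactly_supported_prob \<mu>" using assms(1) by (auto simp: distribution_def)
  interpret prob_space \<mu> using cs by (simp add: compactly_supported_prob_def)
  have sets [measurable_cong]: "sets \<mu> = sets borel" using cs by (simp add: compactly_supported_prob_def)
  have space: "space \<mu> = UNIV" using sets_eq_imp_space_eq[OF sets] by simp
  have fin: "finite_measure \<mu>" by unfold_locales
  have b: "AE p in \<mu>. \<bar>p - x\<bar> < B + \<bar>x\<bar>"
    using assms(3) unfolding support_bound_def by eventually_elim simp
  have b1: "AE p in \<mu>. \<bar>(0::real) - 0\<bar> < 1" by simp
  have 1: "\<phi> (poly_at (peak x (B + \<bar>x\<bar>) k) a) = of_real (\<integral>p. (1 - ((p - x) / (B + \<bar>x\<bar>))\<^sup>2) ^ k \<partial>\<mu>)" for k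
    by (simp add: single_moments[OF assms(1,2)] poly_peak flip: integral_complex_of_real)
  have "(\<lambda>p. p) \<in> borel_measurable \<mu>" by measurable
  from peak_integral_limit[OF fin this borel_measurable_const b b1]
  show ?thesis unfolding 1 by (intro tendsto_of_real) (simp add: space)
qed

section \<open>Moments of free sums\<close>

lemma not_successively_split:
  assumes "\<not> successively P xs"
  obtains us x y vs where "xs = us @ x # y # vs" "\<not> P x y"
proof -
  have "\<exists>us x y vs. xs = us @ x # y # vs \<and> \<not> P x y"
    using assms
  proof (induction xs)
    case (Cons a xs)
    show ?case
    proof (cases xs)
      case Nil
      then show ?thesis using Cons.prems by simp
    next
      case (Cons c cs)
      show ?thesis
      proof (cases "P a c")
        case True
        then have "\<not> successively P xs" using Cons.prems \<open>xs = c # cs\<close> by simp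
        with Cons.IH obtain us x y vs where "xs = us @ x # y # vs" "\<not> P x y" by blast
        then show ?thesis by (metis append_Cons)
      next
        case False
        then show ?thesis using \<open>xs = c # cs\<close> by (metis append_Nil)
      qed
    qed
  qed simp
  with that show thesis by blast
qed

text \<open>Neighbours with the same index merge into one polynomial. In an alternating product the
  factors are centred one at a time; each correction is a shorter product, and the fully centred
  nonempty product vanishes on both sides by freeness. Equal marginal moments let the same constants
  centre both sides.\<close>

lemma free_moments:
  fixes \<phi> :: "'a::cstar_algebra \<Rightarrow> complex" and \<psi> :: "'c::cstar_algebra \<Rightarrow> complex"
  assumes "clinear \<phi>" "clinear \<psi>" "\<phi> 1 = 1" "\<psi> 1 = 1"
    and fr: "free_elements \<phi> a\<^sub>1 a\<^sub>2" "free_elements \<psi> c\<^sub>1 c\<^sub>2"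
    and eq: "\<And>p. \<phi> (poly_at p a\<^sub>1) = \<psi> (poly_at p c\<^sub>1)" "\<And>p. \<phi> (poly_at p a\<^sub>2) = \<psi> (poly_at p c\<^sub>2)"
  shows "\<phi> (prod_list (map (\<lambda>(i, p). poly_at p (if i then a\<^sub>1 else a\<^sub>2)) ps)) =
    \<psi> (prod_list (map (\<lambda>(i, p). poly_at p (if i then c\<^sub>1 else c\<^sub>2)) ps))"
proof (induction "length ps" arbitrary: ps rule: less_induct)
  case less
  let ?A = "\<lambda>(i, p). poly_at p (if i then a\<^sub>1 else a\<^sub>2)" and ?C = "\<lambda>(i, p). poly_at p (if i then c\<^sub>1 else c\<^sub>2)"
  note lin = clinearD[OF assms(1), unfolded scaleC_complex_def] clinearD[OF assms(2), unfolded scaleC_complex_def]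
  have e: "\<psi> (?C ip) = \<phi> (?A ip)" for ip using eq by (cases ip) simp
  show ?case
  proof (cases "successively (\<lambda>p q. fst p \<noteq> fst q) ps")
    case False
    then obtain us x y vs where "ps = us @ x # y # vs" "fst x = fst y"
      by (rule not_successively_split) blast
    then obtain i p q where ps: "ps = us @ (i, p) # (i, q) # vs" by (cases x; cases y) auto
    have "\<phi> (prod_list (map ?A (us @ (i, p * q) # vs))) = \<psi> (prod_list (map ?C (us @ (i, p * q) # vs)))"
      by (rule less) (simp add: ps)
    then show ?thesis by (simp add: ps poly_at_mult mult.assoc)
  next
    case True
    define ctr where "ctr ip = (fst ip, snd ip - [:\<phi> (?A ip):])" for ip
    have A: "?A (ctr ip) = ?A ip - \<phi> (?A ip) *\<^sub>C 1" and C: "?C (ctr ip) = ?C ip - \<phi> (?A ip) *\<^sub>C 1" for ip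
      by (cases ip; simp add: ctr_def poly_at_diff poly_at_pCons)+
    have z: "\<phi> (?A (ctr ip)) = 0" "\<psi> (?C (ctr ip)) = 0" for ip
      unfolding A C by (simp_all only: lin e assms(3,4) mult_1_right diff_self)
    \<comment> \<open>The factors of \<open>xs\<close> are already centred, those of
      \<open>ys\<close> not yet.\<close>
    have "\<phi> (prod_list (map ?A (map ctr xs @ ys))) = \<psi> (prod_list (map ?C (map ctr xs @ ys)))"
      if "ps = xs @ ys" for xs ys
      using that
    proof (induction ys arbitrary: xs)
      case Nil
      show ?case
      proof (cases "xs = []")
        case True
        then show ?thesis using assms(3,4) by simp
      next
        case False
        have s: "successively (\<lambda>p q. fst p \<noteq> fst q) (map ctr xs)"
          using True Nil by (simp add: successively_map ctr_def)
        have b: "\<forall>(i, p)\<in>set (map ctr xs). \<phi> (poly_at p (if i then a\<^sub>1 else a\<^sub>2)) = 0 \<and>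
            \<psi> (poly_at p (if i then c\<^sub>1 else c\<^sub>2)) = 0"
        proof clarify
          fix i p assume "(i, p) \<in> set (map ctr xs)"
          then obtain ip where ip: "(i, p) = ctr ip" by auto
          from z[of ip, folded ip] show "\<phi> (poly_at p (if i then a\<^sub>1 else a\<^sub>2)) = 0 \<and>
            \<psi> (poly_at p (if i then c\<^sub>1 else c\<^sub>2)) = 0" by simp
        qed
        have "\<phi> (prod_list (map ?A (map ctr xs))) = 0"
          by (rule fr(1)[unfolded free_elements_def, rule_format]) (use False s b in blast)
        moreover have "\<psi> (prod_list (map ?C (map ctr xs))) = 0"
          by (rule fr(2)[unfolded free_elements_def, rule_format]) (use False s b in blast)
        ultimately show ?thesis by simp
      qed
    next
      case (Cons ip ys)
      let ?k = "\<phi> (?A ip)"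
      have 1: "\<phi> (prod_list (map ?A (map ctr (xs @ [ip]) @ ys))) = \<psi> (prod_list (map ?C (map ctr (xs @ [ip]) @ ys)))"
        by (rule Cons.IH) (simp add: Cons.prems)
      have 2: "\<phi> (prod_list (map ?A (map ctr xs @ ys))) = \<psi> (prod_list (map ?C (map ctr xs @ ys)))"
        by (rule less) (simp add: Cons.prems)
      have "prod_list (map ?A (map ctr xs @ ip # ys)) =
          prod_list (map ?A (map ctr (xs @ [ip]) @ ys)) + ?k *\<^sub>C prod_list (map ?A (map ctr xs @ ys))"
        by (simp add: A[of ip] left_diff_distrib right_diff_distrib mult_scaleC)
      moreover have "prod_list (map ?C (map ctr xs @ ip # ys)) =
          prod_list (map ?C (map ctr (xs @ [ip]) @ ys)) + ?k *\<^sub>C prod_list (map ?C (map ctr xs @ ys))"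
        by (simp add: C[of ip] left_diff_distrib right_diff_distrib mult_scaleC)
      ultimately show ?case by (simp only: lin 1 2)
    qed
    from this[of "[]" ps] show ?thesis by simp
  qed
qed

lemma free_sum_moments:
  fixes \<phi> :: "'a::cstar_algebra \<Rightarrow> complex" and \<psi> :: "'c::cstar_algebra \<Rightarrow> complex"
  assumes "clinear \<phi>" "clinear \<psi>" "\<phi> 1 = 1" "\<psi> 1 = 1"
    and "free_elements \<phi> a\<^sub>1 a\<^sub>2" "free_elements \<psi> c\<^sub>1 c\<^sub>2"
    and "\<And>p. \<phi> (poly_at p a\<^sub>1) = \<psi> (poly_at p c\<^sub>1)" "\<And>p. \<phi> (poly_at p a\<^sub>2) = \<psi> (poly_at p c\<^sub>2)"
  shows "\<phi> (poly_at p (a\<^sub>1 + a\<^sub>2)) = \<psi> (poly_at p (c\<^sub>1 + c\<^sub>2))"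
proof -
  let ?A = "\<lambda>(i, p). poly_at p (if i then a\<^sub>1 else a\<^sub>2)" and ?C = "\<lambda>(i, p). poly_at p (if i then c\<^sub>1 else c\<^sub>2)"
  note lin = clinearD[OF assms(1), unfolded scaleC_complex_def] clinearD[OF assms(2), unfolded scaleC_complex_def]
  \<comment> \<open>The prefix \<open>ps\<close> collects the summands already chosen while the
    power is expanded.\<close>
  have "\<phi> (prod_list (map ?A ps) * (a\<^sub>1 + a\<^sub>2) ^ n) = \<psi> (prod_list (map ?C ps) * (c\<^sub>1 + c\<^sub>2) ^ n)" for n ps
  proof (induction n arbitrary: ps)
    case 0
    then show ?case using free_moments[OF assms] by simp
  next
    case (Suc n)
    let ?X = "[:0, 1:] :: complex poly"
    have "prod_list (map ?A ps) * (a\<^sub>1 + a\<^sub>2) ^ Suc n =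
        prod_list (map ?A (ps @ [(True, ?X)])) * (a\<^sub>1 + a\<^sub>2) ^ n + prod_list (map ?A (ps @ [(False, ?X)])) * (a\<^sub>1 + a\<^sub>2) ^ n"
      by (simp add: poly_at_linear distrib_left distrib_right mult.assoc)
    moreover have "prod_list (map ?C ps) * (c\<^sub>1 + c\<^sub>2) ^ Suc n =
        prod_list (map ?C (ps @ [(True, ?X)])) * (c\<^sub>1 + c\<^sub>2) ^ n + prod_list (map ?C (ps @ [(False, ?X)])) * (c\<^sub>1 + c\<^sub>2) ^ n"
      by (simp add: poly_at_linear distrib_left distrib_right mult.assoc)
    ultimately show ?case by (simp only: lin Suc)
  qed
  from this[of "[]"] have "\<phi> ((a\<^sub>1 + a\<^sub>2) ^ n) = \<psi> ((c\<^sub>1 + c\<^sub>2) ^ n)" for n by simp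
  then show ?thesis by (simp add: poly_at_def lin)
qed

lemma free_convolution_support:
  assumes "free_convolution TYPE('c::cstar_algebra) \<mu>\<^sub>1 \<mu>\<^sub>2 \<mu>"
  shows "compactly_supported_prob \<mu>"
proof -
  obtain \<psi> :: "'c \<Rightarrow> complex" and c\<^sub>1 c\<^sub>2 where "distribution \<psi> (c\<^sub>1 + c\<^sub>2) \<mu>"
    using assms unfolding free_convolution_def by blast
  then show ?thesis by (simp add: distribution_def)
qed

text \<open>The convolution may be realized on another algebra; freeness and equal marginal moments
  carry its moments over to \<open>a\<^sub>1 + a\<^sub>2\<close>.\<close>

lemma free_convolution_peak:
  assumes conv: "free_convolution TYPE('c::cstar_algebra) \<mu>\<^sub>1 \<mu>\<^sub>2 \<mu>"
    and st: "clinear \<phi>" "\<phi> 1 = 1" "free_elements \<phi> a\<^sub>1 a\<^sub>2"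
    and mom: "\<And>p. \<phi> (poly_at p a\<^sub>1) = (\<integral>t. poly p (of_real t) \<partial>\<mu>\<^sub>1)" "\<And>p. \<phi> (poly_at p a\<^sub>2) = (\<integral>t. poly p (of_real t) \<partial>\<mu>\<^sub>2)"
    and B: "support_bound \<mu> B"
  shows "(\<lambda>k. \<phi> (poly_at (peak x (B + \<bar>x\<bar>) k) (a\<^sub>1 + a\<^sub>2))) \<longlonglongrightarrow> of_real (measure \<mu> {x})"
proof -
  obtain \<psi> :: "'c \<Rightarrow> complex" and c\<^sub>1 c\<^sub>2 where c: "faithful_state \<psi>" "free_elements \<psi> c\<^sub>1 c\<^sub>2"
    "distribution \<psi> c\<^sub>1 \<mu>\<^sub>1" "distribution \<psi> c\<^sub>2 \<mu>\<^sub>2" "distribution \<psi> (c\<^sub>1 + c\<^sub>2) \<mu>"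
    using conv unfolding free_convolution_def by blast
  have l: "clinear \<psi>" "\<psi> 1 = 1" using c(1) by (auto simp: faithful_state_def)
  have "\<phi> (poly_at p (a\<^sub>1 + a\<^sub>2)) = \<psi> (poly_at p (c\<^sub>1 + c\<^sub>2))" for p
    by (rule free_sum_moments[OF st(1) l(1) st(2) l(2) st(3) c(2)])
      (simp_all add: mom single_moments[OF c(3) l(1)] single_moments[OF c(4) l(1)])
  then show ?thesis using single_peak_limit[OF c(5) l(1) B] by simp
qed

lemma marginal_moments:
  assumes "pair_distribution \<phi> (a, b) \<eta>" "clinear \<phi>"
  shows "\<phi> (poly_at p a) = (\<integral>t. poly p (of_real t) \<partial>fst_marginal \<eta>)"
    and "\<phi> (poly_at p b) = (\<integral>t. poly p (of_real t) \<partial>snd_marginal \<eta>)"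
proof -
  have sets: "sets \<eta> = sets borel" using assms(1) by (auto simp: pair_distribution_def compactly_supported_prob_def)
  note meas = fst_snd_measurable[OF sets]
  have p: "(\<lambda>t. poly p (complex_of_real t)) \<in> borel_measurable borel"
    by (auto intro!: borel_measurable_continuous_onI continuous_intros)
  show "\<phi> (poly_at p a) = (\<integral>t. poly p (of_real t) \<partial>fst_marginal \<eta>)"
    using pair_moments[OF assms, of p 1] by (simp add: fst_marginal_def integral_distr[OF meas(1) p])
  show "\<phi> (poly_at p b) = (\<integral>t. poly p (of_real t) \<partial>snd_marginal \<eta>)"
    using pair_moments[OF assms, of 1 p] by (simp add: snd_marginal_def integral_distr[OF meas(2) p])
qed

lemma marginal_atom:
  assumes "pair_distribution \<phi> (a, b) \<eta>"
  shows "measure \<eta> {(x, z)} \<le> measure (fst_marginal \<eta>) {x}" "measure \<eta> {(x, z)} \<le> measure (snd_marginal \<eta>) {z}"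
proof -
  have cs: "compactly_supported_prob \<eta>" using assms by (auto simp: pair_distribution_def)
  interpret prob_space \<eta> using cs by (simp add: compactly_supported_prob_def)
  have sets: "sets \<eta> = sets borel" using cs by (simp add: compactly_supported_prob_def)
  have space: "space \<eta> = UNIV" using sets_eq_imp_space_eq[OF sets] by simp
  note meas = fst_snd_measurable[OF sets]
  have "fst -` {x} \<inter> space \<eta> \<in> sets \<eta>" "snd -` {z} \<inter> space \<eta> \<in> sets \<eta>"
    using meas by (auto intro: measurable_sets)
  then show "measure \<eta> {(x, z)} \<le> measure (fst_marginal \<eta>) {x}" "measure \<eta> {(x, z)} \<le> measure (snd_marginal \<eta>) {z}"
    unfolding fst_marginal_def snd_marginal_def
    by (simp_all add: measure_distr meas) (auto intro!: finite_measure_mono simp: space)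
qed

section \<open>From peaks to the measures\<close>

theorem corollary3p7:
  fixes \<phi> :: "'a::cstar_algebra \<Rightarrow> complex"
    and a\<^sub>1 b\<^sub>1 a\<^sub>2 b\<^sub>2 :: 'a
    and \<eta>\<^sub>1 \<eta>\<^sub>2 \<eta> :: "(real \<times> real) measure"
    and \<mu>\<^sub>1 \<mu>\<^sub>2 \<mu> \<nu>\<^sub>1 \<nu>\<^sub>2 \<nu> :: "real measure"
    and \<xi> \<zeta> :: real
  assumes "faithful_state \<phi>"
    and "self_adjoint_pair (a\<^sub>1, b\<^sub>1)" "self_adjoint_pair (a\<^sub>2, b\<^sub>2)"
    and "bi_partite (a\<^sub>1, b\<^sub>1)" "bi_partite (a\<^sub>2, b\<^sub>2)"
    and "bi_free TYPE('x::complex_vector) TYPE('y::complex_vector) \<phi> (a\<^sub>1, b\<^sub>1) (a\<^sub>2, b\<^sub>2)"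
    and eta\<^sub>1: "pair_distribution \<phi> (a\<^sub>1, b\<^sub>1) \<eta>\<^sub>1"
    and eta\<^sub>2: "pair_distribution \<phi> (a\<^sub>2, b\<^sub>2) \<eta>\<^sub>2"
    and mu: "\<mu>\<^sub>1 = fst_marginal \<eta>\<^sub>1" "\<mu>\<^sub>2 = fst_marginal \<eta>\<^sub>2"
    and nu: "\<nu>\<^sub>1 = snd_marginal \<eta>\<^sub>1" "\<nu>\<^sub>2 = snd_marginal \<eta>\<^sub>2"
    and bi_free_convolution: "pair_distribution \<phi> (a\<^sub>1 + a\<^sub>2, b\<^sub>1 + b\<^sub>2) \<eta>"
    and free_convolution_mu: "free_convolution TYPE('c::cstar_algebra) \<mu>\<^sub>1 \<mu>\<^sub>2 \<mu>"
    and free_convolution_nu: "free_convolution TYPE('d::cstar_algebra) \<nu>\<^sub>1 \<nu>\<^sub>2 \<nu>"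
    and atom: "measure \<eta> {(\<xi>, \<zeta>)} > 0"
  shows "\<exists>\<xi>\<^sub>1 \<zeta>\<^sub>1 \<xi>\<^sub>2 \<zeta>\<^sub>2.
    (\<xi>\<^sub>1 + \<xi>\<^sub>2, \<zeta>\<^sub>1 + \<zeta>\<^sub>2) = (\<xi>, \<zeta>) \<and>
    measure \<eta>\<^sub>1 {(\<xi>\<^sub>1, \<zeta>\<^sub>1)} > 0 \<and> measure \<eta>\<^sub>2 {(\<xi>\<^sub>2, \<zeta>\<^sub>2)} > 0 \<and>
    1 + measure \<mu> {\<xi>} * measure \<nu> {\<zeta>} / measure \<eta> {(\<xi>, \<zeta>)} =
      measure \<mu>\<^sub>1 {\<xi>\<^sub>1} * measure \<nu>\<^sub>1 {\<zeta>\<^sub>1} / measure \<eta>\<^sub>1 {(\<xi>\<^sub>1, \<zeta>\<^sub>1)} +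
      measure \<mu>\<^sub>2 {\<xi>\<^sub>2} * measure \<nu>\<^sub>2 {\<zeta>\<^sub>2} / measure \<eta>\<^sub>2 {(\<xi>\<^sub>2, \<zeta>\<^sub>2)}"
proof -
  have lin: "clinear \<phi>" using assms(1) by (simp add: faithful_state_def)
  have state: "cstar_state \<phi>"
    unfolding cstar_state_def using assms(1) by (auto simp: faithful_state_def)
  then interpret cstar_state \<phi> .
  have adj: "adj a\<^sub>1 = a\<^sub>1" "adj a\<^sub>2 = a\<^sub>2" "adj b\<^sub>1 = b\<^sub>1" "adj b\<^sub>2 = b\<^sub>2"
    using assms(2,3) by (simp_all add: self_adjoint_pair_def)
  obtain T\<^sub>1 T\<^sub>2 S\<^sub>1 S\<^sub>2 where
    G: "models \<phi> {(a\<^sub>1, lop (Inl :: 'x \<Rightarrow> 'x + 'y) T\<^sub>1), (a\<^sub>2, lop Inr T\<^sub>2), (b\<^sub>1, rop Inl S\<^sub>1), (b\<^sub>2, rop Inr S\<^sub>2)}"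
    and H: "models \<phi> {(b\<^sub>1, lop (Inl :: 'x \<Rightarrow> 'x + 'y) S\<^sub>1), (b\<^sub>2, lop Inr S\<^sub>2)}"
    by (rule bi_free_models[OF assms(6) lin])
  have lr: "letter (Inr :: 'y \<Rightarrow> 'x + 'y) (\<not> True)" using letter_Inr by simp
  have "model (Inl :: 'x \<Rightarrow> 'x + 'y) Inr True \<phi> a\<^sub>1 a\<^sub>2 T\<^sub>1 T\<^sub>2"
    by (rule model.intro[OF letter_Inl lr model_axioms.intro[OF models_subset[OF G]]]) blast
  then have fa: "free_pair \<phi> a\<^sub>1 a\<^sub>2" by (rule model.free_pair)
  have "model (Inl :: 'x \<Rightarrow> 'x + 'y) Inr True \<phi> b\<^sub>1 b\<^sub>2 S\<^sub>1 S\<^sub>2"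
    by (rule model.intro[OF letter_Inl lr model_axioms.intro[OF H]])
  then have fb: "free_pair \<phi> b\<^sub>1 b\<^sub>2" by (rule model.free_pair)
  have cs: "compactly_supported_prob \<eta>\<^sub>1" "compactly_supported_prob \<eta>\<^sub>2" "compactly_supported_prob \<eta>"
    using eta\<^sub>1 eta\<^sub>2 bi_free_convolution by (simp_all add: pair_distribution_def)
  have cs': "compactly_supported_prob \<mu>" "compactly_supported_prob \<nu>"
    using free_convolution_support[OF free_convolution_mu] free_convolution_support[OF free_convolution_nu] .
  obtain C\<^sub>1 where C1: "C\<^sub>1 > 0" "support_bound \<eta>\<^sub>1 C\<^sub>1"
    by (rule compactly_supported_bound[OF cs(1), folded support_bound_def])
  obtain C\<^sub>2 where C2: "C\<^sub>2 > 0" "support_bound \<eta>\<^sub>2 C\<^sub>2"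
    by (rule compactly_supported_bound[OF cs(2), folded support_bound_def])
  obtain C\<^sub>3 where C3: "C\<^sub>3 > 0" "support_bound \<eta> C\<^sub>3"
    by (rule compactly_supported_bound[OF cs(3), folded support_bound_def])
  obtain C\<^sub>4 where C4: "C\<^sub>4 > 0" "support_bound \<mu> C\<^sub>4"
    by (rule compactly_supported_bound[OF cs'(1), folded support_bound_def])
  obtain C\<^sub>5 where C5: "C\<^sub>5 > 0" "support_bound \<nu> C\<^sub>5"
    by (rule compactly_supported_bound[OF cs'(2), folded support_bound_def])
  \<comment> \<open>One bound for all five supports, so that a single radius at each point serves
    every peak sequence.\<close>
  define B where "B = C\<^sub>1 + C\<^sub>2 + C\<^sub>3 + C\<^sub>4 + C\<^sub>5"
  have B: "B > 0" "support_bound \<eta>\<^sub>1 B" "support_bound \<eta>\<^sub>2 B" "support_bound \<eta> B" "support_bound \<mu> B" "support_bound \<nu> B"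
    using C1(1) C2(1) C3(1) C4(1) C5(1)
    by (simp_all add: B_def support_bound_mono[OF C1(2)] support_bound_mono[OF C2(2)]
        support_bound_mono[OF C3(2)] support_bound_mono[OF C4(2)] support_bound_mono[OF C5(2)])
  have ps: "peak_seq \<phi> h x (B + \<bar>x\<bar>) m"
    if "adj h = h" "(\<lambda>k. \<phi> (poly_at (peak x (B + \<bar>x\<bar>) k) h)) \<longlonglongrightarrow> of_real m" for h x m
    using that B(1) by (intro peak_seq.intro state peak_seq_axioms.intro) auto
  note l1 = pair_peak_limit[OF eta\<^sub>1 lin B(2)] and l2 = pair_peak_limit[OF eta\<^sub>2 lin B(3)]
    and l = pair_peak_limit[OF bi_free_convolution lin B(4)]
  have pa: "peak_seq \<phi> (a\<^sub>1 + a\<^sub>2) \<xi> (B + \<bar>\<xi>\<bar>) (measure \<mu> {\<xi>})"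
    by (rule ps[OF _ free_convolution_peak[OF free_convolution_mu lin one free_pair.free[OF fa] _ _ B(5)]])
      (simp_all add: adj adj_add mu marginal_moments[OF eta\<^sub>1 lin] marginal_moments[OF eta\<^sub>2 lin])
  have pb: "peak_seq \<phi> (b\<^sub>1 + b\<^sub>2) \<zeta> (B + \<bar>\<zeta>\<bar>) (measure \<nu> {\<zeta>})"
    by (rule ps[OF _ free_convolution_peak[OF free_convolution_nu lin one free_pair.free[OF fb] _ _ B(6)]])
      (simp_all add: adj adj_add nu marginal_moments[OF eta\<^sub>1 lin] marginal_moments[OF eta\<^sub>2 lin])
  \<comment> \<open>Both sides are limits of the same values of \<phi> at peaks. Positivity follows
    because a marginal atom dominates the joint one.\<close>
  have "measure \<mu> {\<xi>} = measure (fst_marginal \<eta>) {\<xi>}" "measure \<nu> {\<zeta>} = measure (snd_marginal \<eta>) {\<zeta>}"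
    using LIMSEQ_unique[OF peak_seq.lim[OF pa] l(2)] LIMSEQ_unique[OF peak_seq.lim[OF pb] l(3)] by simp_all
  then have pos: "measure \<mu> {\<xi>} > 0" "measure \<nu> {\<zeta>} > 0"
    using marginal_atom[OF bi_free_convolution, of \<xi> \<zeta>] atom by simp_all
  have bip: "\<phi> (alt_sum_suf y\<^sub>1 y\<^sub>2 N * alt_sum_suf u\<^sub>1 u\<^sub>2 N) = alt_sum (\<phi> (y\<^sub>1 * u\<^sub>1)) (\<phi> (y\<^sub>2 * u\<^sub>2)) N"
    if "y\<^sub>1 = poly_at p\<^sub>1 a\<^sub>1" "y\<^sub>2 = poly_at p\<^sub>2 a\<^sub>2" "\<phi> y\<^sub>1 = 0" "\<phi> y\<^sub>2 = 0"
      "u\<^sub>1 = poly_at q\<^sub>1 b\<^sub>1" "u\<^sub>2 = poly_at q\<^sub>2 b\<^sub>2" "\<phi> u\<^sub>1 = 0" "\<phi> u\<^sub>2 = 0"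
    for y\<^sub>1 y\<^sub>2 u\<^sub>1 u\<^sub>2 p\<^sub>1 p\<^sub>2 q\<^sub>1 q\<^sub>2 N
    unfolding alt_sum_suf_def alt_sum_def by (rule bi_pairing[OF letter_Inl lr G that])
  obtain \<xi>\<^sub>1 \<xi>\<^sub>2 \<zeta>\<^sub>1 \<zeta>\<^sub>2 where "\<xi>\<^sub>1 + \<xi>\<^sub>2 = \<xi>" "\<zeta>\<^sub>1 + \<zeta>\<^sub>2 = \<zeta>"
    "measure \<eta>\<^sub>1 {(\<xi>\<^sub>1, \<zeta>\<^sub>1)} > 0" "measure \<eta>\<^sub>2 {(\<xi>\<^sub>2, \<zeta>\<^sub>2)} > 0"
    "1 + measure \<mu> {\<xi>} * measure \<nu> {\<zeta>} / measure \<eta> {(\<xi>, \<zeta>)} =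
      measure \<mu>\<^sub>1 {\<xi>\<^sub>1} * measure \<nu>\<^sub>1 {\<zeta>\<^sub>1} / measure \<eta>\<^sub>1 {(\<xi>\<^sub>1, \<zeta>\<^sub>1)} +
      measure \<mu>\<^sub>2 {\<xi>\<^sub>2} * measure \<nu>\<^sub>2 {\<zeta>\<^sub>2} / measure \<eta>\<^sub>2 {(\<xi>\<^sub>2, \<zeta>\<^sub>2)}"
  proof (rule bi_atoms[where K = "\<lambda>x. B + \<bar>x\<bar>" and \<mu>\<^sub>1 = "\<lambda>x. measure \<mu>\<^sub>1 {x}" and \<mu>\<^sub>2 = "\<lambda>x. measure \<mu>\<^sub>2 {x}"
      and \<nu>\<^sub>1 = "\<lambda>x. measure \<nu>\<^sub>1 {x}" and \<nu>\<^sub>2 = "\<lambda>x. measure \<nu>\<^sub>2 {x}"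
      and \<eta>\<^sub>1 = "\<lambda>x z. measure \<eta>\<^sub>1 {(x, z)}" and \<eta>\<^sub>2 = "\<lambda>x z. measure \<eta>\<^sub>2 {(x, z)}", OF fa fb adj _ pa pos(1) pb pos(2)])
    show "\<And>y\<^sub>1 y\<^sub>2 u\<^sub>1 u\<^sub>2 p\<^sub>1 p\<^sub>2 q\<^sub>1 q\<^sub>2 N. y\<^sub>1 = poly_at p\<^sub>1 a\<^sub>1 \<Longrightarrow> y\<^sub>2 = poly_at p\<^sub>2 a\<^sub>2 \<Longrightarrow>
        \<phi> y\<^sub>1 = 0 \<Longrightarrow> \<phi> y\<^sub>2 = 0 \<Longrightarrow> u\<^sub>1 = poly_at q\<^sub>1 b\<^sub>1 \<Longrightarrow> u\<^sub>2 = poly_at q\<^sub>2 b\<^sub>2 \<Longrightarrow> \<phi> u\<^sub>1 = 0 \<Longrightarrow> \<phi> u\<^sub>2 = 0 \<Longrightarrow>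
        \<phi> (alt_sum_suf y\<^sub>1 y\<^sub>2 N * alt_sum_suf u\<^sub>1 u\<^sub>2 N) = alt_sum (\<phi> (y\<^sub>1 * u\<^sub>1)) (\<phi> (y\<^sub>2 * u\<^sub>2)) N"
      by (rule bip)
    show "peak_seq \<phi> a\<^sub>1 x (B + \<bar>x\<bar>) (measure \<mu>\<^sub>1 {x})" for x unfolding mu by (rule ps[OF adj(1) l1(2)])
    show "peak_seq \<phi> a\<^sub>2 x (B + \<bar>x\<bar>) (measure \<mu>\<^sub>2 {x})" for x unfolding mu by (rule ps[OF adj(2) l2(2)])
    show "peak_seq \<phi> b\<^sub>1 x (B + \<bar>x\<bar>) (measure \<nu>\<^sub>1 {x})" for x unfolding nu by (rule ps[OF adj(3) l1(3)])
    show "peak_seq \<phi> b\<^sub>2 x (B + \<bar>x\<bar>) (measure \<nu>\<^sub>2 {x})" for x unfolding nu by (rule ps[OF adj(4) l2(3)])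
  qed (rule l1(1) l2(1) l(1) atom measure_nonneg | assumption)+
  then show ?thesis
    by (intro exI[of _ \<xi>\<^sub>1] exI[of _ \<zeta>\<^sub>1] exI[of _ \<xi>\<^sub>2] exI[of _ \<zeta>\<^sub>2]) simp
qed

end
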